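(* Let $d\ge 2$, $2<p\le\infty$ and $1/p<r<1/2$ (with $1/p:=0$ if $p=\infty$). There is a constant $C=C(p,d,r)>0$ such that for all integers $m\ge 2$ $$ d_m(\mathbf W^r_p,L_\infty)\le C\,m^{-r}(\log m)^{(d-2)(1-r)+1}. $$
   Context: All functions are $2\pi$-periodic in each of $d$ variables, i.e. defined on $\mathbb T^d$; $L_p=L_p(\mathbb T^d)$ with norm $\|\cdot\|_p$ (normalized Lebesgue measure). Kolmogorov widths: for a subset $\mathbf F$ of a Banach space $X$ and $m\ge1$, $$d_m(\mathbf F,X):=\inf_{\{u_i\}_{i=1}^m\subset X}\ \sup_{f\in\mathbf F}\ \inf_{c_1,\dots,c_m}\Big\|f-\sum_{i=1}^m c_iu_i\Big\|_X ,$$ where the $c_i$ are scalars. The class $\mathbf W^r_p$: for $r>0$ let $F_r(x):=1+2\sum_{k=1}^\infty k^{-r}\cos(kx-r\pi/2)$ be the univariate Bernoulli kernel and $F_r(\mathbf x):=\prod_{j=1}^dF_r(x_j)$ its multivariate analog. Then $\mathbf W^r_p$ is the class of functions $f$ representable as $$f(\mathbf x)=(\varphi\ast F_r)(\mathbf x):=(2\pi)^{-d}\int_{\mathbb T^d}\varphi(\mathbf y)F_r(\mathbf x-\mathbf y)\,d\mathbf y,\qquad \varphi\in L_p,\ \|\varphi\|_p\le1.$$ *)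

theory Defs
  imports "HOL-Analysis.Analysis" "HOL-Probability.Essential_Supremum"
begin

text \<open>
  Functions on the torus are functions on \<open>real ^ 'd\<close> that are \<open>2 * pi\<close>-periodic in each
  coordinate, and they are integrated over the fundamental domain \<open>[0, 2 * pi]^d\<close>. Elements of
  \<open>L\<^sub>p\<close> are represented by Borel functions; every Lebesgue measurable class
  contains one. Scalars are complex.
\<close>

definition torus_measure :: "(real ^ 'd) measure" where
  "torus_measure = uniform_measure lborel (cbox 0 (\<chi> i. 2 * pi))"

definition torus_periodic :: "(real ^ 'd \<Rightarrow> 'b) \<Rightarrow> bool" where
  "torus_periodic f \<longleftrightarrow> (\<forall>x i. f (x + axis i (2 * pi)) = f x)"

text \<open>The norm takes values in \<open>[0, \<infinity>]\<close>; it is meant for \<open>1 \<le> p \<le> \<infinity>\<close>.\<close>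

definition Lp_norm :: "ennreal \<Rightarrow> (real ^ 'd \<Rightarrow> complex) \<Rightarrow> ennreal" where
  "Lp_norm p f =
     (if p = \<infinity> then esssup torus_measure (\<lambda>x. ennreal (norm (f x)))
      else let I = (\<integral>\<^sup>+ x. ennreal (norm (f x) powr enn2real p) \<partial>torus_measure)
           in if I = \<infinity> then \<infinity> else ennreal (enn2real I powr (1 / enn2real p)))"

definition Lp_space :: "ennreal \<Rightarrow> (real ^ 'd \<Rightarrow> complex) set" where
  "Lp_space p = {f. f \<in> borel_measurable borel \<and> torus_periodic f \<and> Lp_norm p f < \<infinity>}"

text \<open>
  The Kolmogorov width \<open>d\<^sub>m(F, X)\<close> of a set \<open>F\<close> in a space \<open>X\<close> of functions with norm \<open>N\<close>. The norm
  is \<open>ennreal\<close>-valued, so that the infima and the supremum exist without side conditions.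
\<close>

definition kolmogorov_width ::
  "nat \<Rightarrow> ('a \<Rightarrow> complex) set \<Rightarrow> ('a \<Rightarrow> complex) set \<Rightarrow> (('a \<Rightarrow> complex) \<Rightarrow> ennreal) \<Rightarrow> ennreal" where
  "kolmogorov_width m F X N =
     (INF u \<in> {u :: nat \<Rightarrow> 'a \<Rightarrow> complex. \<forall>i<m. u i \<in> X}.
        SUP f \<in> F. INF c :: nat \<Rightarrow> complex. N (\<lambda>x. f x - (\<Sum>i<m. c i * u i x)))"

text \<open>
  For \<open>0 < r\<close> the series converges conditionally outside \<open>2 * pi * \<int>\<close>. The unspecified value of
  \<open>suminf\<close> on that null set does not affect the convolutions below.
\<close>

definition bernoulli_kernel :: "real \<Rightarrow> real \<Rightarrow> real" where
  "bernoulli_kernel r x =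
     1 + 2 * (\<Sum>k. real (Suc k) powr (- r) * cos (real (Suc k) * x - r * pi / 2))"

definition bernoulli_kernel_multi :: "real \<Rightarrow> real ^ 'd \<Rightarrow> real" where
  "bernoulli_kernel_multi r x = (\<Prod>j\<in>UNIV. bernoulli_kernel r (x $ j))"

definition torus_convolution ::
  "(real ^ 'd \<Rightarrow> complex) \<Rightarrow> (real ^ 'd \<Rightarrow> real) \<Rightarrow> real ^ 'd \<Rightarrow> complex" where
  "torus_convolution \<phi> K x = (LINT y|torus_measure. \<phi> y * complex_of_real (K (x - y)))"

definition W_class :: "real \<Rightarrow> ennreal \<Rightarrow> (real ^ 'd \<Rightarrow> complex) set" where
  "W_class r p =
     {torus_convolution \<phi> (bernoulli_kernel_multi r) | \<phi>. \<phi> \<in> Lp_space p \<and> Lp_norm p \<phi> \<le> 1}"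

end

theory Submission
  imports Defs "HOL-Probability.Probability" "HOL-Real_Asymp.Real_Asymp"
begin

text \<open>
  The convolution with the Bernoulli kernel is cut into smooth dyadic blocks indexed by
  \<open>s \<in> \<nat>\<^sup>d\<close>, grouped into layers \<open>\<bar>s\<bar>\<^sub>1 = l\<close>. With \<open>2 ^ n * n ^ (d - 1)\<close> comparable to \<open>m\<close>, the
  layers \<open>l \<le> n\<close> are reproduced exactly, and the layers beyond a large multiple of \<open>n\<close> are negligible since
  \<open>r > 1 / p\<close>. In between, \<open>\<phi>\<close> is split at a height \<open>t\<close>. The bounded part of \<open>\<phi>\<close> is estimated block by
  block and not approximated at all. The remaining part has \<open>L\<^sub>2\<close> norm at most \<open>t powr (1 - p / 2)\<close>
  and is approximated uniformly from a random subspace: the ball of \<open>L\<^sub>2\<close> in an \<open>N\<close>-dimensional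
  space of trigonometric polynomials has width at most a constant times
  \<open>sqrt (N * log N / m)\<close> in the uniform norm. The bounded part costs \<open>l ^ (d - 1)\<close>, the
  random one \<open>sqrt l\<close>; the two balance at the layer \<open>n + (2 * d - 3) * log n\<close>, which
  dominates and produces the exponent of the logarithm. The subspaces are given dimensions that
  decay geometrically away from this layer.

  The width of the \<open>L\<^sub>2\<close> ball follows by duality from a Gelfand number estimate: a random sign matrix
  almost preserves the norms of all \<open>k\<close>-term sums of the evaluation vectors, and Maurey's
  greedy argument approximates every point of their absolutely convex hull by such a sum,
  simultaneously in the norm and in the image of the matrix.
\<close>

section \<open>Uniform approximation of a Euclidean ball\<close>

text \<open>In the uniform norm the blocks of a layer are added by the triangle inequality, at the
  price \<open>l ^ (d - 1)\<close>; in L_2 the windows overlap boundedly and nothing is lost. Hence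
  the splitting of \<open>\<phi>\<close> by height. With about \<open>2 ^ n * n ^ (d - 1)\<close>
  random dimensions, layer \<open>l\<close> costs
  \<open>2 powr (- r * l) * 2 powr ((l - n) / 2) * sqrt n\<close>, which grows with \<open>l\<close>
  since \<open>r < 1 / 2\<close>, until it meets \<open>2 powr (- r * l) * n ^ (d - 1)\<close> where
  \<open>2 powr (l - n) = n powr (2 * d - 3)\<close>. At distance \<open>\<delta>\<close> beyond
  this layer the height is \<open>2 powr (\<theta> * \<delta>)\<close>: the bounded part decays if
  \<open>\<theta> < r\<close>, the rest if \<open>1 / 2 - r + \<theta> * (1 - p / 2) < 0\<close>.
  Any \<open>\<theta>\<close> strictly between \<open>1 / p\<close> and \<open>r\<close> satisfies
  both, so \<open>r > 1 / p\<close> serves here a second time. The critical error is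
  \<open>2 powr (- r * n) * n powr ((d - 1) - r * (2 * d - 3))\<close>, and since
  \<open>2 powr (- r * n)\<close> is comparable to
  \<open>m powr (- r) * n powr (r * (d - 1))\<close>, the exponent becomes
  \<open>(d - 2) * (1 - r) + 1\<close>.\<close>

text \<open>Termwise comparison of power series, by
  \<open>2 ^ n * fact n \<le> fact (2 * n)\<close>. This is the subgaussian bound for a single
  random sign.\<close>

lemma cosh_le_exp_half_square: "cosh x \<le> exp (x\<^sup>2 / 2)" for x :: real
proof -
  have fact_bound: "2 ^ n * fact n \<le> (fact (2 * n) :: real)" for n
  proof (induction n)
    case (Suc n)
    have "2 ^ Suc n * fact (Suc n) = (2 * real n + 2) * (2 ^ n * fact n :: real)"
      by simp
    also have "\<dots> \<le> (2 * real n + 2) * fact (2 * n)"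
      using Suc by (intro mult_left_mono) auto
    also have "\<dots> \<le> (2 * real n + 2) * ((2 * real n + 1) * fact (2 * n))"
      by (intro mult_left_mono) (auto simp: algebra_simps)
    finally show ?case by (simp add: algebra_simps)
  qed simp
  have "(\<lambda>n. if even n then x ^ n /\<^sub>R fact n else 0) sums cosh x"
    by (rule cosh_converges)
  then have "(\<lambda>n. x ^ (2 * n) /\<^sub>R fact (2 * n)) sums cosh x"
    by (subst (asm) sums_mono_reindex[of "\<lambda>n. 2 * n", symmetric])
       (auto simp: strict_mono_def elim!: evenE)
  moreover have "(\<lambda>n. (x\<^sup>2 / 2) ^ n /\<^sub>R fact n) sums exp (x\<^sup>2 / 2)"
    by (rule exp_converges)
  moreover have "x ^ (2 * n) /\<^sub>R fact (2 * n) \<le> (x\<^sup>2 / 2) ^ n /\<^sub>R fact n" for n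
  proof -
    have "x ^ (2 * n) / fact (2 * n) \<le> x ^ (2 * n) / (2 ^ n * fact n)"
      by (intro divide_left_mono fact_bound) auto
    then show ?thesis by (simp add: power_divide divide_simps mult.commute flip: power_mult)
  qed
  ultimately show ?thesis by (rule sums_le[rotated 1]) 
qed

text \<open>The derivative of the difference is \<open>exp (- t) - (1 - t)\<close>, which is
  nonnegative. Stopping at second order lets a second and a fourth moment control a Laplace
  transform.\<close>

lemma exp_neg_le_quadratic:
  fixes x :: real
  assumes "0 \<le> x"
  shows "exp (- x) \<le> 1 - x + x\<^sup>2 / 2"
proof -
  have "(\<lambda>t. 1 - t + t\<^sup>2 / 2 - exp (- t)) 0 \<le> (\<lambda>t. 1 - t + t\<^sup>2 / 2 - exp (- t)) x"
  proof (rule DERIV_nonneg_imp_nondecreasing[OF assms])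
    fix t :: real
    assume "0 \<le> t"
    have "((\<lambda>t. 1 - t + t\<^sup>2 / 2 - exp (- t)) has_real_derivative (-1 + t + exp (- t))) (at t)"
      by (auto intro!: derivative_eq_intros)
    moreover have "0 \<le> -1 + t + exp (- t)"
      using exp_ge_add_one_self[of "- t"] by simp
    ultimately show "\<exists>y. ((\<lambda>t. 1 - t + t\<^sup>2 / 2 - exp (- t)) has_real_derivative y) (at t) \<and> 0 \<le> y"
      by blast
  qed
  then show ?thesis by simp
qed

lemma exists_le_average:
  fixes f :: "'a \<Rightarrow> real"
  assumes "finite A" "A \<noteq> {}" "(\<Sum>a\<in>A. f a) \<le> real (card A) * c"
  shows "\<exists>a\<in>A. f a \<le> c"
proof (rule ccontr)
  assume "\<not> ?thesis"
  then have "(\<Sum>a\<in>A. c) < (\<Sum>a\<in>A. f a)"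
    using assms by (intro sum_strict_mono) auto
  then show False using assms by simp
qed

text \<open>A sign vector is encoded by the set where it is +1, so that expectations over random
  signs are averages over \<open>Pow Q\<close>.\<close>

definition signs :: "'q set \<Rightarrow> 'q \<Rightarrow> real" where
  "signs S k = (if k \<in> S then 1 else -1)"

definition fip :: "'q set \<Rightarrow> ('q \<Rightarrow> real) \<Rightarrow> ('q \<Rightarrow> real) \<Rightarrow> real" where
  "fip Q u v = (\<Sum>k\<in>Q. u k * v k)"

lemma fip_self: "fip Q y y = (\<Sum>k\<in>Q. (y k)\<^sup>2)"
  by (simp add: fip_def power2_eq_square)

lemma fip_self_nonneg: "0 \<le> fip Q y y"
  by (simp add: fip_self sum_nonneg)

lemma fip_self_eq_L2_set: "fip Q y y = (L2_set y Q)\<^sup>2"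
  by (simp add: fip_self L2_set_def sum_nonneg)

text \<open>Conditioning on the sign at \<open>a\<close>: the subsets of \<open>insert a Q\<close>
  are the sets \<open>S\<close> and \<open>insert a S\<close> with \<open>S\<close> in
  \<open>Pow Q\<close>. The moment bounds below are inductions through this identity.\<close>

lemma sum_signs_insert:
  assumes "finite Q" "a \<notin> Q"
  shows "(\<Sum>S\<in>Pow (insert a Q). g (fip (insert a Q) (signs S) y)) =
    (\<Sum>S\<in>Pow Q. g (fip Q (signs S) y + y a) + (g (fip Q (signs S) y - y a) :: real))"
proof -
  have inj: "inj_on (insert a) (Pow Q)"
    using assms by (auto simp: inj_on_def)
  have disj: "Pow Q \<inter> insert a ` Pow Q = {}"
    using assms by auto
  have e1: "fip (insert a Q) (signs S) y = fip Q (signs S) y - y a" if "S \<in> Pow Q" for S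
    using assms that by (auto simp: fip_def signs_def)
  have e2: "fip (insert a Q) (signs (insert a S)) y = fip Q (signs S) y + y a" if "S \<in> Pow Q" for S
  proof -
    have "fip Q (signs (insert a S)) y = fip Q (signs S) y"
      using assms unfolding fip_def by (intro sum.cong) (auto simp: signs_def)
    then show ?thesis
      using assms by (simp add: fip_def) (simp add: signs_def)
  qed
  show ?thesis
    using assms inj disj
    by (simp add: Pow_insert sum.union_disjoint sum.reindex e1 e2 sum.distrib add.commute)
qed

lemma signs_second_moment:
  assumes "finite Q"
  shows "(\<Sum>S\<in>Pow Q. (fip Q (signs S) y)\<^sup>2) = 2 ^ card Q * fip Q y y"
  using assms
proof (induction Q rule: finite_induct)
  case (insert a Q)
  have "(\<Sum>S\<in>Pow (insert a Q). (fip (insert a Q) (signs S) y)\<^sup>2)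
     = (\<Sum>S\<in>Pow Q. 2 * (fip Q (signs S) y)\<^sup>2 + 2 * (y a)\<^sup>2)"
    by (subst sum_signs_insert[OF insert.hyps, of "\<lambda>t. t\<^sup>2"])
       (intro sum.cong, auto simp: power2_eq_square algebra_simps)
  also have "\<dots> = 2 * (\<Sum>S\<in>Pow Q. (fip Q (signs S) y)\<^sup>2) + 2 ^ card Q * (2 * (y a)\<^sup>2)"
    using insert.hyps by (simp add: sum.distrib sum_distrib_left card_Pow)
  finally show ?case
    using insert by (simp add: fip_self algebra_simps)
qed (simp add: fip_def)

lemma signs_fourth_moment:
  assumes "finite Q"
  shows "(\<Sum>S\<in>Pow Q. (fip Q (signs S) y) ^ 4) \<le> 2 ^ card Q * (3 * (fip Q y y)\<^sup>2)"
  using assms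
proof (induction Q rule: finite_induct)
  case (insert a Q)
  have "(\<Sum>S\<in>Pow (insert a Q). (fip (insert a Q) (signs S) y) ^ 4)
     = (\<Sum>S\<in>Pow Q. 2 * (fip Q (signs S) y) ^ 4 + 12 * (y a)\<^sup>2 * (fip Q (signs S) y)\<^sup>2 + 2 * (y a) ^
         4)"
    by (subst sum_signs_insert[OF insert.hyps, of "\<lambda>t. t ^ 4"])
       (intro sum.cong, auto simp: power2_eq_square power4_eq_xxxx algebra_simps)
  also have "\<dots> = 2 * (\<Sum>S\<in>Pow Q. (fip Q (signs S) y) ^ 4)
      + 12 * (y a)\<^sup>2 * (2 ^ card Q * fip Q y y) + 2 ^ card Q * (2 * (y a) ^ 4)"
    using insert.hyps
    by (simp add: sum.distrib sum_distrib_left card_Pow flip: signs_second_moment)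
  \<comment> \<open>Raising \<open>2 * (y a) ^ 4\<close> to \<open>6 * (y a) ^ 4\<close> completes
    the square \<open>3 * (fip Q y y + (y a)\<^sup>2)\<^sup>2\<close>.\<close>
  also have "\<dots> \<le> 2 * (2 ^ card Q * (3 * (fip Q y y)\<^sup>2))
      + 12 * (y a)\<^sup>2 * (2 ^ card Q * fip Q y y) + 2 ^ card Q * (6 * (y a) ^ 4)"
    using insert.IH by (intro add_mono mult_left_mono) auto
  also have "\<dots> = 2 ^ card (insert a Q) * (3 * (fip (insert a Q) y y)\<^sup>2)"
    using insert.hyps by (simp add: fip_def power2_eq_square power4_eq_xxxx algebra_simps)
  finally show ?case .
qed (simp add: fip_def)

text \<open>Averaging over one sign splits off \<open>exp (t * (y a)\<^sup>2)\<close> and slightly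
  increases the parameter, so the induction runs over all \<open>t\<close>. The smallness condition
  survives the increase and keeps the total loss within a factor 2 in the exponent.\<close>

lemma signs_exp_square_moment:
  assumes "finite Q" "0 \<le> t" "t * fip Q y y \<le> 1 / 4"
  shows "(\<Sum>S\<in>Pow Q. exp (t * (fip Q (signs S) y)\<^sup>2)) \<le> 2 ^ card Q * exp (2 * t * fip Q y y)"
  using assms
proof (induction Q arbitrary: t rule: finite_induct)
  case (insert a Q)
  define q where "q = fip Q y y"
  \<comment> \<open>The bound on \<open>cosh\<close> produces
    \<open>exp (2 * t\<^sup>2 * (y a)\<^sup>2 * u\<^sup>2)\<close>, which is absorbed by raising
    \<open>t\<close> to \<open>t'\<close>.\<close>
  define t' where "t' = t * (1 + 2 * t * (y a)\<^sup>2)"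
  have q: "0 \<le> q" unfolding q_def by (rule fip_self_nonneg)
  have ins: "fip (insert a Q) y y = (y a)\<^sup>2 + q"
    using insert.hyps by (simp add: q_def fip_self)
  have tq: "t * q \<le> 1 / 4" "t * (y a)\<^sup>2 + t * q \<le> 1/4"
    using insert.prems ins q by (auto simp: algebra_simps intro: order_trans[rotated])
  have "t' * q = t * q + 2 * (t * (y a)\<^sup>2) * (t * q)"
    by (simp add: t'_def algebra_simps)
  also have "\<dots> \<le> t * q + 2 * (t * (y a)\<^sup>2) * (1 / 4)"
    using tq insert.prems by (intro add_left_mono mult_left_mono) auto
  also have "\<dots> \<le> t * q + t * (y a)\<^sup>2"
    using insert.prems by simp
  finally have t'q: "t' * q \<le> 1 / 4" using tq by simp
  have t'0: "0 \<le> t'" using insert.prems by (simp add: t'_def)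
  have step: "exp (t * (u + y a)\<^sup>2) + exp (t * (u - y a)\<^sup>2)
      \<le> 2 * exp (t * (y a)\<^sup>2) * exp (t' * u\<^sup>2)" for u
  proof -
    have "exp (t * (u + y a)\<^sup>2) + exp (t * (u - y a)\<^sup>2)
        = exp (t * u\<^sup>2 + t * (y a)\<^sup>2) * (2 * cosh (2 * t * u * y a))"
      by (simp add: cosh_def exp_add[symmetric] power2_eq_square algebra_simps)
    also have "\<dots> \<le> exp (t * u\<^sup>2 + t * (y a)\<^sup>2) * (2 * exp ((2 * t * u * y a)\<^sup>2 / 2))"
      by (intro mult_left_mono cosh_le_exp_half_square) auto
    also have "\<dots> = 2 * exp (t * (y a)\<^sup>2) * exp (t' * u\<^sup>2)"
      by (simp add: t'_def exp_add[symmetric] power2_eq_square algebra_simps)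
    finally show ?thesis .
  qed
  have "(\<Sum>S\<in>Pow (insert a Q). exp (t * (fip (insert a Q) (signs S) y)\<^sup>2))
    \<le> (\<Sum>S\<in>Pow Q. 2 * exp (t * (y a)\<^sup>2) * exp (t' * (fip Q (signs S) y)\<^sup>2))"
    by (subst sum_signs_insert[OF insert.hyps, of "\<lambda>u. exp (t * u\<^sup>2)"]) (intro sum_mono step)
  also have "\<dots> = 2 * exp (t * (y a)\<^sup>2) * (\<Sum>S\<in>Pow Q. exp (t' * (fip Q (signs S) y)\<^sup>2))"
    by (simp add: sum_distrib_left)
  also have "\<dots> \<le> 2 * exp (t * (y a)\<^sup>2) * (2 ^ card Q * exp (2 * t' * q))"
    using insert.IH[of t'] t'0 t'q by (intro mult_left_mono) (auto simp: q_def fip_self_nonneg)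
  also have "\<dots> = 2 ^ card (insert a Q) * exp (t * (y a)\<^sup>2 + 2 * t' * q)"
    using insert.hyps by (simp add: exp_add)
  also have "t * (y a)\<^sup>2 + 2 * t' * q = 2 * t * q + t * (y a)\<^sup>2 * (1 + 4 * (t * q))"
    by (simp add: t'_def algebra_simps)
  also have "\<dots> \<le> 2 * t * q + t * (y a)\<^sup>2 * 2"
    using tq insert.prems by (intro add_left_mono mult_left_mono) auto
  also have "\<dots> = 2 * t * fip (insert a Q) y y"
    by (simp add: ins algebra_simps)
  finally show ?case by simp
qed (simp add: fip_def)

text \<open>The lower tail. If \<open>X\<close> is the square divided by
  \<open>4 * fip Q y y\<close>, then \<open>X\<close> has mean 1/4 and \<open>X\<^sup>2 / 2\<close>
  has mean at most 3/32, so \<open>exp (- X)\<close> has mean at most 1 - 5/32.\<close>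

lemma signs_exp_neg_square_moment:
  assumes "finite Q" "0 < fip Q y y"
  shows "(\<Sum>S\<in>Pow Q. exp (- ((fip Q (signs S) y)\<^sup>2 / (4 * fip Q y y))))
      \<le> 2 ^ card Q * exp (- 5 / 32)"
proof -
  define q where "q = fip Q y y"
  have q: "0 < q" using assms by (simp add: q_def)
  have "(\<Sum>S\<in>Pow Q. exp (- ((fip Q (signs S) y)\<^sup>2 / (4 * q))))
    \<le> (\<Sum>S\<in>Pow Q. 1 - (fip Q (signs S) y)\<^sup>2 / (4 * q) + (fip Q (signs S) y) ^ 4 / (32 * q\<^sup>2))"
  proof (intro sum_mono)
    fix S
    show "exp (- ((fip Q (signs S) y)\<^sup>2 / (4 * q)))
      \<le> 1 - (fip Q (signs S) y)\<^sup>2 / (4 * q) + (fip Q (signs S) y) ^ 4 / (32 * q\<^sup>2)"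
      using exp_neg_le_quadratic[of "(fip Q (signs S) y)\<^sup>2 / (4 * q)"] q
      by (simp add: power_divide power_mult_distrib)
  qed
  also have "\<dots> = 2 ^ card Q - (\<Sum>S\<in>Pow Q. (fip Q (signs S) y)\<^sup>2) / (4 * q)
      + (\<Sum>S\<in>Pow Q. (fip Q (signs S) y) ^ 4) / (32 * q\<^sup>2)"
    using assms by (simp add: sum.distrib sum_subtractf sum_divide_distrib card_Pow)
  also have "\<dots> \<le> 2 ^ card Q - (2 ^ card Q * q) / (4 * q) + (2 ^ card Q * (3 * q\<^sup>2)) / (32 * q\<^sup>2)"
    using signs_second_moment[OF assms(1), of y] signs_fourth_moment[OF assms(1), of y]
    by (intro add_mono diff_mono divide_right_mono) (auto simp: q_def fip_self_nonneg)
  also have "\<dots> = 2 ^ card Q * (1 + (- 5 / 32))"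
    using q by (simp add: field_simps)
  also have "\<dots> \<le> 2 ^ card Q * exp (- 5 / 32)"
    by (intro mult_left_mono exp_ge_add_one_self) auto
  finally show ?thesis by (simp add: q_def)
qed

text \<open>
  Rows are chosen one at a time by the method of conditional expectations: each new row can be
  taken so that a sum of exponentials (one per norm to be preserved) does not increase.
\<close>

lemma random_rows:
  fixes F V :: "('q \<Rightarrow> real) set"
  assumes fin: "finite Q" "finite F" "finite V" and "0 < B"
    and F: "\<And>y. y \<in> F \<Longrightarrow> 0 < fip Q y y"
    and V: "\<And>v. v \<in> V \<Longrightarrow> fip Q v v \<le> B\<^sup>2"
    and ln: "ln (real (card F + card V)) \<le> real m / 16"
    and ne: "0 < card F + card V"
  obtains e :: "nat \<Rightarrow> 'q \<Rightarrow> real" where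
    "\<And>y. y \<in> F \<Longrightarrow> real m / 4 * fip Q y y \<le> (\<Sum>j<m. (fip Q (e j) y)\<^sup>2)"
    "\<And>v. v \<in> V \<Longrightarrow> (\<Sum>j<m. (fip Q (e j) v)\<^sup>2) \<le> 4 * real m * B\<^sup>2"
proof -
  define T where "T e n y = (\<Sum>j<n. (fip Q (e j) y)\<^sup>2)" for e :: "nat \<Rightarrow> 'q \<Rightarrow> real" and n :: nat and y
  \<comment> \<open>A potential: a summand is large when the corresponding bound fails after
    \<open>n\<close> rows. The factors \<open>exp (5 / 32 * n)\<close> and
    \<open>exp (- n / 2)\<close> offset the average effect of one row, so \<open>W\<close> need not
    grow.\<close>
  define W where "W e n = (\<Sum>y\<in>F. exp (- (T e n y / (4 * fip Q y y))) * exp (5 / 32 * real n))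
    + (\<Sum>v\<in>V. exp (1 / (4 * B\<^sup>2) * T e n v) * exp (- (real n / 2)))" for e :: "nat \<Rightarrow> 'q \<Rightarrow> real" and n
  have "\<exists>e. W e n \<le> real (card F + card V)" for n
  proof (induction n)
    case 0
    show ?case by (auto simp: W_def T_def)
  next
    case (Suc n)
    then obtain e where e: "W e n \<le> real (card F + card V)" by blast
    define e' where "e' S = e(n := signs S)" for S
    have T': "T (e' S) (Suc n) y = T e n y + (fip Q (signs S) y)\<^sup>2" for S y
      by (simp add: T_def e'_def)
    have a1: "(\<Sum>S\<in>Pow Q. exp (- (T (e' S) (Suc n) y / (4 * fip Q y y))) * exp (5 / 32 * real (Suc
        n)))
       \<le> 2 ^ card Q * (exp (- (T e n y / (4 * fip Q y y))) * exp (5 / 32 * real n))" if "y \<in> F"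
           for y
    proof -
      have "(\<Sum>S\<in>Pow Q. exp (- (T (e' S) (Suc n) y / (4 * fip Q y y))) * exp (5 / 32 * real (Suc n)))
        = exp (- (T e n y / (4 * fip Q y y))) * exp (5 / 32 * real n) * exp (5 / 32) *
          (\<Sum>S\<in>Pow Q. exp (- ((fip Q (signs S) y)\<^sup>2 / (4 * fip Q y y))))"
        unfolding T' sum_distrib_left
        by (intro sum.cong refl) (simp add: exp_add[symmetric] add_divide_distrib algebra_simps)
      also have "\<dots> \<le> exp (- (T e n y / (4 * fip Q y y))) * exp (5 / 32 * real n) * exp (5 / 32) *
          (2 ^ card Q * exp (- 5 / 32))"
        using fin F[OF that] by (intro mult_left_mono signs_exp_neg_square_moment) auto
      also have "\<dots> = 2 ^ card Q * (exp (- (T e n y / (4 * fip Q y y))) * exp (5 / 32 * real n)) *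
          (exp (5 / 32) * exp (- (5 / 32)))"
        by (simp add: mult_ac)
      also have "exp (5 / 32) * exp (- (5 / 32)) = (1 :: real)"
        by (simp add: exp_add[symmetric])
      finally show ?thesis by simp
    qed
    have a2: "(\<Sum>S\<in>Pow Q. exp (1 / (4 * B\<^sup>2) * T (e' S) (Suc n) v) * exp (- (real (Suc n) / 2)))
       \<le> 2 ^ card Q * (exp (1 / (4 * B\<^sup>2) * T e n v) * exp (- (real n / 2)))" if "v \<in> V" for v
    proof -
      have le: "1 / (4 * B\<^sup>2) * fip Q v v \<le> 1 / 4"
        using V[OF that] \<open>0 < B\<close> by (simp add: field_simps)
      have "(\<Sum>S\<in>Pow Q. exp (1 / (4 * B\<^sup>2) * T (e' S) (Suc n) v) * exp (- (real (Suc n) / 2)))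
        = exp (1 / (4 * B\<^sup>2) * T e n v) * exp (- (real n / 2)) * exp (- (1 / 2)) *
          (\<Sum>S\<in>Pow Q. exp (1 / (4 * B\<^sup>2) * (fip Q (signs S) v)\<^sup>2))"
        unfolding T' sum_distrib_left
        by (intro sum.cong refl) (simp add: exp_add[symmetric] add_divide_distrib algebra_simps)
      also have "\<dots> \<le> exp (1 / (4 * B\<^sup>2) * T e n v) * exp (- (real n / 2)) * exp (- (1 / 2)) *
          (2 ^ card Q * exp (2 * (1 / (4 * B\<^sup>2)) * fip Q v v))"
        using fin le by (intro mult_left_mono signs_exp_square_moment) auto
      also have "\<dots> \<le> exp (1 / (4 * B\<^sup>2) * T e n v) * exp (- (real n / 2)) * exp (- (1 / 2)) *
          (2 ^ card Q * exp (1 / 2))"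
        using le by (intro mult_left_mono) (auto simp: field_simps)
      also have "\<dots> = 2 ^ card Q * (exp (1 / (4 * B\<^sup>2) * T e n v) * exp (- (real n / 2))) * (exp (-
          (1 / 2)) * exp (1 / 2))"
        by (simp add: mult_ac)
      also have "exp (- (1 / 2)) * exp (1 / 2) = (1 :: real)"
        by (simp add: exp_add[symmetric])
      finally show ?thesis by simp
    qed
    have "(\<Sum>S\<in>Pow Q. W (e' S) (Suc n)) =
       (\<Sum>y\<in>F. \<Sum>S\<in>Pow Q. exp (- (T (e' S) (Suc n) y / (4 * fip Q y y))) * exp (5 / 32 * real (Suc
           n)))
       + (\<Sum>v\<in>V. \<Sum>S\<in>Pow Q. exp (1 / (4 * B\<^sup>2) * T (e' S) (Suc n) v) * exp (- (real (Suc n) / 2)))"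
      unfolding W_def sum.distrib
      by (intro arg_cong2[where f = "(+)"] sum.swap)
    also have "\<dots> \<le> (\<Sum>y\<in>F. 2 ^ card Q * (exp (- (T e n y / (4 * fip Q y y))) * exp (5 / 32 * real
        n)))
       + (\<Sum>v\<in>V. 2 ^ card Q * (exp (1 / (4 * B\<^sup>2) * T e n v) * exp (- (real n / 2))))"
      by (intro add_mono sum_mono a1 a2)
    also have "\<dots> = 2 ^ card Q * W e n"
      by (simp add: W_def sum_distrib_left ring_distribs)
    also have "\<dots> \<le> real (card (Pow Q)) * real (card F + card V)"
      using e fin by (simp add: card_Pow)
    finally show ?case
      using exists_le_average[of "Pow Q" "\<lambda>S. W (e' S) (Suc n)"] fin by blast
  qed
  then obtain e where e: "W e m \<le> real (card F + card V)" by blast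
  have pos: "0 < real (card F + card V)" using ne by linarith
  \<comment> \<open>A single summand is at most \<open>card F + card V\<close>, whose logarithm is
    at most \<open>m / 16\<close>. What is left suffices: 5/32 - 1/16 is at least 1/16 for the lower
    bounds, and 1/2 + 1/16 is at most 1 for the upper ones.\<close>
  show ?thesis
  proof (rule that[of e])
    fix y assume y: "y \<in> F"
    have "exp (- (T e m y / (4 * fip Q y y)) + 5 / 32 * real m)
      \<le> (\<Sum>y\<in>F. exp (- (T e m y / (4 * fip Q y y))) * exp (5 / 32 * real m))"
      unfolding exp_add by (intro member_le_sum y fin) auto
    also have "\<dots> \<le> W e m" unfolding W_def by (simp add: sum_nonneg)
    finally have "exp (- (T e m y / (4 * fip Q y y)) + 5 / 32 * real m) \<le> real (card F + card V)"
      using e by linarith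
    then have "- (T e m y / (4 * fip Q y y)) + 5 / 32 * real m \<le> ln (real (card F + card V))"
      using pos by (simp add: ln_ge_iff)
    then have "real m / 16 \<le> T e m y / (4 * fip Q y y)"
      using ln by linarith
    then show "real m / 4 * fip Q y y \<le> (\<Sum>j<m. (fip Q (e j) y)\<^sup>2)"
      using F[OF y] by (simp add: T_def field_simps)
  next
    fix v assume v: "v \<in> V"
    have "exp (1 / (4 * B\<^sup>2) * T e m v + - (real m / 2))
      \<le> (\<Sum>v\<in>V. exp (1 / (4 * B\<^sup>2) * T e m v) * exp (- (real m / 2)))"
      unfolding exp_add by (intro member_le_sum v fin) auto
    also have "\<dots> \<le> W e m" unfolding W_def by (simp add: sum_nonneg)
    finally have "exp (1 / (4 * B\<^sup>2) * T e m v + - (real m / 2)) \<le> real (card F + card V)"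
      using e by linarith
    then have "1 / (4 * B\<^sup>2) * T e m v + - (real m / 2) \<le> ln (real (card F + card V))"
      using pos by (simp add: ln_ge_iff)
    then have "1 / (4 * B\<^sup>2) * T e m v \<le> real m"
      using ln by linarith
    then show "(\<Sum>j<m. (fip Q (e j) v)\<^sup>2) \<le> 4 * real m * B\<^sup>2"
      using \<open>0 < B\<close> by (simp add: T_def field_simps)
  qed
qed

section \<open>Sparse approximation, the Gelfand estimate and its dual\<close>

definition lincomb :: "'x set \<Rightarrow> ('x \<Rightarrow> real) \<Rightarrow> ('x \<Rightarrow> 'i \<Rightarrow> real) \<Rightarrow> 'i \<Rightarrow> real" where
  "lincomb X a v i = (\<Sum>x\<in>X. a x * v x i)"

text \<open>The vertices of the \<open>l_1\<close> ball, and 0, which takes up the missing weight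
  when the coefficients have \<open>l_1\<close> norm below 1. Coefficient functions are stored
  rather than vectors, so that one choice can be evaluated in several families
  \<open>v\<close>.\<close>

definition steps :: "'x set \<Rightarrow> ('x \<Rightarrow> real) set" where
  "steps X = insert (\<lambda>_. 0) ((\<lambda>(x, s) z. if z = x then s else 0) ` (X \<times> {1, -1}))"

primrec step_sums :: "'x set \<Rightarrow> nat \<Rightarrow> ('x \<Rightarrow> real) set" where
  "step_sums X 0 = {\<lambda>_. 0}"
| "step_sums X (Suc k) = (\<lambda>(b, s) x. b x + s x) ` (step_sums X k \<times> steps X)"

lemma finite_steps: "finite X \<Longrightarrow> finite (steps X)"
  by (simp add: steps_def)

lemma card_steps: "finite X \<Longrightarrow> card (steps X) \<le> 2 * card X + 1"
proof -
  assume X: "finite X"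
  have "card (steps X) \<le> Suc (card ((\<lambda>(x, s) z. if z = x then s else 0 :: real) ` (X \<times> {1, -1})))"
    unfolding steps_def by (rule card_insert_le_m1) (use X in auto)
  also have "\<dots> \<le> Suc (card (X \<times> {1, -1 :: real}))"
    using X by (intro Suc_le_mono[THEN iffD2] card_image_le) auto
  also have "\<dots> \<le> 2 * card X + 1"
    using X by (simp add: card_cartesian_product)
  finally show ?thesis .
qed

lemma finite_step_sums: "finite X \<Longrightarrow> finite (step_sums X k)"
  by (induction k) (simp_all add: finite_steps)

lemma card_step_sums: "finite X \<Longrightarrow> card (step_sums X k) \<le> (2 * card X + 1) ^ k"
proof (induction k)
  case (Suc k)
  have "card (step_sums X (Suc k)) \<le> card (step_sums X k \<times> steps X)"
    unfolding step_sums.simps using Suc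
    by (intro card_image_le finite_cartesian_product finite_step_sums finite_steps)
  also have "\<dots> \<le> (2 * card X + 1) ^ k * (2 * card X + 1)"
    unfolding card_cartesian_product using Suc card_steps by (intro mult_mono) auto
  finally show ?case by (simp add: mult.commute)
qed simp

lemma fip_lincomb: "fip I u (lincomb X a v) = (\<Sum>x\<in>X. a x * fip I u (v x))"
  unfolding fip_def lincomb_def sum_distrib_left
  by (subst sum.swap) (simp add: mult_ac)

lemma fip_add_square:
  "fip I (\<lambda>i. u i + v i) (\<lambda>i. u i + v i) = fip I u u + 2 * fip I u v + fip I v v"
  by (simp add: fip_def sum.distrib sum_distrib_left algebra_simps)

lemma fip_diff_square:
  "fip I (\<lambda>i. u i - v i) (\<lambda>i. u i - v i) = fip I u u - 2 * fip I u v + fip I v v"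
  by (simp add: fip_def sum.distrib sum_subtractf sum_distrib_left algebra_simps)

lemma fip_diff_right: "fip I u (\<lambda>i. v i - w i) = fip I u v - fip I u w"
  by (simp add: fip_def sum_subtractf algebra_simps)

text \<open>
  Maurey's argument: averaging over a random step with mean \<open>y\<close> increases the squared distance by
  at most \<open>B\<close>, so some step does.
\<close>

lemma maurey:
  fixes v :: "'x \<Rightarrow> 'i \<Rightarrow> real"
  assumes X: "finite X" and a: "(\<Sum>x\<in>X. \<bar>a x\<bar>) \<le> 1"
    and v: "\<And>x. x \<in> X \<Longrightarrow> fip I (v x) (v x) \<le> B" and B: "0 \<le> B"
  shows "\<exists>b\<in>step_sums X k.
    fip I (\<lambda>i. lincomb X b v i - real k * lincomb X a v i)
          (\<lambda>i. lincomb X b v i - real k * lincomb X a v i) \<le> real k * B"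
proof (induction k)
  case 0
  show ?case by (simp add: lincomb_def fip_def)
next
  case (Suc k)
  define y where "y = lincomb X a v"
  define N where "N u = fip I u u" for u
  obtain b where b: "b \<in> step_sums X k"
    and le: "N (\<lambda>i. lincomb X b v i - real k * y i) \<le> real k * B"
    using Suc by (auto simp: N_def y_def)
  define S where "S i = lincomb X b v i - real k * y i" for i
  \<comment> \<open>\<open>g s\<close> is the growth of the squared distance when the step
    \<open>s\<close> is added and the target moves from \<open>k * y\<close> to
    \<open>(k + 1) * y\<close>.\<close>
  define g where "g s = N (\<lambda>i. S i + (lincomb X s v i - y i)) - N S" for s
  define unit where "unit x s = (\<lambda>z. if z = x then s else 0 :: real)" for x :: 'x and s
  have unit: "lincomb X (unit x s) v = (\<lambda>i. s * v x i)" if "x \<in> X" for x s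
    using that X by (auto simp: lincomb_def unit_def if_distrib[of "\<lambda>t. t * _"] cong: if_cong)
  have zero: "lincomb X (\<lambda>_. 0) v = (\<lambda>_. 0)"
    by (simp add: lincomb_def fun_eq_iff)
  have gx: "g (unit x s) = 2 * s * fip I S (v x) - 2 * fip I S y + s\<^sup>2 * N (v x)
      - 2 * s * fip I y (v x) + N y" if "x \<in> X" for x s
    unfolding g_def N_def fip_add_square fip_diff_square fip_diff_right unit[OF that]
    by (simp add: fip_def sum_distrib_left power2_eq_square mult_ac)
  have g0: "g (\<lambda>_. 0) = - 2 * fip I S y + N y"
    unfolding g_def N_def fip_add_square fip_diff_square fip_diff_right zero
    by (simp add: fip_def)
  define A where "A = (\<Sum>x\<in>X. \<bar>a x\<bar>)"
  have "\<exists>s\<in>steps X. g s \<le> B"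
  proof (rule ccontr)
    assume "\<not> ?thesis"
    then have gt: "B < g s" if "s \<in> steps X" for s
      using that by force
    have gt1: "B < g (unit x (sgn (a x)))" if "x \<in> X" "a x \<noteq> 0" for x
      by (rule gt) (use that in \<open>auto simp: steps_def unit_def sgn_real_def image_iff\<close>)
    have gt0: "B < g (\<lambda>_. 0)"
      by (rule gt) (simp add: steps_def)
    \<comment> \<open>The step at \<open>x\<close> with sign \<open>sgn (a x)\<close> gets the
      weight \<open>\<bar>a x\<bar>\<close>, the zero step the weight \<open>1 - A\<close>. The
      weighted mean of the steps is \<open>y\<close>, so the terms linear in \<open>S\<close>
      cancel.\<close>
    have "(\<Sum>x\<in>X. \<bar>a x\<bar> * g (unit x (sgn (a x))))
        \<le> (\<Sum>x\<in>X. 2 * (a x * fip I S (v x)) - 2 * fip I S y * \<bar>a x\<bar> + \<bar>a x\<bar> * B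
        - 2 * (a x * fip I y (v x)) + N y * \<bar>a x\<bar>)"
    proof (intro sum_mono)
      fix x assume x: "x \<in> X"
      have s: "\<bar>a x\<bar> * sgn (a x) = a x" "\<bar>a x\<bar> * (sgn (a x))\<^sup>2 = \<bar>a x\<bar>"
        by (auto simp: sgn_real_def)
      have "\<bar>a x\<bar> * g (unit x (sgn (a x))) = 2 * (\<bar>a x\<bar> * sgn (a x)) * fip I S (v x) - 2 * fip I S y
          * \<bar>a x\<bar>
          + (\<bar>a x\<bar> * (sgn (a x))\<^sup>2) * N (v x) - 2 * (\<bar>a x\<bar> * sgn (a x)) * fip I y (v x) + N y * \<bar>a
              x\<bar>"
        by (subst gx[OF x]) (simp add: algebra_simps)
      also have "\<dots> \<le> 2 * (a x * fip I S (v x)) - 2 * fip I S y * \<bar>a x\<bar> + \<bar>a x\<bar> * B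
        - 2 * (a x * fip I y (v x)) + N y * \<bar>a x\<bar>"
        unfolding s using mult_left_mono[OF v[OF x], of "\<bar>a x\<bar>"] by (simp add: N_def)
      finally show "\<bar>a x\<bar> * g (unit x (sgn (a x))) \<le> \<dots>" .
    qed
    also have "\<dots> = 2 * fip I S y - 2 * fip I S y * A + A * B - 2 * N y + N y * A"
      by (simp add: sum.distrib sum_subtractf A_def y_def N_def fip_lincomb sum_distrib_left
          sum_distrib_right)
    finally have upper: "(\<Sum>x\<in>X. \<bar>a x\<bar> * g (unit x (sgn (a x))))
      \<le> 2 * fip I S y - 2 * fip I S y * A + A * B - 2 * N y + N y * A" .
    have lower: "A * B \<le> (\<Sum>x\<in>X. \<bar>a x\<bar> * g (unit x (sgn (a x))))"
      unfolding A_def sum_distrib_right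
      by (intro sum_mono) (metis abs_ge_zero abs_zero gt1 less_imp_le mult_left_mono mult_zero_left
          order_refl)
    then have 1: "A * B \<le> 2 * fip I S y - 2 * fip I S y * A + A * B - 2 * N y + N y * A"
      using upper by linarith
    have N: "0 \<le> N y" by (simp add: N_def fip_self_nonneg)
    have "2 * fip I S y < N y - B" using gt0 g0 by simp
    moreover have A: "0 \<le> A" "A \<le> 1" using a by (simp_all add: A_def sum_nonneg)
    ultimately have "(1 - A) * (2 * fip I S y) \<le> (1 - A) * (N y - B)"
      by (intro mult_left_mono) auto
    with 1 have 2: "N y + (1 - A) * B \<le> 0" by (simp add: algebra_simps)
    moreover have "0 \<le> (1 - A) * B" using A B by simp
    ultimately have N0: "N y = 0" "(1 - A) * B = 0" using N by linarith+
    \<comment> \<open>The averaged inequality alone leaves the equality case open. Strictness comes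
      from a nonzero weight if \<open>A = 1\<close>, and from the zero step, whose weight
      \<open>1 - A\<close> is positive, otherwise.\<close>
    show False
    proof (cases "A = 1")
      case True
      then obtain x where "x \<in> X" "a x \<noteq> 0"
        unfolding A_def by (metis abs_zero sum.neutral zero_neq_one)
      have "A * B < (\<Sum>x\<in>X. \<bar>a x\<bar> * g (unit x (sgn (a x))))"
        unfolding A_def sum_distrib_right
      proof (rule sum_strict_mono_ex1[OF X])
        show "\<forall>x\<in>X. \<bar>a x\<bar> * B \<le> \<bar>a x\<bar> * g (unit x (sgn (a x)))"
          by (metis abs_ge_zero abs_zero gt1 less_imp_le mult_left_mono mult_zero_left order_refl)
        show "\<exists>x\<in>X. \<bar>a x\<bar> * B < \<bar>a x\<bar> * g (unit x (sgn (a x)))"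
          using \<open>x \<in> X\<close> \<open>a x \<noteq> 0\<close> gt1 by (intro bexI[of _ x]) auto
      qed
      also note upper
      finally show False using True N0 by simp
    next
      case False
      then have "(1 - A) * (2 * fip I S y) < (1 - A) * (N y - B)"
        using \<open>2 * fip I S y < N y - B\<close> A by (intro mult_strict_left_mono) auto
      moreover have "(1 - A) * (N y - B) = 0"
        using N0 by (simp add: right_diff_distrib)
      moreover have "0 \<le> (1 - A) * (2 * fip I S y)"
        using 1 N0 by (simp add: algebra_simps)
      ultimately show False by linarith
    qed
  qed
  then obtain s where s: "s \<in> steps X" "g s \<le> B" by blast
  define c where "c = (\<lambda>x. b x + s x)"
  have "c \<in> step_sums X (Suc k)"
    using b s by (auto simp: c_def intro!: image_eqI[of _ _ "(b, s)"])
  moreover have "(\<lambda>i. lincomb X c v i - real (Suc k) * y i) = (\<lambda>i. S i + (lincomb X s v i - y i))"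
    by (auto simp: c_def S_def lincomb_def sum.distrib algebra_simps)
  then have "N (\<lambda>i. lincomb X c v i - real (Suc k) * y i) \<le> real (Suc k) * B"
    using s(2) le by (simp add: g_def S_def[abs_def] algebra_simps)
  ultimately show ?case
    unfolding N_def y_def by blast
qed

text \<open>Maurey gives a sum \<open>p\<close> of \<open>k\<close> steps with
  \<open>p - k * y\<close> of order \<open>sqrt k * B\<close>, and likewise in the image of the
  matrix. The matrix is bounded below on \<open>p\<close>, so the norm of \<open>p\<close> is
  controlled by the image of \<open>y\<close>; dividing by \<open>k\<close> gives the claim. Hull
  points in the kernel thus have norm at most \<open>8 * B / sqrt k\<close>. The condition
  \<open>km\<close> pays for all \<open>(2 * card X + 1) ^ k\<close> candidates
  \<open>p\<close>.\<close>

lemma random_rows_gelfand: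
  fixes v :: "'x \<Rightarrow> 'q \<Rightarrow> real"
  assumes Q: "finite Q" and X: "finite X" "X \<noteq> {}" and "0 < B"
    and v: "\<And>x. x \<in> X \<Longrightarrow> fip Q (v x) (v x) \<le> B\<^sup>2"
    and k: "0 < k" and km: "2 * real k * ln (2 * real (card X) + 1) \<le> real m / 16"
  obtains e :: "nat \<Rightarrow> 'q \<Rightarrow> real" where
    "\<And>a. (\<Sum>x\<in>X. \<bar>a x\<bar>) \<le> 1 \<Longrightarrow> L2_set (lincomb X a v) Q
       \<le> 8 * B / sqrt (real k) + 2 / sqrt (real m) * L2_set (\<lambda>j. fip Q (e j) (lincomb X a v))
           {..<m}"
proof -
  \<comment> \<open>Vanishing combinations are left out because the potential divides by
    \<open>fip Q y y\<close>; for them the lower bound is trivial.\<close>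
  define F where "F = {y \<in> (\<lambda>b. lincomb X b v) ` step_sums X k. 0 < fip Q y y}"
  define V where "V = v ` X"
  define M where "M = 2 * card X + 1"
  have finF: "finite F" "finite V"
    using X by (auto simp: F_def V_def finite_step_sums)
  have "card F \<le> card ((\<lambda>b. lincomb X b v) ` step_sums X k)"
    unfolding F_def using X by (intro card_mono) (auto simp: finite_step_sums)
  also have "\<dots> \<le> M ^ k"
    unfolding M_def using card_image_le[OF finite_step_sums] card_step_sums X by (metis le_trans)
  finally have cF: "card F \<le> M ^ k" .
  have cV: "card V \<le> card X" "0 < card V"
    using X card_image_le[of X v] by (auto simp: V_def card_gt_0_iff)
  have cX: "0 < card X" using X by (simp add: card_gt_0_iff)
  have M1: "M ^ 1 \<le> M ^ k" using k by (intro power_increasing) (auto simp: M_def)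
  have "card F + card V \<le> 2 * M ^ k" using cF cV M1 by (simp add: M_def)
  also have "\<dots> \<le> M ^ k * M ^ k" using M1 cX by (intro mult_right_mono) (auto simp: M_def)
  finally have "card F + card V \<le> M ^ (2 * k)" by (simp add: power_add mult_2)
  then have "real (card F + card V) \<le> real M ^ (2 * k)"
    by (metis of_nat_le_iff of_nat_power)
  then have "ln (real (card F + card V)) \<le> ln (real M ^ (2 * k))"
    using cV by (intro ln_mono) auto
  also have "\<dots> = 2 * real k * ln (2 * real (card X) + 1)"
    by (simp add: ln_realpow M_def)
  finally have ln: "ln (real (card F + card V)) \<le> real m / 16" using km by simp
  obtain e :: "nat \<Rightarrow> 'q \<Rightarrow> real" where
    e1: "\<And>y. y \<in> F \<Longrightarrow> real m / 4 * fip Q y y \<le> (\<Sum>j<m. (fip Q (e j) y)\<^sup>2)" and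
    e2: "\<And>v. v \<in> V \<Longrightarrow> (\<Sum>j<m. (fip Q (e j) v)\<^sup>2) \<le> 4 * real m * B\<^sup>2"
  proof (rule random_rows[of Q F V B m])
    show "0 < fip Q y y" if "y \<in> F" for y using that by (simp add: F_def)
    show "fip Q u u \<le> B\<^sup>2" if "u \<in> V" for u using that v by (auto simp: V_def)
  qed (use Q finF \<open>0 < B\<close> ln cV in auto)
  have "0 < 2 * real k * ln (2 * real (card X) + 1)" using k cX by (intro mult_pos_pos) auto
  then have m: "0 < real m" using km by linarith
  show ?thesis
  proof (rule that[of e])
    fix a :: "'x \<Rightarrow> real" assume a: "(\<Sum>x\<in>X. \<bar>a x\<bar>) \<le> 1"
    define y where "y = lincomb X a v"
    \<comment> \<open>Each vector is extended by its scaled image, so that one run of Maurey's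
      argument controls both. The scale \<open>1 / (2 * sqrt m)\<close> gives each half squared norm
      at most \<open>B\<^sup>2\<close>.\<close>
    define I where "I = Q <+> {..<m}"
    define vc where "vc x = case_sum (v x) (\<lambda>j. fip Q (e j) (v x) / (2 * sqrt (real m)))" for x
    have split: "fip I u u = fip Q (u \<circ> Inl) (u \<circ> Inl) + (\<Sum>j<m. (u (Inr j))\<^sup>2)" for u
      using Q unfolding I_def fip_self by (subst sum.Plus) (auto simp: o_def)
    have vc: "fip I (vc x) (vc x) \<le> 2 * B\<^sup>2" if "x \<in> X" for x
    proof -
      have "(\<Sum>j<m. (fip Q (e j) (v x) / (2 * sqrt (real m)))\<^sup>2)
          = (\<Sum>j<m. (fip Q (e j) (v x))\<^sup>2) / (4 * real m)"
        using m by (simp add: sum_divide_distrib power_divide power_mult_distrib)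
      also have "\<dots> \<le> (4 * real m * B\<^sup>2) / (4 * real m)"
        using e2[of "v x"] that m by (intro divide_right_mono) (auto simp: V_def)
      finally show ?thesis using v[OF that] m by (simp add: split vc_def o_def)
    qed
    obtain b where b: "b \<in> step_sums X k"
      and le: "fip I (\<lambda>i. lincomb X b vc i - real k * lincomb X a vc i)
          (\<lambda>i. lincomb X b vc i - real k * lincomb X a vc i) \<le> real k * (2 * B\<^sup>2)"
      using maurey[OF X(1) a, of I vc "2 * B\<^sup>2" k] vc by auto
    define p where "p = lincomb X b v"
    define D where "D i = p i - real k * y i" for i
    have lInl: "lincomb X c vc (Inl i) = lincomb X c v i" for c i
      by (simp add: lincomb_def vc_def)
    have lInr: "lincomb X c vc (Inr j) = fip Q (e j) (lincomb X c v) / (2 * sqrt (real m))" for c j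
      by (simp add: lincomb_def[of _ _ vc] vc_def fip_lincomb sum_divide_distrib)
    have fD: "fip Q u D = fip Q u p - real k * fip Q u y" for u
      by (simp add: D_def[abs_def] fip_diff_right) (simp add: fip_def sum_distrib_left mult_ac)
    have "fip Q D D + (\<Sum>j<m. (fip Q (e j) D)\<^sup>2) / (4 * real m) \<le> real k * (2 * B\<^sup>2)"
    proof -
      have "fip Q D D = fip Q (\<lambda>i. lincomb X b vc (Inl i) - real k * lincomb X a vc (Inl i))
              (\<lambda>i. lincomb X b vc (Inl i) - real k * lincomb X a vc (Inl i))"
        by (simp add: lInl D_def[abs_def] p_def y_def)
      moreover have "(\<Sum>j<m. (fip Q (e j) D)\<^sup>2) / (4 * real m)
         = (\<Sum>j<m. (lincomb X b vc (Inr j) - real k * lincomb X a vc (Inr j))\<^sup>2)"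
        unfolding sum_divide_distrib using m
        by (intro sum.cong refl)
           (simp add: lInr fD p_def y_def diff_divide_distrib[symmetric] power_divide
               power_mult_distrib)
      ultimately show ?thesis using le by (simp add: split o_def)
    qed
    moreover have "0 \<le> (\<Sum>j<m. (fip Q (e j) D)\<^sup>2) / (4 * real m)" "0 \<le> fip Q D D"
      using m by (auto intro!: sum_nonneg divide_nonneg_pos simp: fip_self_nonneg)
    ultimately have D1: "fip Q D D \<le> 2 * real k * B\<^sup>2"
      and D2: "(\<Sum>j<m. (fip Q (e j) D)\<^sup>2) / (4 * real m) \<le> 2 * real k * B\<^sup>2" by auto
    have D2': "(\<Sum>j<m. (fip Q (e j) D)\<^sup>2) \<le> real m * (8 * real k * B\<^sup>2)"
      using D2 m by (simp add: field_simps)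
    define G where "G u = L2_set (\<lambda>j. fip Q (e j) u) {..<m}" for u
    define s where "s = sqrt (real k) * B * sqrt 2"
    have LD: "L2_set D Q \<le> s"
    proof -
      have "L2_set D Q = sqrt (fip Q D D)" by (simp add: fip_self L2_set_def)
      also have "\<dots> \<le> sqrt (2 * real k * B\<^sup>2)" using D1 by simp
      finally show ?thesis using \<open>0 < B\<close> by (simp add: s_def real_sqrt_mult mult_ac)
    qed
    have GD: "G D \<le> sqrt (real m) * (2 * s)"
    proof -
      have "G D \<le> sqrt (real m * (8 * real k * B\<^sup>2))" unfolding G_def L2_set_def using D2' by simp
      also have "\<dots> = sqrt (real m) * (sqrt (4 * 2) * sqrt (real k) * B)"
        using \<open>0 < B\<close> by (simp add: real_sqrt_mult)
      also have "sqrt (4 * 2) = 2 * sqrt (2 :: real)" by (subst real_sqrt_mult) simp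
      finally show ?thesis by (simp add: s_def mult_ac)
    qed
    have Gp: "sqrt (real m) / 2 * L2_set p Q \<le> G p"
    proof (cases "0 < fip Q p p")
      case True
      then have "p \<in> F" using b by (auto simp: F_def p_def)
      from e1[OF this] have "sqrt (real m / 4 * fip Q p p) \<le> G p"
        by (simp add: G_def L2_set_def)
      then show ?thesis by (simp add: real_sqrt_mult real_sqrt_divide fip_self L2_set_def)
    next
      case False
      then have "L2_set p Q = 0"
        by (simp add: fip_self_eq_L2_set)
      then show ?thesis by (simp add: G_def L2_set_nonneg)
    qed
    have "G p = L2_set (\<lambda>j. fip Q (e j) D + real k * fip Q (e j) y) {..<m}"
      by (simp add: G_def fD)
    also have "\<dots> \<le> G D + L2_set (\<lambda>j. real k * fip Q (e j) y) {..<m}"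
      unfolding G_def by (rule L2_set_triangle_ineq)
    also have "L2_set (\<lambda>j. real k * fip Q (e j) y) {..<m} = real k * G y"
      unfolding G_def by (rule L2_set_right_distrib[symmetric]) auto
    finally have Gp2: "G p \<le> G D + real k * G y" .
    have "L2_set p Q = 2 / sqrt (real m) * (sqrt (real m) / 2 * L2_set p Q)"
      using m by simp
    also have "\<dots> \<le> 2 / sqrt (real m) * (sqrt (real m) * (2 * s) + real k * G y)"
      using Gp Gp2 GD by (intro mult_left_mono) auto
    also have "\<dots> = 4 * s + real k * (2 / sqrt (real m) * G y)"
      using m by (simp add: field_simps)
    finally have Lp: "L2_set p Q \<le> 4 * s + real k * (2 / sqrt (real m) * G y)" .
    have "real k * L2_set y Q = L2_set (\<lambda>i. p i + - D i) Q"
      by (subst L2_set_right_distrib) (auto simp: D_def)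
    also have "\<dots> \<le> L2_set p Q + L2_set (\<lambda>i. - D i) Q"
      by (rule L2_set_triangle_ineq)
    also have "L2_set (\<lambda>i. - D i) Q = L2_set D Q" by (simp add: L2_set_def)
    finally have "real k * L2_set y Q \<le> 5 * s + real k * (2 / sqrt (real m) * G y)"
      using Lp LD by linarith
    then have "L2_set y Q \<le> 5 * s / real k + 2 / sqrt (real m) * G y"
      using k by (simp add: field_simps)
    also have "5 * s / real k = 5 * sqrt 2 * B / sqrt (real k)"
      using k by (simp add: s_def field_simps)
    also have "\<dots> \<le> 8 * B / sqrt (real k)"
    proof -
      have "5 * sqrt 2 = sqrt (50 :: real)" using real_sqrt_mult[of 25 2] by simp
      also have "\<dots> \<le> 8" by (rule real_le_lsqrt) auto
      finally show ?thesis using \<open>0 < B\<close> by (intro divide_right_mono mult_right_mono) auto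
    qed
    finally show "L2_set (lincomb X a v) Q \<le> 8 * B / sqrt (real k) +
      2 / sqrt (real m) * L2_set (\<lambda>j. fip Q (e j) (lincomb X a v)) {..<m}"
      by (simp add: y_def G_def)
  qed
qed

text \<open>
  Finite-dimensional duality for the uniform norm without Hahn--Banach: minimise a regularised
  power sum of the residuals; the stationarity condition makes the powers of the residuals an
  almost annihilating functional.
\<close>

lemma sup_approximation_by_duality:
  fixes f :: "'x \<Rightarrow> real" and u :: "nat \<Rightarrow> 'x \<Rightarrow> real"
  assumes X: "finite X" and \<eta>: "0 < \<eta>" and \<beta>: "0 \<le> \<beta>"
    and H: "\<And>a. (\<Sum>x\<in>X. a x * f x) \<le>
      \<eta> * (\<Sum>x\<in>X. \<bar>a x\<bar>) + \<beta> * L2_set (\<lambda>j. \<Sum>x\<in>X. a x * u j x) {..<m}"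
  shows "\<exists>z. \<forall>x\<in>X. \<bar>f x - (\<Sum>j<m. z j * u j x)\<bar> \<le> 3 * \<eta>"
proof -
  \<comment> \<open>An even exponent makes the power sum smooth and nonnegative. Exceeding
    \<open>card X\<close> lets one large residual outweigh the negative terms of all the
    others.\<close>
  define n where "n = 2 * Suc (card X)"
  have n: "even n" "0 < n" by (auto simp: n_def)
  define P where "P = (\<Sum>x\<in>X. f x ^ n)"
  have P: "0 \<le> P" using n by (auto simp: P_def intro!: sum_nonneg)
  define \<tau> where "\<tau> = real n * \<eta> ^ n"
  have \<tau>: "0 < \<tau>" using n \<eta> by (simp add: \<tau>_def)
  \<comment> \<open>Chosen so that the gradient of the regularising term, after the factor
    \<open>\<beta>\<close>, contributes at most \<open>\<tau>\<close>.\<close>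
  define \<sigma> where "\<sigma> = \<tau> / (2 * (\<beta> + 1) * (sqrt P + 1))"
  have sP: "0 \<le> sqrt P" using P by simp
  have \<sigma>: "0 < \<sigma>" using \<tau> \<beta> sP unfolding \<sigma>_def
    by (intro divide_pos_pos mult_pos_pos add_nonneg_pos) auto
  define \<rho> where "\<rho> = \<sigma>\<^sup>2"
  have \<rho>: "0 < \<rho>" "sqrt \<rho> = \<sigma>" using \<sigma> by (auto simp: \<rho>_def)
  have small: "\<beta> * (2 * \<sigma> * sqrt P) \<le> \<tau>"
  proof -
    have "\<beta> * (2 * \<sigma> * sqrt P) = 2 * \<sigma> * (\<beta> * sqrt P)" by simp
    also have "\<dots> \<le> 2 * \<sigma> * ((\<beta> + 1) * (sqrt P + 1))"
      using \<sigma> \<beta> sP by (intro mult_left_mono mult_mono) auto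
    also have "\<dots> = \<tau>" unfolding \<sigma>_def using \<beta> sP by (simp add: field_simps add_nonneg_eq_0_iff)
    finally show ?thesis .
  qed
  define r where "r z x = f x - (\<Sum>j<m. z j * u j x)" for z x
  define \<Psi> where "\<Psi> z = (\<Sum>x\<in>X. r z x ^ n) + \<rho> * (\<Sum>j<m. (z j)\<^sup>2)" for z
  \<comment> \<open>Outside the box of this radius the regularising term alone is at least
    \<open>P\<close>, the value of \<open>\<Psi>\<close> at 0. A minimum over the compact box is
    therefore global.\<close>
  define R where "R = sqrt (P / \<rho>) + 1"
  have R: "0 \<le> R" using P \<rho> by (simp add: R_def)
  define K where "K = (\<Pi>\<^sub>E j\<in>UNIV. if j < m then {- R..R} else {0 :: real})"
  have "compactin (product_topology (\<lambda>_::nat. euclidean :: real topology) UNIV) K"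
    unfolding K_def by (subst compactin_PiE) auto
  then have "compact K" by (simp add: euclidean_product_topology)
  moreover have K0: "(\<lambda>_. 0) \<in> K" using R by (auto simp: K_def)
  moreover have "continuous_on K \<Psi>"
    unfolding \<Psi>_def r_def
    by (intro continuous_intros continuous_on_subset[OF continuous_on_product_coordinates]) auto
  ultimately obtain z where z: "z \<in> K" "\<And>w. w \<in> K \<Longrightarrow> \<Psi> z \<le> \<Psi> w"
    using continuous_attains_inf[of K \<Psi>] by blast
  have \<Psi>0: "\<Psi> (\<lambda>_. 0) = P" by (simp add: \<Psi>_def r_def P_def)
  have zP: "\<Psi> z \<le> P" using z(2)[OF K0] \<Psi>0 by simp
  have rn: "0 \<le> (\<Sum>x\<in>X. r w x ^ n)" for w using n by (auto intro!: sum_nonneg)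
  have glob: "\<Psi> z \<le> \<Psi> w" if w: "\<And>j. m \<le> j \<Longrightarrow> w j = 0" for w
  proof (cases "w \<in> K")
    case False
    then obtain j where "j < m" "\<not> \<bar>w j\<bar> \<le> R"
      using w by (fastforce simp: K_def split: if_splits)
    then have "R\<^sup>2 \<le> (w j)\<^sup>2" using R by (simp add: abs_le_square_iff[symmetric])
    also have "\<dots> \<le> (\<Sum>j<m. (w j)\<^sup>2)" using \<open>j < m\<close> by (intro member_le_sum) auto
    finally have "\<rho> * (sqrt (P / \<rho>))\<^sup>2 \<le> \<rho> * (\<Sum>j<m. (w j)\<^sup>2)"
    proof (intro mult_left_mono)
      assume "R\<^sup>2 \<le> (\<Sum>j<m. (w j)\<^sup>2)"
      moreover have "(sqrt (P / \<rho>))\<^sup>2 \<le> R\<^sup>2" unfolding R_def using P \<rho> by (intro power_mono) auto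
      ultimately show "(sqrt (P / \<rho>))\<^sup>2 \<le> (\<Sum>j<m. (w j)\<^sup>2)" by linarith
    qed (use \<rho> in auto)
    then have "P \<le> \<rho> * (\<Sum>j<m. (w j)\<^sup>2)" using P \<rho> by simp
    then show ?thesis using zP rn[of w] by (simp add: \<Psi>_def[of w])
  qed (use z in auto)
  define e where "e x = r z x" for x
  define a where "a x = real n * e x ^ (n - 1)" for x
  have stat: "(\<Sum>x\<in>X. a x * u j x) = 2 * \<rho> * z j" if j: "j < m" for j
  proof -
    define h where "h t = (\<Sum>x\<in>X. (e x - t * u j x) ^ n) + \<rho> * ((\<Sum>j<m. (z j)\<^sup>2) + 2 * t * z j + t\<^sup>2)"
        for t
    have h: "h t = \<Psi> (z(j := z j + t))" for t
    proof -
      have "(\<Sum>i<m. (z(j := z j + t)) i * c i) = (\<Sum>i<m. z i * c i) + t * c j" for c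
        using j by (simp add: sum.remove[of "{..<m}" j] algebra_simps)
      then have "r (z(j := z j + t)) x = e x - t * u j x" for x
        unfolding r_def e_def by simp
      moreover have "(\<Sum>i<m. ((z(j := z j + t)) i)\<^sup>2) = (\<Sum>j<m. (z j)\<^sup>2) + 2 * t * z j + t\<^sup>2"
        using j by (simp add: sum.remove[of "{..<m}" j] power2_sum)
      ultimately show ?thesis by (simp add: h_def \<Psi>_def)
    qed
    have min: "h 0 \<le> h t" for t
      unfolding h by (simp, rule glob) (use z(1) j in \<open>force simp: K_def split: if_splits\<close>)
    have "(h has_real_derivative ((\<Sum>x\<in>X. - (real n * e x ^ (n - 1) * u j x)) + \<rho> * (2 * z j))) (at
        0)"
      unfolding h_def by (auto intro!: derivative_eq_intros sum.cong)
    then have "(\<Sum>x\<in>X. - (real n * e x ^ (n - 1) * u j x)) + \<rho> * (2 * z j) = 0"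
      using DERIV_local_min[of h _ 0 1] min by auto
    then show ?thesis by (simp add: a_def sum_negf)
  qed
  define Z where "Z = L2_set z {..<m}"
  have Z2: "Z\<^sup>2 = (\<Sum>j<m. (z j)\<^sup>2)" by (simp add: Z_def L2_set_def sum_nonneg)
  have "\<rho> * Z\<^sup>2 \<le> P" using zP rn[of z] by (simp add: \<Psi>_def Z2)
  then have "sqrt (\<rho> * Z\<^sup>2) \<le> sqrt P" by simp
  then have \<sigma>Z: "\<sigma> * Z \<le> sqrt P"
    using \<rho> by (simp add: real_sqrt_mult Z_def L2_set_nonneg)
  have "L2_set (\<lambda>j. \<Sum>x\<in>X. a x * u j x) {..<m} = L2_set (\<lambda>j. 2 * \<rho> * z j) {..<m}"
    using stat by (intro L2_set_cong) auto
  also have "\<dots> = 2 * \<sigma> * (\<sigma> * Z)"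
    using \<rho> by (simp add: L2_set_right_distrib[symmetric] Z_def \<rho>_def power2_eq_square)
  also have "\<dots> \<le> 2 * \<sigma> * sqrt P" using \<sigma> \<sigma>Z by (intro mult_left_mono) auto
  finally have "L2_set (\<lambda>j. \<Sum>x\<in>X. a x * u j x) {..<m} \<le> 2 * \<sigma> * sqrt P" .
  from order_trans[OF mult_left_mono[OF this \<beta>] small]
  have L: "\<beta> * L2_set (\<lambda>j. \<Sum>x\<in>X. a x * u j x) {..<m} \<le> \<tau>" .
  have "(\<Sum>x\<in>X. a x * e x) = (\<Sum>x\<in>X. a x * f x) - (\<Sum>x\<in>X. \<Sum>j<m. z j * (a x * u j x))"
    by (simp add: e_def r_def sum_subtractf[symmetric] sum_distrib_left algebra_simps)
  also have "(\<Sum>x\<in>X. \<Sum>j<m. z j * (a x * u j x)) = (\<Sum>j<m. z j * (\<Sum>x\<in>X. a x * u j x))"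
    by (subst sum.swap) (simp add: sum_distrib_left)
  also have "\<dots> = 2 * \<rho> * (\<Sum>j<m. (z j)\<^sup>2)"
    by (simp add: stat sum_distrib_left power2_eq_square mult_ac)
  finally have "(\<Sum>x\<in>X. a x * e x) \<le> (\<Sum>x\<in>X. a x * f x)"
    using \<rho> by (simp add: sum_nonneg)
  also have "\<dots> \<le> \<eta> * (\<Sum>x\<in>X. \<bar>a x\<bar>) + \<tau>" using H[of a] L by linarith
  finally have "(\<Sum>x\<in>X. a x * e x) \<le> \<eta> * (\<Sum>x\<in>X. \<bar>a x\<bar>) + \<tau>" .
  moreover have "a x * e x = \<bar>a x\<bar> * \<bar>e x\<bar>" for x
  proof -
    have "a x * e x = real n * e x ^ n" using n by (simp add: a_def power_eq_if)
    then have "0 \<le> a x * e x" using n by (simp add: zero_le_even_power)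
    then show ?thesis by (metis abs_mult abs_of_nonneg)
  qed
  ultimately have main: "(\<Sum>x\<in>X. \<bar>a x\<bar> * (\<bar>e x\<bar> - \<eta>)) \<le> \<tau>"
    by (simp add: right_diff_distrib sum_subtractf sum_distrib_left mult.commute)
  have "\<bar>e y\<bar> \<le> 3 * \<eta>" if y: "y \<in> X" for y
  proof (rule ccontr)
    \<comment> \<open>The term of a residual above \<open>3 * \<eta>\<close> is at least
      \<open>2 * 3 ^ (n - 1) * \<tau>\<close>, each other term is at least \<open>- \<tau>\<close>,
      and the total is at most \<open>\<tau>\<close>. With at most \<open>n\<close> terms this is
      impossible.\<close>
    assume ey: "\<not> ?thesis"
    have abs_a: "\<bar>a x\<bar> = real n * \<bar>e x\<bar> ^ (n - 1)" for x
      by (simp add: a_def abs_mult power_abs)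
    have eta_n: "\<eta> ^ n = \<eta> ^ (n - 1) * \<eta>" using n by (simp add: power_eq_if)
    have low: "- \<tau> \<le> \<bar>a x\<bar> * (\<bar>e x\<bar> - \<eta>)" for x
    proof (cases "\<eta> \<le> \<bar>e x\<bar>")
      case True
      then have "0 \<le> \<bar>a x\<bar> * (\<bar>e x\<bar> - \<eta>)" by simp
      then show ?thesis using \<tau> by linarith
    next
      case False
      have "\<bar>a x\<bar> * \<eta> \<le> \<tau>"
        unfolding abs_a \<tau>_def eta_n mult.assoc
        using False \<eta> by (intro mult_left_mono mult_right_mono power_mono) auto
      moreover have "0 \<le> \<bar>a x\<bar> * \<bar>e x\<bar>" by simp
      ultimately show ?thesis unfolding right_diff_distrib by linarith
    qed
    have "2 * 3 ^ (n - 1) * \<tau> = (real n * (3 * \<eta>) ^ (n - 1)) * (3 * \<eta> - \<eta>)"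
      by (simp add: \<tau>_def eta_n power_mult_distrib)
    also have "\<dots> \<le> \<bar>a y\<bar> * (\<bar>e y\<bar> - \<eta>)"
      unfolding abs_a using ey \<eta> by (intro mult_mono mult_left_mono power_mono) auto
    finally have "2 * 3 ^ (n - 1) * \<tau> + (\<Sum>x\<in>X - {y}. - \<tau>)
      \<le> \<bar>a y\<bar> * (\<bar>e y\<bar> - \<eta>) + (\<Sum>x\<in>X - {y}. \<bar>a x\<bar> * (\<bar>e x\<bar> - \<eta>))"
      by (intro add_mono sum_mono low)
    also have "\<dots> = (\<Sum>x\<in>X. \<bar>a x\<bar> * (\<bar>e x\<bar> - \<eta>))"
      using X y by (subst sum.remove[of X y]) auto
    also have "\<dots> \<le> \<tau>" by (rule main)
    finally have "2 * 3 ^ (n - 1) * \<tau> \<le> (real (card (X - {y})) + 1) * \<tau>"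
      by (simp add: algebra_simps)
    then have "2 * 3 ^ (n - 1) \<le> real (card (X - {y})) + 1" using \<tau> by simp
    also have "\<dots> \<le> real n" using X y by (simp add: n_def card_Diff_singleton)
    finally have "2 * 3 ^ (n - 1) \<le> real n" .
    moreover have "1 + real (n - 1) * 2 \<le> (1 + 2) ^ (n - 1)" by (rule Bernoulli_inequality) auto
    ultimately show False using n by (cases n) auto
  qed
  then show ?thesis unfolding e_def r_def by blast
qed

text \<open>The rows of the matrix span the subspace: the Gelfand estimate, made homogeneous in
  \<open>a\<close>, is the hypothesis of the duality lemma with \<open>\<beta> = 2 / sqrt m\<close>
  and \<open>\<eta> = 8 * B / sqrt k\<close>. With \<open>k\<close> of order \<open>m / L\<close>
  this is the stated rate, and \<open>3 * \<eta>\<close> is at most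
  \<open>192 * B * sqrt (L / m)\<close>. The functions \<open>g\<close> are fixed before
  \<open>c\<close>, as a width requires.\<close>

lemma L2_ball_sup_width:
  fixes v :: "'x \<Rightarrow> 'q \<Rightarrow> real"
  assumes Q: "finite Q" and X: "finite X" and B: "0 < B" and m: "0 < m"
    and v: "\<And>x. x \<in> X \<Longrightarrow> fip Q (v x) (v x) \<le> B\<^sup>2"
  obtains g :: "nat \<Rightarrow> 'q \<Rightarrow> real" where
    "\<And>c. fip Q c c \<le> 1 \<Longrightarrow> \<exists>z. \<forall>x\<in>X. \<bar>fip Q c (v x) - (\<Sum>j<m. z j * fip Q (g j) (v x))\<bar>
       \<le> 200 * B * sqrt (ln (2 * real (card X) + 1) / real m)"
proof -
  define L where "L = ln (2 * real (card X) + 1)"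
  have CS: "fip Q c y \<le> L2_set y Q" "\<bar>fip Q c y\<bar> \<le> L2_set y Q" if "fip Q c c \<le> 1" for c y
  proof -
    have "\<bar>fip Q c y\<bar> \<le> (\<Sum>k\<in>Q. \<bar>c k\<bar> * \<bar>y k\<bar>)"
      unfolding fip_def by (rule order_trans[OF sum_abs]) (simp add: abs_mult)
    also have "\<dots> \<le> L2_set c Q * L2_set y Q" by (rule L2_set_mult_ineq)
    also have "\<dots> \<le> 1 * L2_set y Q"
      using that by (intro mult_right_mono L2_set_nonneg) (simp add: L2_set_def fip_self)
    finally show "\<bar>fip Q c y\<bar> \<le> L2_set y Q" by simp
    then show "fip Q c y \<le> L2_set y Q" by linarith
  qed
  show ?thesis
  proof (cases "X = {}")
    case True
    then show ?thesis using that by auto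
  next
    case False
    then have "0 < card X" using X by (simp add: card_gt_0_iff)
    then have L: "0 < L" unfolding L_def by (intro ln_gt_zero) auto
    show ?thesis
    proof (cases "real m < 32 * L")
      \<comment> \<open>Here the right-hand side already exceeds \<open>B\<close>, which bounds
        \<open>fip Q c (v x)\<close>, so the zero subspace is enough.\<close>
      case True
      show ?thesis
      proof (rule that[of "\<lambda>_ _. 0"])
        fix c assume c: "fip Q c c \<le> 1"
        have "\<bar>fip Q c (v x)\<bar> \<le> 200 * B * sqrt (L / real m)" if "x \<in> X" for x
        proof -
          have "\<bar>fip Q c (v x)\<bar> \<le> L2_set (v x) Q" using CS[OF c] by blast
          also have "\<dots> \<le> sqrt (B\<^sup>2)"
            unfolding L2_set_def using v[OF that] by (intro real_sqrt_le_mono) (simp add: fip_self)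
          also have "\<dots> = 200 * B * (1 / 200)" using B by simp
          also have "\<dots> \<le> 200 * B * sqrt (L / real m)"
          proof (intro mult_left_mono real_le_rsqrt)
            have "1 / 32 \<le> L / real m" using True m by (simp add: field_simps)
            moreover have "(1 / 200)\<^sup>2 \<le> (1 / 32 :: real)" by (simp add: power2_eq_square)
            ultimately show "(1 / 200)\<^sup>2 \<le> L / real m" by linarith
          qed (use B in auto)
          finally show ?thesis .
        qed
        then show "\<exists>z. \<forall>x\<in>X. \<bar>fip Q c (v x) - (\<Sum>j<m. z j * fip Q (\<lambda>_. 0) (v x))\<bar>
           \<le> 200 * B * sqrt (ln (2 * real (card X) + 1) / real m)"
          by (simp add: fip_def L_def)
      qed
    next
      case big: False
      \<comment> \<open>The largest integer with \<open>2 * k * L \<le> m / 16\<close>; it is at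
        least half of \<open>m / (32 * L)\<close> because that quotient is at least 1.\<close>
      define k where "k = nat \<lfloor>real m / (32 * L)\<rfloor>"
      have one: "1 \<le> real m / (32 * L)" using big L by (simp add: field_simps)
      have kle: "real k \<le> real m / (32 * L)" using one by (simp add: k_def)
      have kge: "real m / (64 * L) \<le> real k" and k0: "0 < k"
      proof -
        have "1 \<le> \<lfloor>real m / (32 * L)\<rfloor>" using one by simp
        then show "0 < k" by (simp add: k_def)
        have "real m / (32 * L) < real k + 1" using one by (simp add: k_def)
        moreover have "1 \<le> real k" using \<open>0 < k\<close> by simp
        ultimately have "real m / (32 * L) \<le> 2 * real k" by linarith
        then show "real m / (64 * L) \<le> real k" using L by (simp add: field_simps)
      qed
      have km: "2 * real k * ln (2 * real (card X) + 1) \<le> real m / 16"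
        unfolding L_def[symmetric] using kle L by (simp add: field_simps)
      obtain e :: "nat \<Rightarrow> 'q \<Rightarrow> real" where
        e: "\<And>a. (\<Sum>x\<in>X. \<bar>a x\<bar>) \<le> 1 \<Longrightarrow> L2_set (lincomb X a v) Q
         \<le> 8 * B / sqrt (real k) + 2 / sqrt (real m) * L2_set (\<lambda>j. fip Q (e j) (lincomb X a v))
             {..<m}"
        by (rule random_rows_gelfand[of Q X B v k m]) (use Q X False B v k0 km in auto)
      define \<eta> where "\<eta> = 8 * B / sqrt (real k)"
      have \<eta>: "0 < \<eta>" using B k0 by (simp add: \<eta>_def)
      have scaled: "L2_set (lincomb X a v) Q \<le> \<eta> * (\<Sum>x\<in>X. \<bar>a x\<bar>)
         + 2 / sqrt (real m) * L2_set (\<lambda>j. fip Q (e j) (lincomb X a v)) {..<m}" for a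
      proof -
        define A where "A = (\<Sum>x\<in>X. \<bar>a x\<bar>)"
        have A0: "0 \<le> A" by (simp add: A_def sum_nonneg)
        show ?thesis
        proof (cases "A = 0")
          case True
          then have "a x = 0" if "x \<in> X" for x
            using that X by (simp add: A_def sum_nonneg_eq_0_iff)
          then have "lincomb X a v = (\<lambda>_. 0)" by (simp add: lincomb_def fun_eq_iff)
          then show ?thesis using True by (simp add: A_def[symmetric] L2_set_def fip_def)
        next
          case False
          then have A: "0 < A" using A0 by simp
          define y where "y = lincomb X (\<lambda>x. a x / A) v"
          have y: "lincomb X a v = (\<lambda>i. A * y i)"
            using A by (simp add: y_def lincomb_def sum_distrib_left fun_eq_iff)
          have "(\<Sum>x\<in>X. \<bar>a x / A\<bar>) \<le> 1"
            using A by (simp add: abs_divide sum_divide_distrib[symmetric] A_def[symmetric])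
          from e[OF this] have "A * L2_set y Q
              \<le> A * (\<eta> + 2 / sqrt (real m) * L2_set (\<lambda>j. fip Q (e j) y) {..<m})"
            unfolding \<eta>_def y_def using A by (intro mult_left_mono) auto
          moreover have "L2_set (lincomb X a v) Q = A * L2_set y Q"
            unfolding y using A by (simp add: L2_set_right_distrib)
          moreover have "L2_set (\<lambda>j. fip Q (e j) (lincomb X a v)) {..<m}
              = A * L2_set (\<lambda>j. fip Q (e j) y) {..<m}"
            unfolding y using A by (simp add: L2_set_right_distrib fip_def sum_distrib_left mult_ac)
          ultimately show ?thesis by (simp add: A_def[symmetric] algebra_simps)
        qed
      qed
      show ?thesis
      proof (rule that[of e])
        fix c assume c: "fip Q c c \<le> 1"
        have "\<exists>z. \<forall>x\<in>X. \<bar>fip Q c (v x) - (\<Sum>j<m. z j * fip Q (e j) (v x))\<bar> \<le> 3 * \<eta>"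
        proof (rule sup_approximation_by_duality[OF X \<eta>, of "2 / sqrt (real m)"])
          fix a
          have "(\<Sum>x\<in>X. a x * fip Q c (v x)) = fip Q c (lincomb X a v)" by (simp add: fip_lincomb)
          also have "\<dots> \<le> L2_set (lincomb X a v) Q" using CS[OF c] by blast
          also note scaled[of a]
          finally show "(\<Sum>x\<in>X. a x * fip Q c (v x)) \<le> \<eta> * (\<Sum>x\<in>X. \<bar>a x\<bar>)
            + 2 / sqrt (real m) * L2_set (\<lambda>j. \<Sum>x\<in>X. a x * fip Q (e j) (v x)) {..<m}"
            by (simp add: fip_lincomb)
        qed auto
        moreover have "3 * \<eta> \<le> 200 * B * sqrt (L / real m)"
        proof -
          have "\<eta> = 8 * B * sqrt (1 / real k)" by (simp add: \<eta>_def real_sqrt_divide)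
          also have "\<dots> \<le> 8 * B * sqrt (64 * (L / real m))"
            using kge k0 m L B by (intro mult_left_mono real_sqrt_le_mono) (auto simp: field_simps)
          also have "\<dots> = 64 * (B * sqrt (L / real m))" by (subst real_sqrt_mult) simp
          also have "3 * \<dots> \<le> 200 * (B * sqrt (L / real m))" using B L by simp
          finally show ?thesis by simp
        qed
        ultimately show "\<exists>z. \<forall>x\<in>X. \<bar>fip Q c (v x) - (\<Sum>j<m. z j * fip Q (e j) (v x))\<bar>
           \<le> 200 * B * sqrt (ln (2 * real (card X) + 1) / real m)"
          unfolding L_def by (meson order_trans)
      qed
    qed
  qed
qed

section \<open>Trigonometric polynomials on the torus\<close>

definition circle_measure :: "real measure" where
  "circle_measure = density lborel (\<lambda>t. ennreal (indicator {0..2 * pi} t / (2 * pi)))"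

lemma sets_circle_measure [simp, measurable_cong]: "sets circle_measure = sets borel"
  by (simp add: circle_measure_def)

lemma sets_torus_measure [simp, measurable_cong]: "sets torus_measure = sets borel"
  by (simp add: torus_measure_def)

lemma space_torus_measure [simp]: "space torus_measure = UNIV"
  by (simp add: torus_measure_def)

lemma space_circle_measure [simp]: "space circle_measure = UNIV"
  by (simp add: circle_measure_def)

lemma measure_cbox_torus: "emeasure lborel (cbox 0 (\<chi> i. 2 * pi) :: (real ^ 'd) set)
    = ennreal ((2 * pi) ^ CARD('d))"
  by (subst emeasure_lborel_cbox)
     (auto simp: Basis_vec_def inner_axis prod.reindex inj_on_def axis_eq_axis prod_constant
       UNION_singleton_eq_range)

lemma torus_measure_eq_density:
  "torus_measure = density lborel (\<lambda>x :: real ^ 'd. ennreal (\<Prod>j\<in>UNIV. indicator {0..2 * pi} (x $ j)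
      / (2 * pi)))"
proof -
  have "indicator (cbox 0 (\<chi> i. 2 * pi)) x / emeasure lborel (cbox 0 (\<chi> i. 2 * pi) :: (real ^ 'd)
      set)
     = ennreal (\<Prod>j\<in>UNIV. indicator {0..2 * pi} (x $ j) / (2 * pi))" for x :: "real ^ 'd"
  proof (cases "x \<in> cbox 0 (\<chi> i. 2 * pi)")
    case True
    then have "indicator {0..2 * pi} (x $ j) = (1 :: real)" for j
      by (simp add: mem_box_cart)
    then show ?thesis using True
      by (simp add: measure_cbox_torus prod_constant divide_ennreal[of 1, simplified]
          power_one_over)
  next
    case False
    then obtain j where j: "indicator {0..2 * pi} (x $ j) = (0 :: real)"
      by (auto simp: mem_box_cart indicator_def)
    then have "(\<Prod>j\<in>UNIV. indicator {0..2 * pi} (x $ j) / (2 * pi)) = (0 :: real)"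
      by (intro prod_zero bexI[of _ j]) (simp_all only: j finite UNIV_I div_0)
    then show ?thesis using False by (simp only:) (simp add: divide_ennreal_def)
  qed
  then show ?thesis unfolding torus_measure_def uniform_measure_def by simp
qed

lemma prod_Basis_vec:
  fixes h :: "real ^ 'd \<Rightarrow> 'a::comm_monoid_mult"
  shows "(\<Prod>b\<in>Basis. h b) = (\<Prod>j\<in>UNIV. h (axis j 1))"
proof -
  have *: "Basis = range (\<lambda>j. axis j 1 :: real ^ 'd)" by (auto simp: Basis_vec_def)
  show ?thesis unfolding * by (subst prod.reindex) (auto simp: inj_on_def axis_eq_axis)
qed

text \<open>Inverse of \<open>\<lambda>j. axis j 1\<close>, needed because the product formulas for
  \<open>lborel\<close> run over \<open>Basis\<close> instead of the coordinates.\<close>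

definition axis_index :: "real ^ 'd \<Rightarrow> 'd" where
  "axis_index b = (THE j. b = axis j 1)"

lemma axis_index_axis [simp]: "axis_index (axis j 1) = j"
  unfolding axis_index_def by (rule the_equality) (auto simp: axis_eq_axis)

lemma nn_integral_torus_prod:
  fixes f :: "'d::finite \<Rightarrow> real \<Rightarrow> ennreal"
  assumes [measurable]: "\<And>j. f j \<in> borel_measurable borel"
  shows "(\<integral>\<^sup>+ x. (\<Prod>j\<in>UNIV. f j (x $ j)) \<partial>torus_measure) = (\<Prod>j\<in>UNIV. \<integral>\<^sup>+ t. f j t \<partial>circle_measure)"
proof -
  define w :: "real \<Rightarrow> real" where "w t = indicator {0..2 * pi} t / (2 * pi)" for t
  have [measurable]: "w \<in> borel_measurable borel" unfolding w_def by measurable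
  have w0: "0 \<le> w t" for t by (simp add: w_def)
  define h where "h j t = ennreal (w t) * f j t" for j t
  have [measurable]: "h j \<in> borel_measurable borel" for j unfolding h_def by measurable
  have "(\<integral>\<^sup>+ x. (\<Prod>j\<in>UNIV. f j (x $ j)) \<partial>torus_measure)
    = (\<integral>\<^sup>+ x. ennreal (\<Prod>j\<in>UNIV. w (x $ j)) * (\<Prod>j\<in>UNIV. f j (x $ j)) \<partial>lborel)"
    unfolding torus_measure_eq_density w_def[symmetric]
    by (subst nn_integral_density) auto
  also have "\<dots> = (\<integral>\<^sup>+ x. (\<Prod>b\<in>(Basis :: (real ^ 'd) set). h (axis_index b) (x \<bullet> b)) \<partial>lborel)"
    by (intro nn_integral_cong)
       (simp add: prod_Basis_vec h_def prod.distrib prod_ennreal w0 inner_axis)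
  also have "\<dots> = (\<Prod>b\<in>(Basis :: (real ^ 'd) set). \<integral>\<^sup>+ t. h (axis_index b) t \<partial>lborel)"
    by (rule nn_integral_lborel_prod) auto
  also have "\<dots> = (\<Prod>j\<in>UNIV. \<integral>\<^sup>+ t. h j t \<partial>lborel)"
    by (simp add: prod_Basis_vec)
  also have "\<dots> = (\<Prod>j\<in>UNIV. \<integral>\<^sup>+ t. f j t \<partial>circle_measure)"
    unfolding circle_measure_def w_def[symmetric] h_def
    by (simp add: nn_integral_density)
  finally show ?thesis .
qed

lemma integral_torus_prod:
  fixes f :: "'d::finite \<Rightarrow> real \<Rightarrow> complex"
  assumes [measurable]: "\<And>j. f j \<in> borel_measurable borel" and int: "\<And>j. integrable circle_measure
      (f j)"
  shows "(LINT x|torus_measure. (\<Prod>j\<in>UNIV. f j (x $ j))) = (\<Prod>j\<in>UNIV. LINT t|circle_measure. f j t)"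
proof -
  define w :: "real \<Rightarrow> real" where "w t = indicator {0..2 * pi} t / (2 * pi)" for t
  have [measurable]: "w \<in> borel_measurable borel" unfolding w_def by measurable
  have w0: "0 \<le> w t" for t by (simp add: w_def)
  define h where "h j t = complex_of_real (w t) * f j t" for j t
  have [measurable]: "h j \<in> borel_measurable borel" for j unfolding h_def by measurable
  have hint: "integrable lborel (h j)" for j
    using int[of j] unfolding circle_measure_def w_def[symmetric] h_def
    by (subst (asm) integrable_density) (auto simp: w0 scaleR_conv_of_real)
  interpret product_sigma_finite "\<lambda>_ :: real ^ 'd. lborel :: real measure" ..
  have "(LINT x|torus_measure. (\<Prod>j\<in>UNIV. f j (x $ j)))
    = (LINT x|lborel. (\<Prod>j\<in>UNIV. w (x $ j)) *\<^sub>R (\<Prod>j\<in>UNIV. f j (x $ j)))"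
    unfolding torus_measure_eq_density w_def[symmetric]
    by (subst integral_density) (auto intro!: prod_nonneg w0)
  also have "\<dots> = (LINT x :: real ^ 'd|lborel. (\<Prod>b\<in>Basis. h (axis_index b) (x \<bullet> b)))"
    by (intro Bochner_Integration.integral_cong refl)
       (simp add: prod_Basis_vec h_def prod.distrib inner_axis scaleR_conv_of_real)
  also have "\<dots> = (LINT x |(\<Pi>\<^sub>M b\<in>(Basis :: (real ^ 'd) set). lborel). (\<Prod>b\<in>Basis. h (axis_index b) (x
      b)))"
    by (subst lborel_eq, subst integral_distr) (auto intro!: Bochner_Integration.integral_cong)
  also have "\<dots> = (\<Prod>b\<in>(Basis :: (real ^ 'd) set). LINT t|lborel. h (axis_index b) t)"
    by (rule product_integral_prod) (auto intro: hint)
  also have "\<dots> = (\<Prod>j\<in>UNIV. LINT t|lborel. h j t)"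
    by (simp add: prod_Basis_vec)
  also have "\<dots> = (\<Prod>j\<in>UNIV. LINT t|circle_measure. f j t)"
    unfolding circle_measure_def w_def[symmetric] h_def
    by (intro prod.cong refl, subst integral_density) (auto simp: w0 scaleR_conv_of_real)
  finally show ?thesis .
qed

lemma prob_space_torus_measure: "prob_space (torus_measure :: (real ^ 'd) measure)"
  unfolding torus_measure_def
  by (rule prob_space_uniform_measure) (auto simp: measure_cbox_torus ennreal_eq_0_iff not_le)

lemma prob_space_circle_measure: "prob_space circle_measure"
proof
  have "emeasure circle_measure (space circle_measure)
      = (\<integral>\<^sup>+ t. ennreal (1 / (2 * pi)) * indicator {0..2 * pi} t \<partial>lborel)"
    unfolding circle_measure_def
    by (subst emeasure_density) (auto intro!: nn_integral_cong split: split_indicator)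
  also have "\<dots> = 1" by (subst nn_integral_cmult_indicator) (auto simp: ennreal_mult[symmetric])
  finally show "emeasure circle_measure (space circle_measure) = 1" .
qed

interpretation circle: prob_space circle_measure by (rule prob_space_circle_measure)
interpretation torus: prob_space "torus_measure :: (real ^ 'd) measure"
    by (rule prob_space_torus_measure)

section \<open>Characters and Bessel's inequality\<close>

lemma integral_cis_circle:
  fixes n :: int
  shows "(LINT t|circle_measure. cis (of_int n * t)) = (if n = 0 then 1 else 0)"
proof (cases "n = 0")
  case True
  then show ?thesis using circle.prob_space by simp
next
  case False
  have "(LINT t|circle_measure. cis (of_int n * t))
     = (LINT t|lborel. indicator {0..2 * pi} t *\<^sub>R (cis (of_int n * t) / (2 * pi)))"
    unfolding circle_measure_def
    by (subst integral_density) (auto intro!: Bochner_Integration.integral_cong split: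
        split_indicator simp: scaleR_conv_of_real cis_conv_exp)
  also have "\<dots> = cis (of_int n * (2 * pi)) / (\<i> * of_int n) / (2 * pi) - cis (of_int n * 0) / (\<i> *
      of_int n) / (2 * pi)"
  proof (rule integral_FTC_Icc)
    fix t :: real
    have "((\<lambda>z. exp (\<i> * of_int n * z) / (\<i> * of_int n) / (2 * pi)) has_field_derivative
        exp (\<i> * of_int n * of_real t) / (2 * pi)) (at (of_real t))"
      using False by (auto intro!: derivative_eq_intros simp: field_simps)
    from has_vector_derivative_real_field[OF this, of "{0..2 * pi}"]
    show "((\<lambda>t. cis (of_int n * t) / (\<i> * of_int n) / (2 * pi)) has_vector_derivative cis (of_int n
        * t) / (2 * pi)) (at t within {0..2 * pi})"
      by (simp add: cis_conv_exp mult_ac)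
  qed (auto intro!: continuous_intros)
  also have "cis (of_int n * (2 * pi)) = 1"
    using cis_multiple_2pi[of "of_int n"] by (simp add: mult_ac)
  finally show ?thesis using False by simp
qed

lemma measurable_cis [measurable]: "cis \<in> borel_measurable borel"
  by (intro borel_measurable_continuous_onI continuous_intros)

lemma measurable_cnj [measurable (raw)]:
  "f \<in> borel_measurable M \<Longrightarrow> (\<lambda>x. cnj (f x)) \<in> borel_measurable M"
  by (rule measurable_compose[of f M borel cnj])
     (auto intro!: borel_measurable_continuous_onI continuous_intros)

definition texp :: "('d \<Rightarrow> int) \<Rightarrow> real ^ 'd::finite \<Rightarrow> complex" where
  "texp k x = cis (\<Sum>j\<in>UNIV. of_int (k j) * x $ j)"

lemma cis_sum: "cis (\<Sum>j\<in>A. f j) = (\<Prod>j\<in>A. cis (f j))"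
  by (induction A rule: infinite_finite_induct) (auto simp: cis_mult[symmetric])

lemma texp_eq_prod: "texp k x = (\<Prod>j\<in>UNIV. cis (of_int (k j) * x $ j))"
  by (simp add: texp_def cis_sum)

lemma norm_texp [simp]: "norm (texp k x) = 1"
  by (simp add: texp_def)

lemma continuous_on_texp [continuous_intros]: "continuous_on S (texp k)"
  unfolding texp_def by (intro continuous_intros)

lemma measurable_texp [measurable]: "texp k \<in> borel_measurable borel"
  by (intro borel_measurable_continuous_onI continuous_on_texp)

lemma texp_diff_right: "texp k (x - y) = texp k x * cnj (texp k y)"
  by (simp add: texp_def cis_cnj cis_mult algebra_simps sum_subtractf)

lemma texp_mult_cnj: "texp k x * cnj (texp l x) = texp (\<lambda>j. k j - l j) x"
  by (simp add: texp_def cis_cnj cis_mult algebra_simps sum_subtractf)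

lemma texp_shift:
  "texp k (\<chi> j. x $ j + 2 * pi * of_int (q j)) = texp k x"
proof -
  have "texp k (\<chi> j. x $ j + 2 * pi * of_int (q j))
      = texp k x * cis (2 * pi * of_int (\<Sum>j\<in>UNIV. k j * q j))"
    by (simp add: texp_def cis_mult sum.distrib sum_distrib_left algebra_simps)
  moreover have "cis (2 * pi * of_int (\<Sum>j\<in>UNIV. k j * q j)) = 1"
    by (intro cis_multiple_2pi) auto
  ultimately show ?thesis by (simp only: mult_1_right)
qed

lemma torus_periodic_texp: "torus_periodic (texp k)"
  unfolding torus_periodic_def
proof (intro allI)
  fix x :: "real ^ 'a" and i
  have "x + axis i (2 * pi) = (\<chi> j. x $ j + 2 * pi * of_int (if j = i then 1 else 0))"
    by (auto simp: vec_eq_iff axis_def)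
  then show "texp k (x + axis i (2 * pi)) = texp k x"
    using texp_shift[of k x "\<lambda>j. if j = i then 1 else 0"] by simp
qed

lemma integral_texp: "(LINT x|torus_measure. texp k x) = (if k = (\<lambda>_. 0) then 1 else 0)"
proof -
  have "(LINT x|torus_measure. texp k x) = (\<Prod>j\<in>UNIV. LINT t|circle_measure. cis (of_int (k j) * t))"
    unfolding texp_eq_prod
    by (rule integral_torus_prod) (auto intro!: circle.integrable_const_bound[of _ 1])
  also have "\<dots> = (if k = (\<lambda>_. 0) then 1 else 0)"
    by (auto simp: integral_cis_circle fun_eq_iff)
  finally show ?thesis .
qed

lemma integrable_torus_bounded:
  assumes "f \<in> borel_measurable borel" "\<And>x. norm (f x) \<le> B"
  shows "integrable torus_measure (f :: real ^ 'd \<Rightarrow> 'b::{banach, second_countable_topology})"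
  by (rule torus.integrable_const_bound[of _ B]) (use assms in auto)

lemma integrable_texp [simp]: "integrable torus_measure (texp k)"
  by (rule integrable_torus_bounded[of _ 1]) auto

lemma integral_texp_cnj: "(LINT x|torus_measure. texp k x * cnj (texp l x)) = (if k
    = l then 1 else 0)"
  by (auto simp: texp_mult_cnj integral_texp fun_eq_iff)

text \<open>Expansion of the nonnegative integral of \<open>(norm (\<phi> y - S y))\<^sup>2\<close>,
  where \<open>S\<close> is the Fourier sum of \<open>\<phi>\<close> over \<open>Q\<close>.\<close>

lemma bessel:
  fixes \<phi> :: "real ^ 'd \<Rightarrow> complex"
  assumes Q: "finite Q" and [measurable]: "\<phi> \<in> borel_measurable borel"
    and int: "integrable torus_measure (\<lambda>y. (norm (\<phi> y))\<^sup>2)"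
  shows "(\<Sum>k\<in>Q. (norm (LINT y|torus_measure. \<phi> y * cnj (texp k y)))\<^sup>2)
      \<le> (LINT y|torus_measure. (norm (\<phi> y))\<^sup>2)"
proof -
  define a where "a k = (LINT y|torus_measure. \<phi> y * cnj (texp k y))" for k
  have int1: "integrable torus_measure \<phi>"
  proof (rule Bochner_Integration.integrable_bound)
    show "integrable torus_measure (\<lambda>y. 1 + (norm (\<phi> y))\<^sup>2)" using int by simp
    have "norm (\<phi> y) \<le> norm (1 + (norm (\<phi> y))\<^sup>2)" for y
    proof -
      have "0 \<le> (norm (\<phi> y) - 1)\<^sup>2" by simp
      then have "2 * norm (\<phi> y) \<le> 1 + (norm (\<phi> y))\<^sup>2" unfolding power2_diff by simp
      then show ?thesis using norm_ge_zero[of "\<phi> y"] by (smt (verit) real_norm_def)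
    qed
    then show "AE y in torus_measure. norm (\<phi> y) \<le> norm (1 + (norm (\<phi> y))\<^sup>2)" by simp
  qed auto
  have int2: "integrable torus_measure (\<lambda>y. \<phi> y * cnj (texp k y))" for k
    by (rule Bochner_Integration.integrable_bound[OF int1]) (auto simp: norm_mult)
  have int3: "integrable torus_measure (\<lambda>y. Re (cnj (a k) * (\<phi> y * cnj (texp k y))))" for k
    using int2[of k] by (intro integrable_Re integrable_mult_right)
  define S where "S y = (\<Sum>k\<in>Q. a k * texp k y)" for y
  have nS: "complex_of_real ((norm (S y))\<^sup>2) = (\<Sum>k\<in>Q. \<Sum>l\<in>Q. (a k * cnj (a l)) * (texp k y * cnj
      (texp l y)))" for y
    unfolding complex_norm_square S_def by (simp add: sum_product mult_ac)
  have intS: "integrable torus_measure (\<lambda>y. (a k * cnj (a l)) * (texp k y * cnj (texp l y)))"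
      for k l
    by (simp add: texp_mult_cnj)
  have "complex_of_real (LINT y|torus_measure. (norm (S y))\<^sup>2)
      = (LINT y|torus_measure. (\<Sum>k\<in>Q. \<Sum>l\<in>Q. (a k * cnj (a l)) * (texp k y * cnj (texp l y))))"
    unfolding nS[symmetric] by (rule integral_complex_of_real[symmetric])
  also have "\<dots> = (\<Sum>k\<in>Q. \<Sum>l\<in>Q. (a k * cnj (a l)) * (if k = l then 1 else 0))"
    using intS by (simp add: integral_texp_cnj)
  also have "\<dots> = complex_of_real (\<Sum>k\<in>Q. (norm (a k))\<^sup>2)"
    unfolding of_real_sum complex_norm_square using Q by (simp add: if_distrib cong: if_cong)
  finally have IS: "(LINT y|torus_measure. (norm (S y))\<^sup>2) = (\<Sum>k\<in>Q. (norm (a k))\<^sup>2)"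
    by (simp only: of_real_eq_iff)
  have intSS: "integrable torus_measure (\<lambda>y. (norm (S y))\<^sup>2)"
  proof (rule integrable_torus_bounded[of _ "(\<Sum>k\<in>Q. norm (a k))\<^sup>2"])
    fix x
    have "norm (S x) \<le> (\<Sum>k\<in>Q. norm (a k))"
      unfolding S_def by (rule order_trans[OF norm_sum]) (simp add: norm_mult)
    then show "norm ((norm (S x))\<^sup>2) \<le> (\<Sum>k\<in>Q. norm (a k))\<^sup>2" by (simp add: power_mono)
  qed (simp add: S_def)
  have cross: "(norm (\<phi> y - S y))\<^sup>2 = (norm (\<phi> y))\<^sup>2 + (norm (S y))\<^sup>2 - 2 * (\<Sum>k\<in>Q. Re (cnj (a k) *
      (\<phi> y * cnj (texp k y))))" for y
  proof -
    have "(norm (\<phi> y - S y))\<^sup>2 = (norm (\<phi> y))\<^sup>2 + (norm (S y))\<^sup>2 - 2 * Re (\<phi> y * cnj (S y))"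
      unfolding cmod_power2 by (simp add: power2_eq_square algebra_simps)
    also have "\<phi> y * cnj (S y) = (\<Sum>k\<in>Q. cnj (a k) * (\<phi> y * cnj (texp k y)))"
      by (simp add: S_def sum_distrib_left mult_ac)
    finally show ?thesis by simp
  qed
  have re: "(LINT y|torus_measure. Re (cnj (a k) * (\<phi> y * cnj (texp k y)))) = (norm (a k))\<^sup>2" for k
  proof -
    have "(LINT y|torus_measure. Re (cnj (a k) * (\<phi> y * cnj (texp k y))))
        = Re (LINT y|torus_measure. cnj (a k) * (\<phi> y * cnj (texp k y)))"
      using int2 by (intro integral_Re) auto
    also have "\<dots> = Re (cnj (a k) * a k)" by (simp add: a_def)
    also have "\<dots> = (norm (a k))\<^sup>2" unfolding cmod_power2 by (simp add: power2_eq_square)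
    finally show ?thesis .
  qed
  have "0 \<le> (LINT y|torus_measure. (norm (\<phi> y - S y))\<^sup>2)" by simp
  also have "\<dots> = (LINT y|torus_measure. (norm (\<phi> y))\<^sup>2) + (\<Sum>k\<in>Q. (norm (a k))\<^sup>2)
     - 2 * (\<Sum>k\<in>Q. LINT y|torus_measure. Re (cnj (a k) * (\<phi> y * cnj (texp k y))))"
    unfolding cross using int intSS int3 by (simp add: IS)
  finally show ?thesis unfolding re unfolding a_def by linarith
qed

section \<open>Trigonometric polynomials and discretization of the uniform norm\<close>

definition tpoly :: "('d \<Rightarrow> int) set \<Rightarrow> (('d \<Rightarrow> int) \<Rightarrow> complex) \<Rightarrow> real ^ 'd::finite \<Rightarrow> complex" where
  "tpoly Q b x = (\<Sum>k\<in>Q. b k * texp k x)"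

lemma norm_tpoly_le: "norm (tpoly Q b x) \<le> (\<Sum>k\<in>Q. norm (b k))"
  unfolding tpoly_def by (rule order_trans[OF norm_sum]) (simp add: norm_mult)

lemma continuous_on_tpoly [continuous_intros]: "continuous_on S (tpoly Q b)"
  unfolding tpoly_def by (intro continuous_intros)

lemma measurable_tpoly [measurable]: "tpoly Q b \<in> borel_measurable borel"
  by (intro borel_measurable_continuous_onI continuous_on_tpoly)

lemma tpoly_coeff:
  assumes "finite Q" "l \<in> Q"
  shows "(LINT x|torus_measure. tpoly Q b x * cnj (texp l x)) = b l"
proof -
  have "(LINT x|torus_measure. tpoly Q b x * cnj (texp l x))
      = (\<Sum>k\<in>Q. LINT x|torus_measure. b k * (texp k x * cnj (texp l x)))"
    unfolding tpoly_def sum_distrib_right mult.assoc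
    by (rule Bochner_Integration.integral_sum) (simp add: texp_mult_cnj)
  also have "\<dots> = (\<Sum>k\<in>Q. b k * (if k = l then 1 else 0))"
    by (simp add: integral_texp_cnj)
  also have "\<dots> = b l" using assms by (simp add: if_distrib cong: if_cong)
  finally show ?thesis .
qed

text \<open>A crude substitute for Bernstein's inequality: with it the modulus of continuity of a
  polynomial is estimated term by term from its uniform norm.\<close>

lemma norm_coeff_le_sup:
  assumes "finite Q" "l \<in> Q" "\<And>x. norm (tpoly Q b x) \<le> s"
  shows "norm (b l) \<le> s"
proof -
  have int: "integrable torus_measure (\<lambda>x. tpoly Q b x * cnj (texp l x))"
    by (rule integrable_torus_bounded[of _ s]) (use assms in \<open>auto simp: norm_mult\<close>)
  have "norm (LINT x|torus_measure. tpoly Q b x * cnj (texp l x))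
      \<le> (LINT x|torus_measure. norm (tpoly Q b x * cnj (texp l x)))"
    by (rule Bochner_Integration.integral_norm_bound)
  also have "\<dots> \<le> s"
    using int by (intro torus.integral_le_const integrable_norm) (auto simp: norm_mult assms)
  finally have "norm (LINT x|torus_measure. tpoly Q b x * cnj (texp l x)) \<le> s" .
  then show ?thesis using assms by (simp add: tpoly_coeff)
qed

lemma norm_cis_diff_le: "norm (cis a - cis b) \<le> \<bar>a - b\<bar>"
proof -
  have "norm (cis a - cis b) = norm (cis (a - b) - 1)"
  proof -
    have "cis a - cis b = cis b * (cis (a - b) - 1)" by (simp add: right_diff_distrib cis_mult)
    then show ?thesis by (simp add: norm_mult)
  qed
  also have "\<dots> \<le> \<bar>a - b\<bar>"
    using dist_exp_i_1[of "a - b"] abs_sin_x_le_abs_x[of "(a - b) / 2"] by (simp add: cis_conv_exp)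
  finally show ?thesis .
qed

lemma norm_texp_diff_le:
  fixes x y :: "real ^ 'd"
  assumes k: "\<And>j. \<bar>k j\<bar> \<le> D" and h: "\<And>j. \<bar>x $ j - y $ j\<bar> \<le> h"
  shows "norm (texp k x - texp k y) \<le> real CARD('d) * (of_int D * h)"
proof -
  have "norm (texp k x - texp k y) \<le> \<bar>\<Sum>j\<in>UNIV. of_int (k j) * (x $ j - y $ j)\<bar>"
    using norm_cis_diff_le[of "\<Sum>j\<in>UNIV. of_int (k j) * x $ j" "\<Sum>j\<in>UNIV. of_int (k j) * y $ j"]
    by (simp add: texp_def sum_subtractf algebra_simps)
  also have "\<dots> \<le> (\<Sum>j\<in>UNIV. \<bar>of_int (k j)\<bar> * \<bar>x $ j - y $ j\<bar>)"
    by (rule order_trans[OF sum_abs]) (simp add: abs_mult)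
  also have "\<dots> \<le> (\<Sum>j\<in>(UNIV :: 'd set). of_int D * h)"
  proof (intro sum_mono mult_mono)
    fix j
    show "\<bar>of_int (k j) :: real\<bar> \<le> of_int D" using k[of j] by linarith
    then show "0 \<le> (of_int D :: real)" by linarith
  qed (use h in auto)
  finally show ?thesis by simp
qed

definition grid :: "nat \<Rightarrow> (real ^ 'd::finite) set" where
  "grid N = (\<lambda>n. \<chi> j. 2 * pi * real (n j) / real N) ` (\<Pi>\<^sub>E j\<in>UNIV. {..<N})"

lemma finite_grid: "finite (grid N)"
  by (simp add: grid_def finite_PiE)

lemma card_grid: "card (grid N :: (real ^ 'd::finite) set) \<le> N ^ CARD('d)"
  unfolding grid_def by (rule order_trans[OF card_image_le]) (auto simp: finite_PiE card_PiE)

text \<open>With \<open>s\<close> the uniform norm, passing to the nearest lower grid point changes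
  the value by at most \<open>s / 2\<close>, hence \<open>s \<le> \<epsilon> + s / 2\<close>. The
  grid is far finer than optimal, which is harmless since its size enters the widths only through a
  logarithm.\<close>

lemma tpoly_sup_le_grid:
  fixes Q :: "('d::finite \<Rightarrow> int) set"
  assumes Q: "finite Q" and D: "\<And>k j. k \<in> Q \<Longrightarrow> \<bar>k j\<bar> \<le> D"
    and N: "0 < N" "4 * pi * real CARD('d) * of_int D * real (card Q) \<le> real N"
    and g: "\<And>x. x \<in> grid N \<Longrightarrow> norm (tpoly Q b x) \<le> \<epsilon>"
  shows "norm (tpoly Q b x) \<le> 2 * \<epsilon>"
proof -
  define s where "s = (SUP x. norm (tpoly Q b x))"
  have bdd: "bdd_above (range (\<lambda>x. norm (tpoly Q b x)))"
    by (rule bdd_aboveI[of _ "\<Sum>k\<in>Q. norm (b k)"]) (auto intro: norm_tpoly_le)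
  have le_s: "norm (tpoly Q b x) \<le> s" for x
    unfolding s_def by (rule cSUP_upper[OF _ bdd]) auto
  have s0: "0 \<le> s" using le_s[of 0] norm_ge_zero order_trans by blast
  have half: "norm (tpoly Q b x) \<le> \<epsilon> + s / 2" for x
  proof -
    \<comment> \<open>\<open>y\<close> is the lattice point just below \<open>x\<close>; it may lie
      outside the fundamental domain, and reduction modulo \<open>N\<close> replaces it by the grid
      point \<open>w\<close> with the same values.\<close>
    define n where "n j = \<lfloor>real N * x $ j / (2 * pi)\<rfloor>" for j
    define y :: "real ^ 'd" where "y = (\<chi> j. 2 * pi * of_int (n j) / real N)"
    define w :: "real ^ 'd" where "w = (\<chi> j. 2 * pi * real (nat (n j mod int N)) / real N)"
    have w: "w \<in> grid N"
      unfolding grid_def w_def using N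
      by (intro image_eqI[of _ _ "\<lambda>j. nat (n j mod int N)"]) (auto simp: nat_less_iff)
    have "y = (\<chi> j. w $ j + 2 * pi * of_int (n j div int N))"
    proof -
      have "2 * pi * of_int (n j) / real N = 2 * pi * real (nat (n j mod int N)) / real N + 2 * pi *
          of_int (n j div int N)" for j
      proof -
        have "(of_int (int N * (n j div int N) + n j mod int N) :: real)
            = real N * of_int (n j div int N) + of_int (n j mod int N)"
          by (simp only: of_int_add of_int_mult of_int_of_nat_eq)
        then have "(of_int (n j) :: real) = real N * of_int (n j div int N) + of_int (n j mod int
            N)"
          by (simp only: mult_div_mod_eq)
        moreover have "(of_int (n j mod int N) :: real) = real (nat (n j mod int N))"
          using N by (simp add: of_nat_nat)
        ultimately have "(of_int (n j) :: real)
            = real N * of_int (n j div int N) + real (nat (n j mod int N))"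
          by (simp only:)
        then show ?thesis using N by (simp only:) (simp add: add_divide_distrib distrib_left)
      qed
      then show ?thesis by (simp add: y_def w_def vec_eq_iff)
    qed
    then have yw: "tpoly Q b y = tpoly Q b w"
      by (simp add: tpoly_def texp_shift)
    have xy: "\<bar>x $ j - y $ j\<bar> \<le> 2 * pi / real N" for j
    proof -
      define t where "t = real N * x $ j / (2 * pi)"
      have "x $ j - y $ j = 2 * pi / real N * (t - of_int \<lfloor>t\<rfloor>)"
        using N by (simp add: y_def n_def t_def field_simps)
      moreover have "\<bar>t - of_int \<lfloor>t\<rfloor>\<bar> \<le> 1" by linarith
      then have "2 * pi / real N * \<bar>t - of_int \<lfloor>t\<rfloor>\<bar> \<le> 2 * pi / real N * 1"
        using N by (intro mult_left_mono) auto
      ultimately show ?thesis by (simp add: abs_mult)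
    qed
    have "norm (tpoly Q b x - tpoly Q b y) \<le> (\<Sum>k\<in>Q. norm (b k) * norm (texp k x - texp k y))"
      unfolding tpoly_def sum_subtractf[symmetric] right_diff_distrib[symmetric]
      by (rule order_trans[OF norm_sum]) (simp add: norm_mult)
    also have "\<dots> \<le> (\<Sum>k\<in>Q. s * (real CARD('d) * (of_int D * (2 * pi / real N))))"
      using s0 by (intro sum_mono mult_mono norm_texp_diff_le norm_coeff_le_sup[OF Q _ le_s] D xy)
          auto
    also have "\<dots> = s * (4 * pi * real CARD('d) * of_int D * real (card Q)) / (2 * real N)"
      by simp
    also have "\<dots> \<le> s * real N / (2 * real N)"
      using N s0 by (intro divide_right_mono mult_left_mono) auto
    also have "\<dots> = s / 2" using N by simp
    finally have "norm (tpoly Q b x - tpoly Q b y) \<le> s / 2" .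
    moreover have "norm (tpoly Q b x) \<le> norm (tpoly Q b y) + norm (tpoly Q b x - tpoly Q b y)"
      by (metis norm_triangle_sub)
    ultimately show ?thesis using g[OF w] yw by simp
  qed
  have "s \<le> \<epsilon> + s / 2"
    unfolding s_def using half[unfolded s_def] by (intro cSUP_least) auto
  then show ?thesis using le_s[of x] by linarith
qed

text \<open>Evaluation at a point is an inner product with a vector of squared norm
  \<open>card Q\<close>, so the Euclidean result applies with \<open>B = sqrt (card Q)\<close>,
  first on the grid and then on the whole torus. The dimension of the ambient space enters through
  \<open>B\<close>, the grid through the logarithm.\<close>

lemma tpoly_L2_ball_sup_width:
  fixes Q :: "('d::finite \<Rightarrow> int) set"
  assumes Q: "finite Q" "Q \<noteq> {}" and D: "\<And>k j. k \<in> Q \<Longrightarrow> \<bar>k j\<bar> \<le> D" and "0 < m"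
    and N: "0 < N" "4 * pi * real CARD('d) * of_int D * real (card Q) \<le> real N"
  obtains g :: "nat \<Rightarrow> ('d \<Rightarrow> int) \<Rightarrow> complex" where
    "\<And>c. (\<Sum>k\<in>Q. (norm (c k))\<^sup>2) \<le> 1 \<Longrightarrow> \<exists>z. \<forall>x.
      norm (tpoly Q c x - (\<Sum>j<m. of_real (z j) * tpoly Q (g j) x))
      \<le> 800 * sqrt (real (card Q) * (real CARD('d) * ln (5 * real N)) / real m)"
proof -
  define X where "X = (grid N :: (real ^ 'd) set) \<times> (UNIV :: bool set)"
  define I where "I = Q \<times> (UNIV :: bool set)"
  \<comment> \<open>Reduction to real numbers: \<open>t\<close> selects the real or imaginary part
    of a coefficient, \<open>s\<close> the real or imaginary part of the value.\<close>
  define v :: "(real ^ 'd) \<times> bool \<Rightarrow> ('d \<Rightarrow> int) \<times> bool \<Rightarrow> real" where "v = (\<lambda>(x, s) (k, t).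
      if s then (if t then Re (texp k x) else - Im (texp k x))
      else (if t then Im (texp k x) else Re (texp k x)))"
  define B where "B = sqrt (real (card Q))"
  have B: "0 < B" using Q by (simp add: B_def card_gt_0_iff)
  have sumI: "(\<Sum>i\<in>I. h i) = (\<Sum>k\<in>Q. h (k, True) + h (k, False))" for h :: "_ \<Rightarrow> real"
    by (simp add: I_def sum.cartesian_product' UNIV_bool add.commute)
  have fin: "finite I" "finite X" using Q by (auto simp: I_def X_def finite_grid)
  have v_norm: "fip I (v p) (v p) \<le> B\<^sup>2" for p
  proof -
    obtain x s where p: "p = (x, s)" by force
    have "(Re (texp k x))\<^sup>2 + (Im (texp k x))\<^sup>2 = 1" for k
      using norm_texp[of k x] by (simp flip: cmod_power2)
    then show ?thesis
      by (cases s) (simp_all add: p fip_self sumI v_def B_def add.commute)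
  qed
  obtain \<gamma> :: "nat \<Rightarrow> ('d \<Rightarrow> int) \<times> bool \<Rightarrow> real" where \<gamma>:
    "\<And>c. fip I c c \<le> 1 \<Longrightarrow> \<exists>z. \<forall>x\<in>X. \<bar>fip I c (v x) - (\<Sum>j<m. z j * fip I (\<gamma> j) (v x))\<bar>
       \<le> 200 * B * sqrt (ln (2 * real (card X) + 1) / real m)"
    by (rule L2_ball_sup_width[of I X B m v]) (use fin B \<open>0 < m\<close> v_norm in auto)
  define R where "R c = (\<lambda>(k, t). if t then Re (c k) else Im (c k))" for c :: "('d \<Rightarrow> int) \<Rightarrow> complex"
  define g where "g j k = Complex (\<gamma> j (k, True)) (\<gamma> j (k, False))" for j k
  have Rg: "R (g j) = \<gamma> j" for j by (auto simp: R_def g_def fun_eq_iff)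
  have fipR: "fip I (R c) (v (x, True)) = Re (tpoly Q c x)" "fip I (R c) (v (x, False))
      = Im (tpoly Q c x)" for c x
    unfolding fip_def sumI tpoly_def by (simp_all add: R_def v_def Re_sum Im_sum algebra_simps)
  have lnX: "ln (2 * real (card X) + 1) \<le> real CARD('d) * ln (5 * real N)"
  proof -
    have "card X \<le> N ^ CARD('d) * 2"
      using card_grid[where 'd = 'd, of N] by (simp add: X_def card_cartesian_product)
    then have "real (card X) \<le> real N ^ CARD('d) * 2"
      by (metis of_nat_le_iff of_nat_mult of_nat_numeral of_nat_power)
    moreover have "1 \<le> real N ^ CARD('d)" using N by (intro one_le_power) auto
    ultimately have "2 * real (card X) + 1 \<le> 5 * real N ^ CARD('d)" by linarith
    also have "\<dots> \<le> 5 ^ CARD('d) * real N ^ CARD('d)"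
      by (intro mult_right_mono self_le_power) auto
    also have "\<dots> = (5 * real N) ^ CARD('d)" by (simp add: power_mult_distrib)
    finally have "ln (2 * real (card X) + 1) \<le> ln ((5 * real N) ^ CARD('d))"
      by (intro ln_mono) auto
    also have "\<dots> = real CARD('d) * ln (5 * real N)" by (rule ln_realpow)
    finally show ?thesis .
  qed
  \<comment> \<open>The final constant 800 is 200, doubled for joining real and imaginary parts and
    doubled again by \<open>tpoly_sup_le_grid\<close>.\<close>
  define \<epsilon> where "\<epsilon> = 200 * sqrt (real (card Q) * (real CARD('d) * ln (5 * real N)) / real m)"
  have eps: "200 * B * sqrt (ln (2 * real (card X) + 1) / real m) \<le> \<epsilon>"
  proof -
    have "200 * B * sqrt (ln (2 * real (card X) + 1) / real m)
        = 200 * sqrt (real (card Q) * ln (2 * real (card X) + 1) / real m)"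
      by (simp add: B_def real_sqrt_mult real_sqrt_divide)
    also have "\<dots> \<le> \<epsilon>" unfolding \<epsilon>_def
      using lnX by (intro mult_left_mono real_sqrt_le_mono divide_right_mono) auto
    finally show ?thesis .
  qed
  show ?thesis
  proof (rule that[of g])
    fix c :: "('d \<Rightarrow> int) \<Rightarrow> complex" assume c: "(\<Sum>k\<in>Q. (norm (c k))\<^sup>2) \<le> 1"
    have "fip I (R c) (R c) \<le> 1" using c by (simp add: fip_self sumI R_def cmod_power2)
    from \<gamma>[OF this] obtain z where z: "\<And>p. p \<in> X
        \<Longrightarrow> \<bar>fip I (R c) (v p) - (\<Sum>j<m. z j * fip I (\<gamma> j) (v p))\<bar> \<le> \<epsilon>"
      using eps by (meson order_trans)
    define b where "b k = c k - (\<Sum>j<m. of_real (z j) * g j k)" for k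
    have b: "tpoly Q b x = tpoly Q c x - (\<Sum>j<m. of_real (z j) * tpoly Q (g j) x)" for x
    proof -
      have "(\<Sum>j<m. of_real (z j) * tpoly Q (g j) x)
          = (\<Sum>k\<in>Q. (\<Sum>j<m. of_real (z j) * g j k) * texp k x)"
        unfolding tpoly_def sum_distrib_left sum_distrib_right
            by (subst sum.swap) (simp add: mult_ac)
      then show ?thesis by (simp add: tpoly_def b_def left_diff_distrib sum_subtractf)
    qed
    have on_grid: "norm (tpoly Q b x) \<le> 2 * \<epsilon>" if x: "x \<in> grid N" for x
    proof -
      have "\<bar>Re (tpoly Q b x)\<bar> \<le> \<epsilon>"
        using z[of "(x, True)"] x by (simp add: X_def b fipR Rg[symmetric])
      moreover have "\<bar>Im (tpoly Q b x)\<bar> \<le> \<epsilon>"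
        using z[of "(x, False)"] x by (simp add: X_def b fipR Rg[symmetric])
      ultimately show ?thesis using cmod_le[of "tpoly Q b x"] by linarith
    qed
    have "norm (tpoly Q b x) \<le> 2 * (2 * \<epsilon>)" for x
      by (rule tpoly_sup_le_grid[OF Q(1) _ N on_grid]) (rule D)
    then have "\<forall>x. norm (tpoly Q b x) \<le> 4 * \<epsilon>" by simp
    then show "\<exists>z. \<forall>x. norm (tpoly Q c x - (\<Sum>j<m. of_real (z j) * tpoly Q (g j) x))
      \<le> 800 * sqrt (real (card Q) * (real CARD('d) * ln (5 * real N)) / real m)"
      unfolding b \<epsilon>_def by (intro exI[of _ z]) simp
  qed
qed

section \<open>Dyadic blocks of the Bernoulli kernel\<close>

lemma abel_summation:
  fixes w :: complex and b :: "nat \<Rightarrow> real"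
  shows "(1 - w) * (\<Sum>k<Suc n. b k * w ^ Suc k)
    = b 0 * w + (\<Sum>k<n. (b (Suc k) - b k) * w ^ (k + 2)) - b n * w ^ (n + 2)"
proof (induction n)
  case (Suc n)
  have "(1 - w) * (\<Sum>k<Suc (Suc n). b k * w ^ Suc k)
    = (1 - w) * (\<Sum>k<Suc n. b k * w ^ Suc k) + (1 - w) * (b (Suc n) * w ^ Suc (Suc n))"
    by (simp only: sum.lessThan_Suc[of _ "Suc n"] distrib_left)
  then show ?case by (simp only: Suc.IH) (simp add: algebra_simps)
qed (simp add: algebra_simps power2_eq_square)

text \<open>Abel summation moves the differences onto \<open>b\<close>; their absolute values
  telescope, so the transformed series converges absolutely.\<close>

lemma dirichlet_convergent:
  fixes w :: complex and b :: "nat \<Rightarrow> real"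
  assumes w: "norm w = 1" "w \<noteq> 1" and dec: "decseq b" and lim: "b \<longlonglongrightarrow> 0"
  shows "summable (\<lambda>k. b k * w ^ Suc k)"
proof -
  have "summable (\<lambda>k. b k - b (Suc k))"
    using telescope_summable'[OF lim] .
  moreover have "norm ((b (Suc k) - b k) * w ^ (k + 2)) = b k - b (Suc k)" for k
  proof -
    have "\<bar>b (Suc k) - b k\<bar> = b k - b (Suc k)" using dec by (simp add: decseq_SucD)
    moreover have "norm (complex_of_real (b (Suc k)) - complex_of_real (b k)) = \<bar>b (Suc k) - b k\<bar>"
      by (simp flip: of_real_diff)
    ultimately show ?thesis using w by (simp add: norm_mult norm_power)
  qed
  ultimately have "summable (\<lambda>k. norm ((b (Suc k) - b k) * w ^ (k + 2)))" by simp
  then have "summable (\<lambda>k. (b (Suc k) - b k) * w ^ (k + 2))"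
    by (rule summable_norm_cancel)
  then have conv: "(\<lambda>n. \<Sum>k<n. (b (Suc k) - b k) * w ^ (k + 2))
      \<longlonglongrightarrow> suminf (\<lambda>k. (b (Suc k) - b k) * w ^ (k + 2))"
    by (rule summable_LIMSEQ)
  have bw: "(\<lambda>n. of_real (b n) * w ^ (n + 2)) \<longlonglongrightarrow> 0"
  proof (rule Lim_null_comparison)
    show "\<forall>\<^sub>F n in sequentially. norm (of_real (b n) * w ^ (n + 2)) \<le> \<bar>b n\<bar>"
      using w by (simp add: norm_mult norm_power)
    show "(\<lambda>n. \<bar>b n\<bar>) \<longlonglongrightarrow> 0" using lim by (rule tendsto_rabs_zero)
  qed
  have "(\<lambda>n. (1 - w) * (\<Sum>k<Suc n. b k * w ^ Suc k))
      \<longlonglongrightarrow> b 0 * w + suminf (\<lambda>k. (b (Suc k) - b k) * w ^ (k + 2)) - 0"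
    unfolding abel_summation by (intro tendsto_intros conv bw)
  then have "(\<lambda>n. (1 - w) * (\<Sum>k<Suc n. b k * w ^ Suc k) / (1 - w))
      \<longlonglongrightarrow> (b 0 * w + suminf (\<lambda>k. (b (Suc k) - b k) * w ^ (k + 2)) - 0) / (1 - w)"
    using w by (intro tendsto_intros) auto
  then have "(\<lambda>n. \<Sum>k<Suc n. b k * w ^ Suc k) \<longlonglongrightarrow> (b 0 * w + suminf (\<lambda>k. (b (Suc k) - b k) * w ^ (k +
      2)) - 0) / (1 - w)"
    using w by simp
  then have "(\<lambda>n. \<Sum>k<n. b k * w ^ Suc k) \<longlonglongrightarrow> (b 0 * w + suminf (\<lambda>k. (b (Suc k) - b k) * w ^ (k + 2)) -
      0) / (1 - w)"
    by (rule LIMSEQ_imp_Suc)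
  then show ?thesis unfolding summable_def sums_def by blast
qed

lemma summable_bernoulli_series:
  assumes "0 < r" "cis x \<noteq> 1"
  shows "summable (\<lambda>k. real (Suc k) powr (- r) * cos (real (Suc k) * x - r * pi / 2))"
proof -
  have "summable (\<lambda>k. complex_of_real (real (Suc k) powr (- r)) * cis x ^ Suc k)"
  proof (rule dirichlet_convergent)
    show "decseq (\<lambda>k. real (Suc k) powr (- r))"
      unfolding decseq_Suc_iff using assms by (auto intro!: powr_mono2')
    have "(\<lambda>k. real k powr (- r)) \<longlonglongrightarrow> 0"
      using assms by real_asymp
    then show "(\<lambda>k. real (Suc k) powr (- r)) \<longlonglongrightarrow> 0" by (rule LIMSEQ_Suc)
  qed (use assms in auto)
  then have "summable (\<lambda>k. cis (- (r * pi / 2)) * (complex_of_real (real (Suc k) powr (- r)) * cis x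
      ^ Suc k))"
    by (rule summable_mult)
  then have "summable (\<lambda>k. Re (cis (- (r * pi / 2)) * (complex_of_real (real (Suc k) powr (- r)) *
      cis x ^ Suc k)))"
    by (rule summable_Re)
  moreover have "Re (cis (- (r * pi / 2)) * (complex_of_real (real (Suc k) powr (- r)) * cis x ^ Suc
      k))
    = real (Suc k) powr (- r) * cos (real (Suc k) * x - r * pi / 2)" for k
  proof -
    have "cis (- (r * pi / 2)) * (complex_of_real (real (Suc k) powr (- r)) * cis x ^ Suc k)
      = complex_of_real (real (Suc k) powr (- r)) * (cis (- (r * pi / 2)) * cis (real (Suc k) * x))"
      by (subst Complex.DeMoivre) (rule mult.left_commute)
    also have "cis (- (r * pi / 2)) * cis (real (Suc k) * x) = cis (real (Suc k) * x - r * pi / 2)"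
      unfolding cis_mult by (rule arg_cong[of _ _ cis]) simp
    finally have "cis (- (r * pi / 2)) * (complex_of_real (real (Suc k) powr (- r)) * cis x ^ Suc k)
      = complex_of_real (real (Suc k) powr (- r)) * cis (real (Suc k) * x - r * pi / 2)" .
    then show ?thesis
      by (simp only: times_complex.sel Re_complex_of_real Im_complex_of_real cis.sel mult_zero_left
          diff_zero)
  qed
  ultimately show ?thesis by (simp del: of_nat_Suc)
qed

text \<open>
  The weights \<open>trap s\<close> are those of the de la Vallee Poussin means: they average the partial sums
  of the series with \<open>2 ^ s \<le> N < 2 ^ Suc s\<close>. The kernels \<open>kap r s\<close> are the differences of
  consecutive means.
\<close>

definition trap :: "nat \<Rightarrow> nat \<Rightarrow> real" where
  "trap s k = max 0 (min 1 (2 - real k / 2 ^ s))"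

definition window :: "nat \<Rightarrow> nat \<Rightarrow> real" where
  "window s k = trap s k - (if s = 0 then 0 else trap (s - 1) k)"

definition bcoef :: "real \<Rightarrow> nat \<Rightarrow> nat \<Rightarrow> real" where
  "bcoef r s k = (if k = 0 then 0 else window s k * real k powr (- r))"

definition kap :: "real \<Rightarrow> nat \<Rightarrow> real \<Rightarrow> real" where
  "kap r s x = (if s = 0 then 1 else 0) +
     2 * (\<Sum>k\<in>{1..2 ^ Suc s}. bcoef r s k * cos (real k * x - r * pi / 2))"

section \<open>Dyadic windows and their coefficients\<close>

lemma trap_card: "trap s k = real (card {N \<in> {2 ^ s..<2 ^ Suc s}. k \<le> N}) / 2 ^ s"
proof -
  have "{N \<in> {2 ^ s..<2 ^ Suc s}. k \<le> N} = {max k (2 ^ s)..<2 ^ Suc s}" by auto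
  then have c: "card {N \<in> {2 ^ s..<2 ^ Suc s}. k \<le> N} = 2 ^ Suc s - max k (2 ^ s)" by simp
  consider "k \<le> 2 ^ s" | "2 ^ s < k" "k \<le> 2 ^ Suc s" | "2 ^ Suc s < k" by linarith
  then show ?thesis
  proof cases
    case 1
    then have "real k \<le> 2 ^ s" by (metis of_nat_le_iff of_nat_numeral of_nat_power)
    then show ?thesis using 1 unfolding c by (simp add: trap_def field_simps max_def)
  next
    case 2
    then have "2 ^ s \<le> real k" "real k \<le> 2 * 2 ^ s"
      by (metis less_imp_le of_nat_le_iff of_nat_numeral of_nat_power, metis of_nat_le_iff
          of_nat_numeral of_nat_power power_Suc)
    then show ?thesis using 2 unfolding c by (simp add: trap_def field_simps max_def of_nat_diff)
  next
    case 3
    then have "2 * 2 ^ s \<le> real k"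
      by (metis less_imp_le of_nat_le_iff of_nat_numeral of_nat_power power_Suc)
    then show ?thesis using 3 unfolding c by (simp add: trap_def field_simps max_def)
  qed
qed

lemma trap_eq_0: "2 ^ Suc s \<le> k \<Longrightarrow> trap s k = 0"
proof -
  assume "2 ^ Suc s \<le> k"
  then have "2 * 2 ^ s \<le> real k" by (metis of_nat_le_iff of_nat_numeral of_nat_power power_Suc)
  then have "2 - real k / 2 ^ s \<le> 0" by (simp add: field_simps)
  then show ?thesis by (simp add: trap_def)
qed

lemma trap_mono: "trap s k \<le> trap (Suc s) k"
  unfolding trap_def by (intro max.mono min.mono diff_mono divide_left_mono) auto

lemma trap_bounds: "0 \<le> trap s k" "trap s k \<le> 1"
  by (auto simp: trap_def)

lemma trap_lipschitz: "\<bar>trap s (Suc k) - trap s k\<bar> \<le> 1 / 2 ^ s"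
proof -
  have clamp: "\<bar>max 0 (min 1 u) - max 0 (min 1 v)\<bar> \<le> \<bar>u - v\<bar>" for u v :: real
    by (auto simp: max_def min_def)
  have "(2 - real (Suc k) / 2 ^ s) - (2 - real k / 2 ^ s) = - (1 / 2 ^ s)"
    by (simp add: field_simps)
  then show ?thesis unfolding trap_def using clamp[of "2 - real (Suc k) / 2 ^ s" "2 - real k / 2 ^
      s"] by simp
qed

lemma window_bounds: "0 \<le> window s k" "window s k \<le> 1"
  using trap_mono[of "s - 1" k] trap_bounds[of s k] trap_bounds[of "s - 1" k]
  by (auto simp: window_def)

lemma window_lipschitz: "\<bar>window s (Suc k) - window s k\<bar> \<le> 3 / 2 ^ s"
proof (cases s)
  case 0
  then show ?thesis using trap_lipschitz[of 0 k] by (simp add: window_def)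
next
  case (Suc t)
  have "1 / 2 ^ t = 2 * (1 / 2 ^ s :: real)" "3 / 2 ^ s = 3 * (1 / 2 ^ s :: real)"
      by (auto simp: Suc)
  moreover have "window s (Suc k) - window s k
      = (trap s (Suc k) - trap s k) - (trap t (Suc k) - trap t k)"
    by (simp add: window_def Suc)
  ultimately show ?thesis using trap_lipschitz[of s k] trap_lipschitz[of t k] by linarith
qed

lemma sum_window: "(\<Sum>t\<le>s. window t k) = trap s k"
  by (induction s) (simp_all add: window_def)

lemma window_support_upper: "2 ^ Suc s \<le> k \<Longrightarrow> window s k = 0"
proof -
  assume k: "2 ^ Suc s \<le> k"
  have "2 ^ Suc (s - 1) \<le> k" if "s \<noteq> 0" using k that by simp
  then show ?thesis using k by (auto simp: window_def trap_eq_0)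
qed

lemma window_support_lower:
  assumes "window s k \<noteq> 0" "0 < k" shows "2 ^ s < 2 * real k"
proof (cases s)
  case (Suc t)
  show ?thesis
  proof (rule ccontr)
    assume "\<not> ?thesis"
    then have "real k \<le> 2 ^ t" by (simp add: Suc)
    moreover have "(2 :: real) ^ t \<le> 2 ^ s" by (simp add: Suc)
    ultimately have "real k \<le> 2 ^ t" "real k \<le> 2 ^ s" by linarith+
    then have "real k / 2 ^ t \<le> 1" "real k / 2 ^ s \<le> 1" by simp_all
    then have "trap t k = 1" "trap s k = 1"
      by (simp_all add: trap_def)
    then show False using assms by (simp add: window_def Suc)
  qed
qed (use assms in auto)

lemma bcoef_upper: "2 ^ Suc s \<le> k \<Longrightarrow> bcoef r s k = 0"
  by (simp add: bcoef_def window_support_upper)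

lemma powr_neg_le_window:
  assumes "window s k \<noteq> 0" "0 < k" "0 < r" "r < 1"
  shows "real k powr (- r) \<le> 2 * 2 powr (- (r * real s))"
proof -
  have "real k powr (- r) \<le> (2 ^ s / 2) powr (- r)"
    using window_support_lower[OF assms(1,2)] assms by (intro powr_mono2') auto
  also have "\<dots> = 2 powr r * 2 powr (- (r * real s))"
    by (simp add: powr_divide powr_minus powr_powr mult.commute field_simps flip: powr_realpow)
  also have "\<dots> \<le> 2 powr 1 * 2 powr (- (r * real s))"
    using assms by (intro mult_right_mono powr_mono) auto
  finally show ?thesis by simp
qed

lemma bcoef_nonneg: "0 \<le> bcoef r s k"
  by (simp add: bcoef_def window_bounds)

lemma bcoef_le:
  assumes "0 < r" "r < 1"
  shows "bcoef r s k \<le> 2 * 2 powr (- (r * real s))"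
proof (cases "k = 0 \<or> window s k = 0")
  case False
  have "bcoef r s k = window s k * real k powr (- r)" using False by (simp add: bcoef_def)
  also have "\<dots> \<le> 1 * (2 * 2 powr (- (r * real s)))"
    using False assms by (intro mult_mono powr_neg_le_window window_bounds) auto
  finally have "bcoef r s k \<le> 1 * (2 * 2 powr (- (r * real s)))" .
  then show ?thesis by simp
qed (auto simp: bcoef_def)

text \<open>Since \<open>k / (k + 1)\<close> is below 1 and \<open>r < 1\<close>, it is at most its
  power with exponent \<open>r\<close>; multiplying by \<open>k powr (- r)\<close> gives the
  bound.\<close>

lemma powr_neg_diff_le:
  assumes "0 < r" "r < 1" "0 < k"
  shows "real k powr (- r) - real (Suc k) powr (- r) \<le> real k powr (- r) / real (Suc k)"
proof -
  have "1 - 1 / real (Suc k) = real k / real (Suc k)" by (simp add: field_simps)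
  also have "\<dots> = (real k / real (Suc k)) powr 1" using assms by simp
  also have "\<dots> \<le> (real k / real (Suc k)) powr r"
    using assms by (intro powr_mono') auto
  also have "\<dots> = real k powr r / real (Suc k) powr r" by (simp add: powr_divide del: of_nat_Suc)
  finally have "real k powr (- r) * (1 - 1 / real (Suc k))
      \<le> real k powr (- r) * (real k powr r / real (Suc k) powr r)"
    by (intro mult_left_mono) auto
  also have "\<dots> = real (Suc k) powr (- r)"
    using assms by (simp add: powr_minus field_simps del: of_nat_Suc)
  finally show ?thesis by (simp add: right_diff_distrib del: of_nat_Suc)
qed

text \<open>A discrete product rule: 6 comes from the slope of the window times the size of the
  power, 4 from the variation of the power where \<open>k\<close> is at least of order
  \<open>2 ^ s\<close>. The gain of \<open>2 ^ s\<close> over the coefficients themselves keeps the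
  L_1 norms of the kernels free of logarithms.\<close>

lemma bcoef_diff_le:
  assumes r: "0 < r" "r < 1"
  shows "\<bar>bcoef r s (Suc k) - bcoef r s k\<bar> \<le> 10 * (2 powr (- (r * real s)) / 2 ^ s)"
proof -
  define E where "E = 2 powr (- (r * real s))"
  have E: "0 < E" by (simp add: E_def)
  define q :: real where "q = 1 / 2 ^ s"
  have q: "0 < q" by (simp add: q_def)
  have lip: "\<bar>window s (Suc k) - window s k\<bar> \<le> 3 * q" using window_lipschitz[of s k]
      by (simp add: q_def)
  have "\<bar>bcoef r s (Suc k) - bcoef r s k\<bar> \<le> 10 * (q * E)"
  proof (cases "k = 0")
    case True
    show ?thesis
    proof (cases s)
      case 0
      then show ?thesis using True window_bounds[of 0 1] by (simp add: bcoef_def E_def q_def)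
    next
      case (Suc t)
      have "window s (Suc 0) = 0"
      proof (rule ccontr)
        assume "\<not> ?thesis"
        then have "2 ^ s < (2 :: real)" using window_support_lower[of s "Suc 0"] by simp
        moreover have "1 \<le> (2 :: real) ^ t" by simp
        ultimately show False by (simp add: Suc)
      qed
      then show ?thesis using True E q by (simp add: bcoef_def)
    qed
  next
    case k: False
    show ?thesis
    proof (cases "window s k = 0")
      case True
      show ?thesis
      proof (cases "window s (Suc k) = 0")
        case False
        have "\<bar>bcoef r s (Suc k) - bcoef r s k\<bar>
            = \<bar>window s (Suc k) - window s k\<bar> * real (Suc k) powr (- r)"
          using True by (simp add: bcoef_def abs_mult)
        also have "\<dots> \<le> (3 * q) * (2 * E)"
          unfolding E_def using lip False r q by (intro mult_mono powr_neg_le_window) auto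
        finally show ?thesis using q E by (simp add: algebra_simps)
      qed (use True E q in \<open>simp add: bcoef_def\<close>)
    next
      case False
      have kE: "real k powr (- r) \<le> 2 * E" unfolding E_def using k r False
          by (intro powr_neg_le_window) auto
      have SkE: "real (Suc k) powr (- r) \<le> 2 * E"
        using k r by (intro order_trans[OF _ kE] powr_mono2') auto
      have d: "\<bar>real (Suc k) powr (- r) - real k powr (- r)\<bar> \<le> 4 * q * E"
      proof -
        have "real (Suc k) powr (- r) \<le> real k powr (- r)" using k r by (intro powr_mono2') auto
        then have "\<bar>real (Suc k) powr (- r) - real k powr (- r)\<bar> \<le> real k powr (- r) / real (Suc k)"
          using powr_neg_diff_le[of r k] k r by linarith
        also have "\<dots> = real k powr (- r) * (1 / real (Suc k))" by simp
        also have "\<dots> \<le> (2 * E) * (2 * q)"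
        proof (intro mult_mono kE)
          have "2 ^ s < 2 * real k" using window_support_lower[of s k] False k by simp
          then show "1 / real (Suc k) \<le> 2 * q" by (simp add: q_def field_simps)
        qed (use E in auto)
        finally show ?thesis by (simp add: algebra_simps)
      qed
      have "bcoef r s (Suc k) - bcoef r s k = (window s (Suc k) - window s k) * real (Suc k) powr (-
          r)
          + window s k * (real (Suc k) powr (- r) - real k powr (- r))"
        using k by (simp add: bcoef_def algebra_simps del: of_nat_Suc)
      also have "\<bar>\<dots>\<bar> \<le> \<bar>window s (Suc k) - window s k\<bar> * real (Suc k) powr (- r)
          + window s k * \<bar>real (Suc k) powr (- r) - real k powr (- r)\<bar>"
        using window_bounds[of s k] by (intro order_trans[OF abs_triangle_ineq]) (simp add: abs_mult
            del: of_nat_Suc)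
      also have "\<dots> \<le> (3 * q) * (2 * E) + 1 * (4 * q * E)"
        using lip SkE d window_bounds[of s k] q by (intro add_mono mult_mono) auto
      finally show ?thesis by (simp add: algebra_simps)
    qed
  qed
  then show ?thesis by (simp add: q_def E_def)
qed

lemma sum_kap:
  "(\<Sum>t\<le>s. kap r t x) = 1 + 2 * (\<Sum>k\<in>{1..2 ^ Suc s}. trap s k * (real k powr (- r) * cos (real k * x -
      r * pi / 2)))"
proof -
  have "(\<Sum>k\<in>{1..2 ^ Suc t}. bcoef r t k * cos (real k * x - r * pi / 2))
     = (\<Sum>k\<in>{1..2 ^ Suc s}. bcoef r t k * cos (real k * x - r * pi / 2))" if "t \<le> s" for t
  proof (rule sum.mono_neutral_left)
    have "(2 :: nat) ^ Suc t \<le> 2 ^ Suc s" using that by (intro power_increasing) auto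
    then show "{1..2 ^ Suc t} \<subseteq> {1..(2 :: nat) ^ Suc s}" by auto
    show "\<forall>i\<in>{1..2 ^ Suc s} - {1..2 ^ Suc t}. bcoef r t i * cos (real i * x - r * pi / 2) = 0"
      by (auto simp: bcoef_upper)
  qed simp
  then have "(\<Sum>t\<le>s. kap r t x) = (\<Sum>t\<le>s. (if t = 0 then 1 else 0) +
     2 * (\<Sum>k\<in>{1..2 ^ Suc s}. bcoef r t k * cos (real k * x - r * pi / 2)))"
    unfolding kap_def by (intro sum.cong) auto
  also have "\<dots> = 1 + 2 * (\<Sum>k\<in>{1..2 ^ Suc s}. \<Sum>t\<le>s. bcoef r t k * cos (real k * x - r * pi / 2))"
    by (simp add: sum.distrib sum_distrib_left[symmetric] sum.swap[of _ "{..s}"])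
  also have "(\<Sum>k\<in>{1..2 ^ Suc s}. \<Sum>t\<le>s. bcoef r t k * cos (real k * x - r * pi / 2))
      = (\<Sum>k\<in>{1..2 ^ Suc s}. trap s k * (real k powr (- r) * cos (real k * x - r * pi / 2)))"
    by (intro sum.cong refl) (auto simp: bcoef_def sum_window[symmetric] sum_distrib_left
        sum_distrib_right mult_ac)
  finally show ?thesis .
qed

text \<open>The smoothed sums are averages of partial sums with index at least \<open>2 ^ s\<close>,
  and therefore share their limit.\<close>

lemma kap_sums:
  assumes "0 < r" "cis x \<noteq> 1"
  shows "(\<lambda>s. \<Sum>t\<le>s. kap r t x) \<longlonglongrightarrow> bernoulli_kernel r x"
proof -
  define a where "a k = real k powr (- r) * cos (real k * x - r * pi / 2)" for k
  define P where "P N = (\<Sum>k\<in>{1..N}. a k)" for N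
  define A where "A = (\<Sum>k. a (Suc k))"
  have "summable (\<lambda>k. a (Suc k))" using summable_bernoulli_series[OF assms] by (simp add: a_def)
  then have "(\<lambda>N. \<Sum>k<N. a (Suc k)) \<longlonglongrightarrow> A" unfolding A_def by (rule summable_LIMSEQ)
  moreover have "(\<Sum>k<N. a (Suc k)) = P N" for N
    unfolding P_def by (simp add: sum.atLeast1_atMost_eq)
  ultimately have PA: "P \<longlonglongrightarrow> A" by (simp add: fun_eq_iff)
  have avg: "(\<Sum>k\<in>{1..2 ^ Suc s}. trap s k * a k) = (\<Sum>N\<in>{2 ^ s..<2 ^ Suc s}. P N) / 2 ^ s" for s
  proof -
    have "P N = (\<Sum>k\<in>{1..2 ^ Suc s}. if k \<le> N then a k else 0)" if "N \<in> {2 ^ s..<2 ^ Suc s}" for N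
      unfolding P_def by (rule sum.mono_neutral_cong_left) (use that in auto)
    then have "(\<Sum>N\<in>{2 ^ s..<2 ^ Suc s}. P N) = (\<Sum>N\<in>{2 ^ s..<2 ^ Suc s}. \<Sum>k\<in>{1..2 ^ Suc s}. if k
        \<le> N then a k else 0)"
      by (intro sum.cong) auto
    also have "\<dots> = (\<Sum>k\<in>{1..2 ^ Suc s}. \<Sum>N\<in>{2 ^ s..<2 ^ Suc s}. if k \<le> N then a k else 0)"
      by (rule sum.swap)
    also have "\<dots> = (\<Sum>k\<in>{1..2 ^ Suc s}. real (card {N \<in> {2 ^ s..<2 ^ Suc s}. k \<le> N}) * a k)"
      by (intro sum.cong refl) (subst sum.inter_filter[symmetric], auto)
    finally show ?thesis by (simp add: trap_card sum_divide_distrib)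
  qed
  have "(\<lambda>s. \<Sum>k\<in>{1..2 ^ Suc s}. trap s k * a k) \<longlonglongrightarrow> A"
  proof (rule LIMSEQ_I)
    fix e :: real assume "0 < e"
    then obtain N0 where N0: "\<And>N. N0 \<le> N \<Longrightarrow> norm (P N - A) < e / 2"
      using LIMSEQ_D[OF PA, of "e / 2"] by auto
    show "\<exists>s0. \<forall>s\<ge>s0. norm ((\<Sum>k\<in>{1..2 ^ Suc s}. trap s k * a k) - A) < e"
    proof (intro exI[of _ N0] allI impI)
      fix s assume s: "N0 \<le> s"
      have "(\<Sum>k\<in>{1..2 ^ Suc s}. trap s k * a k) - A = (\<Sum>N\<in>{2 ^ s..<2 ^ Suc s}. P N - A) / 2 ^ s"
        unfolding avg by (simp add: sum_subtractf diff_divide_distrib)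
      also have "norm \<dots> \<le> (\<Sum>N\<in>{2 ^ s..<(2::nat) ^ Suc s}. e / 2) / 2 ^ s"
      proof -
        have "norm (P N - A) \<le> e / 2" if "N \<in> {2 ^ s..<2 ^ Suc s}" for N
        proof -
          have "s < 2 ^ s" by (rule less_exp)
          moreover have "2 ^ s \<le> N" using that by simp
          ultimately have "N0 \<le> N" using s by linarith
          from N0[OF this] show ?thesis by simp
        qed
        then show ?thesis
          unfolding norm_divide by (intro frac_le sum_norm_le sum_nonneg) (use \<open>0 < e\<close> in auto)
      qed
      also have "\<dots> = e / 2" by simp
      also have "\<dots> < e" using \<open>0 < e\<close> by simp
      finally show "norm ((\<Sum>k\<in>{1..2 ^ Suc s}. trap s k * a k) - A) < e" .
    qed
  qed
  then have "(\<lambda>s. 1 + 2 * (\<Sum>k\<in>{1..2 ^ Suc s}. trap s k * a k)) \<longlonglongrightarrow> 1 + 2 * A"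
    by (intro tendsto_intros)
  then show ?thesis unfolding sum_kap a_def A_def bernoulli_kernel_def by simp
qed

lemma abs_kap_le:
  assumes "0 < r" "r < 1"
  shows "\<bar>kap r s x\<bar> \<le> 9 * 2 powr (real s * (1 - r))"
proof -
  have "\<bar>kap r s x\<bar> \<le> 1 + 2 * (\<Sum>k\<in>{1..2 ^ Suc s}. \<bar>bcoef r s k * cos (real k * x - r * pi / 2)\<bar>)"
  proof -
    have "\<bar>c + 2 * u\<bar> \<le> 1 + 2 * v" if "\<bar>c\<bar> \<le> 1" "\<bar>u\<bar> \<le> v" for c u v :: real
      using that by linarith
    note bound = this
    show ?thesis unfolding kap_def by (intro bound sum_abs) auto
  qed
  also have "\<dots> \<le> 1 + 2 * (\<Sum>k\<in>{1..(2::nat) ^ Suc s}. (2 * 2 powr (- (r * real s))) * 1)"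
    unfolding abs_mult using bcoef_le[OF assms] bcoef_nonneg[of r s]
    by (intro add_left_mono mult_left_mono sum_mono mult_mono) auto
  also have "\<dots> = 1 + 8 * (2 powr real s * 2 powr (- (r * real s)))"
    by (simp add: powr_realpow)
  also have "2 powr real s * 2 powr (- (r * real s)) = 2 powr (real s * (1 - r))"
    by (simp add: powr_add[symmetric] algebra_simps)
  also have "1 + 8 * \<dots> \<le> 9 * 2 powr (real s * (1 - r))"
    using assms ge_one_powr_ge_zero[of 2 "real s * (1 - r)"] by simp
  finally show ?thesis .
qed

section \<open>L_1 norms of the dyadic kernels\<close>

lemma integrable_circle_bounded:
  fixes f :: "real \<Rightarrow> 'b::{banach, second_countable_topology}"
  assumes "f \<in> borel_measurable borel" "\<And>x. norm (f x) \<le> B"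
  shows "integrable circle_measure f"
  by (rule circle.integrable_const_bound[of _ B]) (use assms in auto)

lemma circle_parseval:
  fixes a :: "nat \<Rightarrow> complex"
  shows "(LINT t|circle_measure. (norm (\<Sum>k<n. a k * cis (real k * (x - t))))\<^sup>2)
      = (\<Sum>k<n. (norm (a k))\<^sup>2)"
proof -
  define S where "S t = (\<Sum>k<n. a k * cis (real k * (x - t)))" for t
  define c where "c k l = (a k * cnj (a l)) * cis ((real k - real l) * x)" for k l
  have nS: "complex_of_real ((norm (S t))\<^sup>2) = (\<Sum>k<n. \<Sum>l<n. c k l * cis (of_int (int l - int k) *
      t))" for t
  proof -
    have "complex_of_real ((norm (S t))\<^sup>2) = (\<Sum>k<n. \<Sum>l<n. (a k * cis (real k * (x - t))) * (cnj (a
        l) * cis (- (real l * (x - t)))))"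
      unfolding complex_norm_square S_def by (simp add: sum_product cis_cnj)
    also have "\<dots> = (\<Sum>k<n. \<Sum>l<n. c k l * cis (of_int (int l - int k) * t))"
    proof (intro sum.cong refl)
      fix k l
      have "cis (real k * (x - t)) * cis (- (real l * (x - t)))
          = cis ((real k - real l) * x) * cis (of_int (int l - int k) * t)"
        unfolding cis_mult by (rule arg_cong[of _ _ cis]) (simp add: algebra_simps)
      then show "(a k * cis (real k * (x - t))) * (cnj (a l) * cis (- (real l * (x - t))))
          = c k l * cis (of_int (int l - int k) * t)"
        by (simp add: c_def mult_ac)
    qed
    finally show ?thesis .
  qed
  have int: "integrable circle_measure (\<lambda>t. cis (of_int k * t))" for k
    by (rule integrable_circle_bounded[of _ 1]) auto
  have "complex_of_real (LINT t|circle_measure. (norm (S t))\<^sup>2)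
      = (LINT t|circle_measure. (\<Sum>k<n. \<Sum>l<n. c k l * cis (of_int (int l - int k) * t)))"
    unfolding nS[symmetric] by (rule integral_complex_of_real[symmetric])
  also have "\<dots> = (\<Sum>k<n. \<Sum>l<n. c k l * (if int l - int k = 0 then 1 else 0))"
    using int by (simp add: integral_cis_circle del: of_int_diff)
  also have "\<dots> = complex_of_real (\<Sum>k<n. (norm (a k))\<^sup>2)"
    unfolding of_real_sum complex_norm_square
    by (intro sum.cong refl) (simp add: c_def if_distrib cong: if_cong)
  finally show ?thesis unfolding S_def by (simp only: of_real_eq_iff)
qed

text \<open>A finite geometric sum replaces the infinite series. Once
  \<open>\<rho> ^ n < 1 / 2\<close>, the factor \<open>1 - w ^ n\<close> has modulus at least 1/2,
  so the inverse of \<open>1 - w\<close> is at most twice the sum in modulus, and the finite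
  Parseval identity applies.\<close>

lemma integral_inverse_poisson_le:
  assumes "0 \<le> \<rho>" "\<rho> < 1"
  shows "(LINT t|circle_measure. 1 / (norm (1 - of_real \<rho> * cis (x - t)))\<^sup>2) \<le> 4 / (1 - \<rho>)"
proof -
  obtain n where n: "\<rho> ^ n < 1 / 2"
    using assms real_arch_pow_inv[of "1 / 2" \<rho>] by auto
  define G where "G t = (\<Sum>k<n. of_real (\<rho> ^ k) * cis (real k * (x - t)))" for t
  have low: "1 - \<rho> \<le> norm (1 - of_real \<rho> * cis u)" for u
    using norm_triangle_ineq2[of 1 "of_real \<rho> * cis u"] assms by (simp add: norm_mult)
  have "1 / (norm (1 - of_real \<rho> * cis (x - t)))\<^sup>2 \<le> 4 * (norm (G t))\<^sup>2" for t
  proof -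
    define w where "w = of_real \<rho> * cis (x - t)"
    have "G t = (\<Sum>k<n. w ^ k)"
      unfolding G_def w_def by (intro sum.cong refl) (simp add: power_mult_distrib Complex.DeMoivre)
    then have "(1 - w) * G t = 1 - w ^ n" by (simp only: one_diff_power_eq)
    moreover have "1 / 2 \<le> norm (1 - w ^ n)"
      using norm_triangle_ineq2[of 1 "w ^ n"] n assms by (simp add: w_def norm_mult norm_power)
    ultimately have "1 \<le> 2 * (norm (1 - w) * norm (G t))" by (simp flip: norm_mult)
    then have "1\<^sup>2 \<le> (2 * (norm (1 - w) * norm (G t)))\<^sup>2" by (intro power_mono) auto
    moreover have "0 < norm (1 - w)" unfolding w_def using low[of "x - t"] assms by linarith
    ultimately show ?thesis by (simp add: w_def field_simps power_mult_distrib)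
  qed
  then have "(LINT t|circle_measure. 1 / (norm (1 - of_real \<rho> * cis (x - t)))\<^sup>2)
      \<le> (LINT t|circle_measure. 4 * (norm (G t))\<^sup>2)"
  proof (intro integral_mono)
    show "integrable circle_measure (\<lambda>t. 1 / (norm (1 - of_real \<rho> * cis (x - t)))\<^sup>2)"
    proof (rule integrable_circle_bounded[of _ "1 / (1 - \<rho>)\<^sup>2"])
      fix t
      have "(1 - \<rho>)\<^sup>2 \<le> (norm (1 - of_real \<rho> * cis (x - t)))\<^sup>2"
        using low assms by (intro power_mono) auto
      then show "norm (1 / (norm (1 - of_real \<rho> * cis (x - t)))\<^sup>2) \<le> 1 / (1 - \<rho>)\<^sup>2"
        using assms by (simp add: frac_le)
    qed measurable
    show "integrable circle_measure (\<lambda>t. 4 * (norm (G t))\<^sup>2)"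
    proof (rule integrable_circle_bounded[of _ "4 * (real n)\<^sup>2"])
      fix t
      have "norm (G t) \<le> (\<Sum>k<n. 1)"
        unfolding G_def using assms by (intro sum_norm_le) (auto simp: norm_mult norm_power
            power_le_one)
      then have "(norm (G t))\<^sup>2 \<le> (real n)\<^sup>2" by (intro power_mono) auto
      then show "norm (4 * (norm (G t))\<^sup>2) \<le> 4 * (real n)\<^sup>2" by simp
    qed (unfold G_def, measurable)
  qed
  also have "\<dots> = 4 * (\<Sum>k<n. (\<rho> ^ k)\<^sup>2)"
    unfolding G_def using assms by (simp add: circle_parseval norm_power del: of_real_power)
  also have "(\<Sum>k<n. (\<rho> ^ k)\<^sup>2) \<le> (\<Sum>k<n. \<rho> ^ k)"
    using assms by (intro sum_mono) (simp add: power2_eq_square mult_left_le power_le_one)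
  also have "\<dots> \<le> 1 / (1 - \<rho>)"
    using assms by (simp add: sum_gp_strict divide_right_mono)
  finally show ?thesis by simp
qed

text \<open>
  The \<open>L\<^sub>1\<close> norm is bounded by Cauchy--Schwarz (as AM--GM) against the weight
  \<open>\<bar>1 - \<rho> * cis u\<bar>\<^sup>2\<close> with \<open>\<rho> = 1 - 1 / 2 ^ s\<close>: multiplication by \<open>1 - \<rho> * cis u\<close> turns the
  coefficients into differences, and the inverse weight is a multiple of the Poisson kernel.
\<close>

lemma integral_abs_kap_le:
  assumes r: "0 < r" "r < 1"
  shows "(LINT t|circle_measure. \<bar>kap r s (x - t)\<bar>) \<le> 1200 * 2 powr (- (r * real s))"
proof -
  define E where "E = 2 powr (- (r * real s))"
  have E: "0 < E" "E \<le> 1" using r powr_mono[of "- (r * real s)" 0 2] by (auto simp: E_def)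
  define q :: real where "q = 1 / 2 ^ s"
  have q: "0 < q" "q \<le> 1" by (auto simp: q_def)
  define \<rho> where "\<rho> = 1 - q"
  have \<rho>: "0 \<le> \<rho>" "\<rho> < 1" using q by (auto simp: \<rho>_def)
  define K :: nat where "K = 2 ^ Suc s"
  define h where "h u = (\<Sum>k\<in>{1..K}. of_real (bcoef r s k) * cis (real k * u))" for u
  define d where "d k = (if k = 0 then 0 else complex_of_real (bcoef r s k - \<rho> * bcoef r s (k -
      1)))" for k
  \<comment> \<open>Since \<open>\<rho> = 1 - q\<close>, a coefficient of the product is a plain
    difference plus \<open>q\<close> times a coefficient: 12 = 10 + 2.\<close>
  have dk: "norm (d k) \<le> 12 * (q * E)" for k
  proof (cases k)
    case (Suc j)
    have "bcoef r s (Suc j) - \<rho> * bcoef r s j = (bcoef r s (Suc j) - bcoef r s j) + q * bcoef r s j"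
      by (simp add: \<rho>_def algebra_simps)
    also have "\<bar>\<dots>\<bar> \<le> 10 * (q * E) + q * (2 * E)"
    proof (rule order_trans[OF abs_triangle_ineq add_mono])
      show "\<bar>bcoef r s (Suc j) - bcoef r s j\<bar> \<le> 10 * (q * E)"
        using bcoef_diff_le[OF r, of s j] by (simp add: q_def E_def)
      show "\<bar>q * bcoef r s j\<bar> \<le> q * (2 * E)"
        using bcoef_le[OF r, of s j] bcoef_nonneg[of r s j] q by (simp add: abs_mult E_def)
    qed
    finally show ?thesis using Suc by (simp add: d_def mult_ac del: of_real_diff of_real_mult)
  qed (use q E in \<open>simp add: d_def\<close>)
  have b0: "bcoef r s 0 = 0" by (simp add: bcoef_def)
  have bK: "bcoef r s (Suc K) = 0" by (rule bcoef_upper) (simp add: K_def)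
  have hd: "(1 - of_real \<rho> * cis u) * h u = (\<Sum>k<K + 2. d k * cis (real k * u))" for u
  proof -
    define B where "B k = complex_of_real (bcoef r s k)" for k
    have "h u = (\<Sum>k<Suc K. B (Suc k) * cis (real (Suc k) * u))"
    proof -
      have "h u = (\<Sum>k<K. B (Suc k) * cis (real (Suc k) * u))"
        unfolding h_def B_def by (simp add: sum.atLeast1_atMost_eq)
      then show ?thesis by (simp add: B_def bK)
    qed
    moreover have "cis u * h u = (\<Sum>k<Suc K. B k * cis (real (Suc k) * u))"
    proof -
      have "cis u * h u = (\<Sum>k<K. B (Suc k) * cis (real (Suc (Suc k)) * u))"
      proof -
        have "cis u * (c * cis (real (Suc k) * u)) = c * cis (real (Suc (Suc k)) * u)" for c k
        proof -
          have "cis u * cis (real (Suc k) * u) = cis (real (Suc (Suc k)) * u)"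
            unfolding cis_mult by (rule arg_cong[of _ _ cis]) (simp add: algebra_simps)
          then show ?thesis by (simp only: mult.left_commute)
        qed
        then show ?thesis
          unfolding h_def B_def sum_distrib_left by (simp only: One_nat_def sum.atLeast1_atMost_eq)
      qed
      also have "\<dots> = (\<Sum>k<Suc K. B k * cis (real (Suc k) * u))"
        by (subst sum.lessThan_Suc_shift) (simp add: B_def b0)
      finally show ?thesis .
    qed
    ultimately have "h u - of_real \<rho> * (cis u * h u)
        = (\<Sum>k<Suc K. (B (Suc k) - of_real \<rho> * B k) * cis (real (Suc k) * u))"
      by (simp only: sum_distrib_left sum_subtractf[symmetric] left_diff_distrib mult.assoc)
    also have "\<dots> = (\<Sum>k<Suc K. d (Suc k) * cis (real (Suc k) * u))"
      by (intro sum.cong refl) (simp add: d_def B_def)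
    also have "\<dots> = (\<Sum>k<Suc (Suc K). d k * cis (real k * u))"
      by (subst sum.lessThan_Suc_shift[of _ "Suc K"]) (simp add: d_def)
    finally show ?thesis by (simp add: left_diff_distrib mult.assoc)
  qed
  define D where "D u = (\<Sum>k<K + 2. d k * cis (real k * u))" for u
  have "1 - \<rho> \<le> norm (1 - of_real \<rho> * cis u)" for u
    using norm_triangle_ineq2[of 1 "of_real \<rho> * cis u"] \<rho> by (simp add: norm_mult)
  then have low: "0 < norm (1 - of_real \<rho> * cis u)" for u
    using \<rho> by (rule_tac less_le_trans[of 0 "1 - \<rho>"]) auto
  \<comment> \<open>The AM-GM parameter that gives both terms the order \<open>E\<close>: the
    integral of \<open>(norm (D u))\<^sup>2\<close> is at most \<open>576 * q * E\<^sup>2\<close>,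
    that of the inverse weight at most \<open>4 / q\<close>.\<close>
  define \<mu> where "\<mu> = q * E"
  have \<mu>: "0 < \<mu>" using q E by (simp add: \<mu>_def)
  have amgm: "norm (h u) \<le> (1 / \<mu>) * (norm (D u))\<^sup>2 + \<mu> * (1 / (norm (1 - of_real \<rho> * cis u))\<^sup>2)"
      for u
  proof -
    define w where "w = norm (1 - of_real \<rho> * cis u)"
    have w: "0 < w" using low by (simp add: w_def)
    have "norm (D u) = w * norm (h u)" unfolding D_def hd[symmetric] by (simp add: norm_mult w_def)
    then have hu: "norm (h u) = norm (D u) * (1 / w)" using w by simp
    have "0 \<le> (norm (D u) - \<mu> * (1 / w))\<^sup>2" by simp
    then have "2 * (\<mu> * (norm (D u) * (1 / w))) \<le> (norm (D u))\<^sup>2 + \<mu>\<^sup>2 * (1 / w\<^sup>2)"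
      by (simp add: power2_diff power_mult_distrib power_divide algebra_simps)
    then have "2 * norm (h u) \<le> ((norm (D u))\<^sup>2 + \<mu>\<^sup>2 * (1 / w\<^sup>2)) / \<mu>"
      unfolding hu[symmetric] using \<mu> by (simp add: field_simps)
    also have "\<dots> = (1 / \<mu>) * (norm (D u))\<^sup>2 + \<mu> * (1 / w\<^sup>2)"
      using \<mu> by (simp add: field_simps power2_eq_square)
    finally show ?thesis using norm_ge_zero[of "h u"] unfolding w_def by linarith
  qed
  have intD: "integrable circle_measure (\<lambda>t. (norm (D (x - t)))\<^sup>2)"
  proof (rule integrable_circle_bounded[of _ "(\<Sum>k<K + 2. norm (d k))\<^sup>2"])
    fix t
    have "norm (D (x - t)) \<le> (\<Sum>k<K + 2. norm (d k))"
      unfolding D_def by (intro sum_norm_le) (simp add: norm_mult)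
    then have "(norm (D (x - t)))\<^sup>2 \<le> (\<Sum>k<K + 2. norm (d k))\<^sup>2" by (intro power_mono) auto
    then show "norm ((norm (D (x - t)))\<^sup>2) \<le> (\<Sum>k<K + 2. norm (d k))\<^sup>2" by simp
  qed (unfold D_def, measurable)
  have intP: "integrable circle_measure (\<lambda>t. 1 / (norm (1 - of_real \<rho> * cis (x - t)))\<^sup>2)"
  proof (rule integrable_circle_bounded[of _ "1 / (1 - \<rho>)\<^sup>2"])
    fix t
    have "1 - \<rho> \<le> norm (1 - of_real \<rho> * cis (x - t))"
      using norm_triangle_ineq2[of 1 "of_real \<rho> * cis (x - t)"] \<rho> by (simp add: norm_mult)
    then have "(1 - \<rho>)\<^sup>2 \<le> (norm (1 - of_real \<rho> * cis (x - t)))\<^sup>2"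
      using \<rho> by (intro power_mono) auto
    then show "norm (1 / (norm (1 - of_real \<rho> * cis (x - t)))\<^sup>2) \<le> 1 / (1 - \<rho>)\<^sup>2"
      using \<rho> by (simp add: frac_le)
  qed measurable
  have "(LINT t|circle_measure. (norm (D (x - t)))\<^sup>2) = (\<Sum>k<K + 2. (norm (d k))\<^sup>2)"
    unfolding D_def by (rule circle_parseval)
  also have "\<dots> \<le> (\<Sum>k<K + 2. (12 * (q * E))\<^sup>2)"
    by (intro sum_mono power_mono dk) auto
  also have "\<dots> = (2 / q + 2) * (144 * (q * E)\<^sup>2)"
    by (simp add: K_def q_def power_mult_distrib power_divide)
  also have "\<dots> \<le> (2 / q + 2 / q) * (144 * (q * E)\<^sup>2)"
    using q by (intro mult_right_mono add_left_mono) (auto simp: field_simps)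
  finally have ID: "(LINT t|circle_measure. (norm (D (x - t)))\<^sup>2) \<le> 576 * q * E\<^sup>2"
    using q by (simp add: power2_eq_square field_simps)
  have kap_h: "\<bar>kap r s u\<bar> \<le> E * (if s = 0 then 1 else 0) + 2 * norm (h u)" for u
  proof -
    have "(\<Sum>k\<in>{1..K}. bcoef r s k * cos (real k * u - r * pi / 2))
        = Re (cis (- (r * pi / 2)) * h u)"
      unfolding h_def sum_distrib_left Re_sum
      by (intro sum.cong refl) (simp add: cos_diff algebra_simps)
    also have "\<bar>\<dots>\<bar> \<le> norm (h u)"
      by (rule order_trans[OF abs_Re_le_cmod]) (simp add: norm_mult)
    finally have "\<bar>\<Sum>k\<in>{1..K}. bcoef r s k * cos (real k * u - r * pi / 2)\<bar> \<le> norm (h u)" .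
    moreover have "\<bar>c + 2 * v\<bar> \<le> c + 2 * w" if "\<bar>v\<bar> \<le> w" "0 \<le> c" for c v w :: real
      using that by linarith
    moreover have "E * (if s = 0 then 1 else 0) = (if s = 0 then 1 else 0)" by (simp add: E_def)
    ultimately show ?thesis unfolding kap_def K_def[symmetric] by (simp only:) simp
  qed
  have "(LINT t|circle_measure. \<bar>kap r s (x - t)\<bar>)
      \<le> (LINT t|circle_measure. E + 2 * ((1 / \<mu>) * (norm (D (x - t)))\<^sup>2 + \<mu> * (1 / (norm (1 -
      of_real \<rho> * cis (x - t)))\<^sup>2)))"
  proof (rule integral_mono)
    show "integrable circle_measure (\<lambda>t. \<bar>kap r s (x - t)\<bar>)"
      by (rule integrable_circle_bounded[of _ "9 * 2 powr (real s * (1 - r))"])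
         (use abs_kap_le[OF r] in \<open>auto simp: kap_def\<close>)
    show "integrable circle_measure (\<lambda>t. E + 2 * ((1 / \<mu>) * (norm (D (x - t)))\<^sup>2 + \<mu> * (1 / (norm (1
        - of_real \<rho> * cis (x - t)))\<^sup>2)))"
      using intD intP
      by (intro Bochner_Integration.integrable_add integrable_mult_right circle.integrable_const)
    fix t
    have "E * (if s = 0 then 1 else 0) \<le> E" using E by simp
    then show "\<bar>kap r s (x - t)\<bar> \<le> E + 2 * ((1 / \<mu>) * (norm (D (x - t)))\<^sup>2 + \<mu> * (1 / (norm (1 -
        of_real \<rho> * cis (x - t)))\<^sup>2))"
      by (intro order_trans[OF kap_h] add_mono mult_left_mono amgm) auto
  qed
  also have "\<dots> = E + 2 * ((1 / \<mu>) * (LINT t|circle_measure. (norm (D (x - t)))\<^sup>2)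
      + \<mu> * (LINT t|circle_measure. 1 / (norm (1 - of_real \<rho> * cis (x - t)))\<^sup>2))"
    using intD intP circle.prob_space
    by (simp only: Bochner_Integration.integral_add Bochner_Integration.integrable_add
      integrable_mult_right integral_mult_right_zero circle.integrable_const) simp
  also have "\<dots> \<le> E + 2 * ((1 / \<mu>) * (576 * q * E\<^sup>2) + \<mu> * (4 / (1 - \<rho>)))"
    using ID integral_inverse_poisson_le[OF \<rho>, of x] \<mu>
    by (intro add_left_mono mult_left_mono add_mono) auto
  also have "\<dots> = E + 2 * (576 * E + 4 * E)"
    using q E by (simp add: \<mu>_def \<rho>_def power2_eq_square field_simps)
  also have "\<dots> \<le> 1200 * E" using E by simp
  finally show ?thesis unfolding E_def .
qed

section \<open>Hyperbolic layers\<close>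

text \<open>The Fourier coefficient of \<open>kap r s\<close> at \<open>k\<close>. The phase changes
  sign with \<open>k\<close> because the kernel is real.\<close>

definition hcoef :: "real \<Rightarrow> nat \<Rightarrow> int \<Rightarrow> complex" where
  "hcoef r s k = (if k = 0 then (if s = 0 then 1 else 0)
     else of_real (bcoef r s (nat \<bar>k\<bar>)) * cis (- (of_int (sgn k) * (r * pi / 2))))"

lemma sum_int_symmetric:
  fixes f :: "int \<Rightarrow> 'a::comm_monoid_add"
  shows "(\<Sum>k\<in>{- int n..int n}. f k) = f 0 + (\<Sum>k\<in>{1..n}. f (int k) + f (- int k))"
proof (induction n)
  case (Suc n)
  have "{- int (Suc n)..int (Suc n)} = insert (int (Suc n)) (insert (- int (Suc n)) {- int n..int
      n})"
    by auto
  then have "(\<Sum>k\<in>{- int (Suc n)..int (Suc n)}. f k)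
      = f (int (Suc n)) + (f (- int (Suc n)) + (\<Sum>k\<in>{- int n..int n}. f k))"
    by simp
  then show ?case unfolding Suc by (simp add: add_ac)
qed simp

lemma kap_eq_hcoef:
  "complex_of_real (kap r s x) = (\<Sum>k\<in>{- int (2 ^ Suc s)..int (2 ^ Suc s)}. hcoef r s k * cis (of_int
      k * x))"
proof -
  have cis_add: "cis t + cis (- t) = of_real (2 * cos t)" for t
    by (simp add: complex_eq_iff)
  have "hcoef r s (int k) * cis (of_int (int k) * x) + hcoef r s (- int k) * cis (of_int (- int k) *
      x)
      = of_real (2 * (bcoef r s k * cos (real k * x - r * pi / 2)))" if "k \<in> {1..2 ^ Suc s}" for k
  proof -
    have "hcoef r s (int k) * cis (of_int (int k) * x) + hcoef r s (- int k) * cis (of_int (- int k)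
        * x)
        = of_real (bcoef r s k) * (cis (real k * x - r * pi / 2) + cis (- (real k * x - r * pi /
            2)))"
      using that by (simp add: hcoef_def distrib_left mult.assoc cis_mult add.commute)
    also have "cis (real k * x - r * pi / 2) + cis (- (real k * x - r * pi / 2))
        = of_real (2 * cos (real k * x - r * pi / 2))"
      by (rule cis_add)
    finally show ?thesis by simp
  qed
  then show ?thesis
    unfolding sum_int_symmetric by (simp add: hcoef_def kap_def sum_distrib_left)
qed

lemma hcoef_outside: "int (2 ^ Suc s) < \<bar>k\<bar> \<Longrightarrow> hcoef r s k = 0"
proof -
  assume "int (2 ^ Suc s) < \<bar>k\<bar>"
  then have "2 ^ Suc s \<le> nat \<bar>k\<bar>" "k \<noteq> 0" by (auto simp: nat_le_eq_zle le_nat_iff)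
  then show ?thesis by (simp add: hcoef_def bcoef_upper)
qed

text \<open>The windows at a fixed frequency sum to \<open>trap S n\<close>, hence to at most 1, and
  on the support of a window the power is at most \<open>2 * 2 powr (- r * t)\<close>. The bound is
  uniform in \<open>S\<close>, so summing over scales costs a constant only.\<close>

lemma sum_hcoef_le:
  assumes "0 < r" "r < 1"
  shows "(\<Sum>t\<le>S. 2 powr (r * real t) * norm (hcoef r t k)) \<le> 2"
proof (cases "k = 0")
  case True
  then have "(\<Sum>t\<le>S. 2 powr (r * real t) * norm (hcoef r t k)) = (\<Sum>t\<le>S. if t = 0 then 1 else 0)"
    by (intro sum.cong) (auto simp: hcoef_def)
  then show ?thesis by simp
next
  case False
  define n where "n = nat \<bar>k\<bar>"
  have n: "0 < n" using False by (simp add: n_def)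
  have "2 powr (r * real t) * norm (hcoef r t k) \<le> 2 * window t n" for t
  proof (cases "window t n = 0")
    case False
    have "2 powr (r * real t) * norm (hcoef r t k)
        = window t n * (2 powr (r * real t) * real n powr (- r))"
      using \<open>k \<noteq> 0\<close> n window_bounds[of t n]
      by (simp add: hcoef_def n_def[symmetric] norm_mult bcoef_def mult_ac)
    also have "\<dots> \<le> window t n * (2 powr (r * real t) * (2 * 2 powr (- (r * real t))))"
      using False n assms by (intro mult_left_mono powr_neg_le_window window_bounds) auto
    also have "\<dots> = 2 * window t n"
      by (simp add: powr_minus)
    finally show ?thesis .
  qed (use \<open>k \<noteq> 0\<close> n in \<open>simp add: hcoef_def n_def[symmetric] bcoef_def\<close>)
  then have "(\<Sum>t\<le>S. 2 powr (r * real t) * norm (hcoef r t k)) \<le> (\<Sum>t\<le>S. 2 * window t n)"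
    by (intro sum_mono)
  also have "\<dots> = 2 * trap S n" by (simp add: sum_distrib_left[symmetric] sum_window)
  also have "\<dots> \<le> 2" using trap_bounds[of S n] by simp
  finally show ?thesis .
qed

section \<open>Tensor products and frequency boxes\<close>

definition mkap :: "real \<Rightarrow> ('d \<Rightarrow> nat) \<Rightarrow> real ^ 'd::finite \<Rightarrow> real" where
  "mkap r s z = (\<Prod>j\<in>UNIV. kap r (s j) (z $ j))"

definition level :: "('d::finite \<Rightarrow> nat) \<Rightarrow> nat" where
  "level s = (\<Sum>j\<in>UNIV. s j)"

definition fbox :: "('d::finite \<Rightarrow> nat) \<Rightarrow> ('d \<Rightarrow> int) set" where
  "fbox s = (\<Pi>\<^sub>E j\<in>UNIV. {- int (2 ^ Suc (s j))..int (2 ^ Suc (s j))})"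

definition mcoef :: "real \<Rightarrow> ('d::finite \<Rightarrow> nat) \<Rightarrow> ('d \<Rightarrow> int) \<Rightarrow> complex" where
  "mcoef r s k = (\<Prod>j\<in>UNIV. hcoef r (s j) (k j))"

lemma finite_fbox [simp]: "finite (fbox s)"
  by (simp add: fbox_def finite_PiE)

lemma prod_powr_level: "(\<Prod>j\<in>UNIV. 2 powr (c * real (s j))) = 2 powr (c * real (level s))"
  unfolding level_def of_nat_sum sum_distrib_left by (rule powr_sum[symmetric]) simp

lemma card_fbox: "real (card (fbox (s :: 'd::finite \<Rightarrow> nat))) \<le> 5 ^ CARD('d) * 2 ^ level s"
proof -
  have "card (fbox s) = (\<Prod>j\<in>UNIV. 2 * 2 ^ Suc (s j) + 1)"
    unfolding fbox_def by (simp add: card_PiE nat_add_distrib nat_mult_distrib nat_power_eq)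
  also have "\<dots> \<le> (\<Prod>j\<in>(UNIV :: 'd set). 5 * 2 ^ s j)"
    by (intro prod_mono) auto
  also have "\<dots> = 5 ^ CARD('d) * 2 ^ level s"
    by (simp add: prod.distrib level_def power_sum)
  finally have "real (card (fbox s)) \<le> real (5 ^ CARD('d) * 2 ^ level s)"
      by (simp only: of_nat_le_iff)
  then show ?thesis by simp
qed

lemma mem_fbox_iff: "k \<in> fbox s \<longleftrightarrow> (\<forall>j. \<bar>k j\<bar> \<le> 2 ^ Suc (s j))"
  by (auto simp: fbox_def PiE_iff abs_le_iff minus_le_iff)

lemma mcoef_outside: "k \<notin> fbox s \<Longrightarrow> mcoef r s k = 0"
proof -
  assume "k \<notin> fbox s"
  then obtain j where "int (2 ^ Suc (s j)) < \<bar>k j\<bar>"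
    by (auto simp: mem_fbox_iff not_le)
  then have "hcoef r (s j) (k j) = 0" by (rule hcoef_outside)
  then show ?thesis unfolding mcoef_def by (intro prod_zero) auto
qed

lemma mkap_eq_tpoly: "complex_of_real (mkap r s z) = tpoly (fbox s) (mcoef r s) z"
proof -
  have "complex_of_real (mkap r s z) = (\<Prod>j\<in>UNIV. \<Sum>k\<in>{- int (2 ^ Suc (s j))..int (2 ^ Suc (s j))}.
      hcoef r (s j) k * cis (of_int k * z $ j))"
    unfolding mkap_def of_real_prod kap_eq_hcoef ..
  also have "\<dots> = (\<Sum>k\<in>fbox s. \<Prod>j\<in>UNIV. hcoef r (s j) (k j) * cis (of_int (k j) * z $ j))"
    unfolding fbox_def by (rule prod_sum_PiE) auto
  finally show ?thesis by (simp add: tpoly_def mcoef_def texp_eq_prod prod.distrib)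
qed

lemma measurable_kap [measurable]: "kap r s \<in> borel_measurable borel"
  unfolding kap_def by measurable

lemma measurable_mkap [measurable]: "mkap r s \<in> borel_measurable borel"
  unfolding mkap_def by measurable

lemma abs_mkap_le:
  fixes s :: "'d::finite \<Rightarrow> nat"
  assumes "0 < r" "r < 1"
  shows "\<bar>mkap r s z\<bar> \<le> 9 ^ CARD('d) * 2 powr ((1 - r) * real (level s))"
proof -
  have "\<bar>mkap r s z\<bar> = (\<Prod>j\<in>UNIV. \<bar>kap r (s j) (z $ j)\<bar>)" by (simp add: mkap_def abs_prod)
  also have "\<dots> \<le> (\<Prod>j\<in>(UNIV :: 'd set). 9 * 2 powr ((1 - r) * real (s j)))"
    using abs_kap_le[OF assms] by (intro prod_mono) (auto simp only: mult.commute[of "1 - r"]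
        abs_ge_zero)
  also have "\<dots> = 9 ^ CARD('d) * 2 powr ((1 - r) * real (level s))"
    by (simp add: prod.distrib prod_powr_level)
  finally show ?thesis .
qed

lemma nn_integral_mkap_le:
  fixes s :: "'d::finite \<Rightarrow> nat"
  assumes "0 < r" "r < 1"
  shows "(\<integral>\<^sup>+ y. ennreal \<bar>mkap r s (x - y)\<bar> \<partial>torus_measure)
      \<le> ennreal (1200 ^ CARD('d) * 2 powr (- r * real (level s)))"
proof -
  have int: "integrable circle_measure (\<lambda>t. \<bar>kap r n (u - t)\<bar>)" for n u
    by (rule integrable_circle_bounded[of _ "9 * 2 powr (real n * (1 - r))"]) (use abs_kap_le[OF
        assms] in auto)
  have one: "(\<integral>\<^sup>+ t. ennreal \<bar>kap r n (u - t)\<bar> \<partial>circle_measure)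
      \<le> ennreal (1200 * 2 powr (- r * real n))" for n u
    using int integral_abs_kap_le[OF assms, of n u]
    by (subst nn_integral_eq_integral) (auto intro!: ennreal_leI)
  have "(\<integral>\<^sup>+ y. ennreal \<bar>mkap r s (x - y)\<bar> \<partial>torus_measure)
      = (\<integral>\<^sup>+ y. (\<Prod>j\<in>UNIV. ennreal \<bar>kap r (s j) (x $ j - y $ j)\<bar>) \<partial>torus_measure)"
    by (intro nn_integral_cong) (simp add: mkap_def abs_prod prod_ennreal)
  also have "\<dots> = (\<Prod>j\<in>UNIV. \<integral>\<^sup>+ t. ennreal \<bar>kap r (s j) (x $ j - t)\<bar> \<partial>circle_measure)"
    by (rule nn_integral_torus_prod) measurable
  also have "\<dots> \<le> (\<Prod>j\<in>(UNIV :: 'd set). ennreal (1200 * 2 powr (- r * real (s j))))"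
    by (intro prod_mono_ennreal one)
  also have "\<dots> = ennreal (1200 ^ CARD('d) * 2 powr (- r * real (level s)))"
    using prod_powr_level[of "- r" s] by (simp add: prod_ennreal prod.distrib)
  finally show ?thesis .
qed

definition fcoeff :: "(real ^ 'd::finite \<Rightarrow> complex) \<Rightarrow> ('d \<Rightarrow> int) \<Rightarrow> complex" where
  "fcoeff \<phi> k = (LINT y|torus_measure. \<phi> y * cnj (texp k y))"

lemma integrable_texp_mult:
  assumes "integrable torus_measure \<phi>"
  shows "integrable torus_measure (\<lambda>y. \<phi> y * cnj (texp k y))"
  by (rule Bochner_Integration.integrable_bound[OF assms]) (use assms in \<open>auto simp: norm_mult\<close>)

lemma convolution_mkap:
  assumes "integrable torus_measure \<phi>"
  shows "torus_convolution \<phi> (mkap r s) = tpoly (fbox s) (\<lambda>k. mcoef r s k * fcoeff \<phi> k)"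
proof
  fix x
  have "torus_convolution \<phi> (mkap r s) x
      = (LINT y|torus_measure. (\<Sum>k\<in>fbox s. (mcoef r s k * texp k x) * (\<phi> y * cnj (texp k y))))"
    unfolding torus_convolution_def mkap_eq_tpoly tpoly_def
    by (simp add: texp_diff_right sum_distrib_left mult_ac)
  also have "\<dots> = (\<Sum>k\<in>fbox s. (mcoef r s k * texp k x) * fcoeff \<phi> k)"
    using integrable_texp_mult[OF assms] by (simp add: fcoeff_def)
  finally show "torus_convolution \<phi> (mkap r s) x = tpoly (fbox s) (\<lambda>k. mcoef r s k * fcoeff \<phi> k) x"
    by (simp add: tpoly_def mult_ac)
qed

section \<open>Layers and their multipliers\<close>

definition layer :: "nat \<Rightarrow> ('d::finite \<Rightarrow> nat) set" where
  "layer l = {s. level s = l}"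

definition lfreq :: "nat \<Rightarrow> ('d::finite \<Rightarrow> int) set" where
  "lfreq l = (\<Union>s\<in>layer l. fbox s)"

lemma le_level: "s j \<le> level s"
  unfolding level_def by (rule member_le_sum) auto

lemma layer_subset: "layer l \<subseteq> (\<Pi>\<^sub>E j\<in>UNIV. {..l})"
  using le_level by (auto simp: layer_def)

lemma finite_layer [simp]: "finite (layer l)"
  by (rule finite_subset[OF layer_subset]) (simp add: finite_PiE)

text \<open>All coordinates but one determine an index of given level. This is where the exponent
  \<open>CARD('d) - 1\<close> originates.\<close>

lemma card_layer: "card (layer l :: ('d::finite \<Rightarrow> nat) set) \<le> (l + 1) ^ (CARD('d) - 1)"
proof -
  obtain a :: 'd where True by simp
  have "inj_on (\<lambda>s. restrict s (UNIV - {a})) (layer l)"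
  proof (rule inj_onI)
    fix s t :: "'d \<Rightarrow> nat" assume st: "s \<in> layer l" "t \<in> layer l" "restrict s (UNIV - {a})
        = restrict t (UNIV - {a})"
    have eq: "s j = t j" if "j \<noteq> a" for j
      using fun_cong[OF st(3), of j] that by simp
    have "level u = u a + (\<Sum>j\<in>UNIV - {a}. u j)" for u :: "'d \<Rightarrow> nat"
      unfolding level_def by (subst sum.remove[of UNIV a]) auto
    moreover have "(\<Sum>j\<in>UNIV - {a}. s j) = (\<Sum>j\<in>UNIV - {a}. t j)" using eq by (intro sum.cong) auto
    ultimately have "s a = t a" using st by (simp add: layer_def)
    show "s = t"
    proof
      fix j show "s j = t j" using \<open>s a = t a\<close> eq by (cases "j = a") auto
    qed
  qed
  moreover have "(\<lambda>s. restrict s (UNIV - {a})) ` layer l \<subseteq> (\<Pi>\<^sub>E j\<in>UNIV - {a}. {..l})"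
    by (auto simp: layer_def le_level split: if_splits)
  ultimately have "card (layer l :: ('d \<Rightarrow> nat) set) \<le> card (\<Pi>\<^sub>E j\<in>UNIV - {a}. {..l})"
    by (intro card_inj_on_le) (auto simp: finite_PiE)
  also have "\<dots> = (l + 1) ^ (CARD('d) - 1)"
    by (simp add: card_PiE card_Diff_singleton)
  finally show ?thesis .
qed

lemma finite_lfreq [simp]: "finite (lfreq l)"
  by (simp add: lfreq_def)

lemma card_lfreq:
  "real (card (lfreq l :: ('d::finite \<Rightarrow> int) set))
      \<le> 5 ^ CARD('d) * 2 ^ l * real (l + 1) ^ (CARD('d) - 1)"
proof -
  have "real (card (lfreq l :: ('d \<Rightarrow> int) set))
      \<le> real (\<Sum>s\<in>(layer l :: ('d \<Rightarrow> nat) set). card (fbox s))"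
    unfolding lfreq_def of_nat_le_iff by (rule card_UN_le) simp
  also have "\<dots> \<le> (\<Sum>s\<in>(layer l :: ('d \<Rightarrow> nat) set). 5 ^ CARD('d) * 2 ^ l)"
    unfolding of_nat_sum by (intro sum_mono order_trans[OF card_fbox]) (simp add: layer_def)
  also have "\<dots> = real (card (layer l :: ('d \<Rightarrow> nat) set)) * (5 ^ CARD('d) * 2 ^ l)"
    by simp
  also have "\<dots> \<le> real ((l + 1) ^ (CARD('d) - 1)) * (5 ^ CARD('d) * 2 ^ l)"
    using card_layer[where 'd = 'd, of l] by (intro mult_right_mono) (auto simp del: of_nat_power)
  finally show ?thesis by (simp add: mult_ac)
qed

lemma lfreq_bound: "k \<in> lfreq l \<Longrightarrow> \<bar>k j\<bar> \<le> 2 ^ Suc l"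
proof -
  assume "k \<in> lfreq l"
  then obtain s where s: "level s = l" "k \<in> fbox s" by (auto simp: lfreq_def layer_def)
  then have "\<bar>k j\<bar> \<le> 2 ^ Suc (s j)" by (simp only: mem_fbox_iff)
  also have "\<dots> \<le> 2 ^ Suc l" using le_level[of s j] s by (intro power_increasing) auto
  finally show ?thesis .
qed

lemma lfreq_nonempty: "lfreq l \<noteq> ({} :: ('d::finite \<Rightarrow> int) set)"
proof -
  obtain a :: 'd where True by simp
  have "(\<lambda>j. if j = a then l else 0) \<in> (layer l :: ('d \<Rightarrow> nat) set)"
      by (simp add: layer_def level_def)
  moreover have "(\<lambda>_. 0) \<in> fbox s" for s :: "'d \<Rightarrow> nat" by (auto simp: fbox_def)
  ultimately show ?thesis by (auto simp: lfreq_def)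
qed

definition lcoef :: "real \<Rightarrow> nat \<Rightarrow> ('d::finite \<Rightarrow> int) \<Rightarrow> complex" where
  "lcoef r l k = (\<Sum>s\<in>layer l. mcoef r s k)"

text \<open>The weight \<open>2 powr (r * l)\<close> factors over the coordinates; enlarging the
  layer to a box then turns the sum of products into a product of sums bounded by
  \<open>sum_hcoef_le\<close>. However many boxes cover a frequency, no power of \<open>l\<close>
  appears: this is the advantage of L_2 over the uniform norm.\<close>

lemma norm_lcoef_le:
  fixes k :: "'d::finite \<Rightarrow> int"
  assumes "0 < r" "r < 1"
  shows "norm (lcoef r l k) \<le> 2 ^ CARD('d) * 2 powr (- r * real l)"
proof -
  have "norm (lcoef r l k) \<le> (\<Sum>s\<in>layer l. norm (mcoef r s k))"
    unfolding lcoef_def by (rule norm_sum)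
  also have "\<dots> = 2 powr (- r * real l) * (\<Sum>s\<in>layer l. \<Prod>j\<in>UNIV. 2 powr (r * real (s j)) * norm (hcoef
      r (s j) (k j)))"
    unfolding sum_distrib_left
  proof (intro sum.cong refl)
    fix s :: "'d \<Rightarrow> nat" assume "s \<in> layer l"
    then have "(\<Prod>j\<in>UNIV. 2 powr (r * real (s j))) = 2 powr (r * real l)"
      using prod_powr_level[of r s] by (simp add: layer_def)
    then show "norm (mcoef r s k) = 2 powr (- r * real l) * (\<Prod>j\<in>UNIV. 2 powr (r * real (s j)) * norm
        (hcoef r (s j) (k j)))"
      by (simp add: mcoef_def prod_norm prod.distrib powr_minus)
  qed
  also have "\<dots> \<le> 2 powr (- r * real l) * (\<Sum>s\<in>(\<Pi>\<^sub>E j\<in>UNIV. {..l}). \<Prod>j\<in>UNIV. 2 powr (r * real (s j)) *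
      norm (hcoef r (s j) (k j)))"
    by (intro mult_left_mono sum_mono2 layer_subset) (auto simp: finite_PiE intro!: prod_nonneg)
  also have "(\<Sum>s\<in>(\<Pi>\<^sub>E j\<in>UNIV. {..l}). \<Prod>j\<in>UNIV. 2 powr (r * real (s j)) * norm (hcoef r (s j) (k j)))
      = (\<Prod>j\<in>UNIV. \<Sum>t\<le>l. 2 powr (r * real t) * norm (hcoef r t (k j)))"
    by (rule prod_sum_PiE[symmetric]) auto
  also have "\<dots> \<le> (\<Prod>j\<in>(UNIV :: 'd set). 2)"
    by (intro prod_mono) (auto intro!: sum_nonneg sum_hcoef_le assms)
  finally show ?thesis by (simp add: mult.commute)
qed

definition layer_conv :: "real \<Rightarrow> nat \<Rightarrow> (real ^ 'd::finite \<Rightarrow> complex) \<Rightarrow> real ^ 'd \<Rightarrow> complex" where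
  "layer_conv r l \<phi> x = (\<Sum>s\<in>layer l. torus_convolution \<phi> (mkap r s) x)"

lemma layer_conv_eq_tpoly:
  assumes "integrable torus_measure \<phi>"
  shows "layer_conv r l \<phi> = tpoly (lfreq l) (\<lambda>k. lcoef r l k * fcoeff \<phi> k)"
proof
  fix x :: "real ^ 'a"
  have "tpoly (fbox s) (\<lambda>k. mcoef r s k * fcoeff \<phi> k) x
      = (\<Sum>k\<in>lfreq l. mcoef r s k * (fcoeff \<phi> k * texp k x))"
    if "s \<in> layer l" for s
    unfolding tpoly_def using that
    by (intro sum.mono_neutral_cong_left) (auto simp: lfreq_def mcoef_outside mult_ac)
  then have "layer_conv r l \<phi> x = (\<Sum>s\<in>layer l. \<Sum>k\<in>lfreq l. mcoef r s k * (fcoeff \<phi> k * texp k x))"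
    unfolding layer_conv_def convolution_mkap[OF assms] by (intro sum.cong) auto
  also have "\<dots> = (\<Sum>k\<in>lfreq l. lcoef r l k * (fcoeff \<phi> k * texp k x))"
    by (subst sum.swap) (simp add: lcoef_def sum_distrib_right)
  finally show "layer_conv r l \<phi> x = tpoly (lfreq l) (\<lambda>k. lcoef r l k * fcoeff \<phi> k) x"
    by (simp add: tpoly_def mult_ac)
qed

section \<open>Convergence of the block expansion\<close>

lemma cis_eq_1_imp: "cis t = 1 \<Longrightarrow> \<exists>n::int. t = of_int n * 2 * pi"
  by (simp add: complex_eq_iff flip: cos_one_2pi_int)

lemma countable_cis_eq_1: "countable {t. cis (c - t) = 1}"
proof -
  have "{t. cis (c - t) = 1} \<subseteq> range (\<lambda>n::int. c - of_int n * 2 * pi)"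
    by (auto dest!: cis_eq_1_imp simp: image_iff algebra_simps)
  then show ?thesis by (rule countable_subset) auto
qed

lemma emeasure_circle_countable: "countable N \<Longrightarrow> emeasure circle_measure N = 0"
proof -
  assume "countable N"
  then have N: "N \<in> null_sets lborel" by (rule countable_imp_null_set_lborel)
  then have "AE t in lborel. t \<notin> N" by (rule AE_not_in)
  then have "(\<integral>\<^sup>+ t. ennreal (indicator {0..2 * pi} t / (2 * pi)) * indicator N t \<partial>lborel) = 0"
    using N by (subst nn_integral_0_iff_AE) (auto elim!: eventually_mono)
  then show ?thesis
    unfolding circle_measure_def using N by (subst emeasure_density) auto
qed

text \<open>In each coordinate the excluded set is countable, so the product formula gives it
  measure 0. Off these sets every univariate kernel series converges.\<close>

lemma AE_torus_off_singularities:
  "AE y in torus_measure. \<forall>j\<in>(UNIV :: 'd::finite set). cis (x $ j - y $ j) \<noteq> 1"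
proof (rule AE_finite_allI)
  fix j :: 'd
  define N where "N = {t. cis (x $ j - t) = 1}"
  have N: "countable N" unfolding N_def by (rule countable_cis_eq_1)
  then have [measurable]: "N \<in> sets borel" using countable_imp_null_set_lborel[of N] by auto
  define f :: "'d \<Rightarrow> real \<Rightarrow> ennreal" where "f i = (if i = j then indicator N else (\<lambda>_. 1))" for i
  have [measurable]: "f i \<in> borel_measurable borel" for i unfolding f_def by simp
  have "(\<integral>\<^sup>+ y. (\<Prod>i\<in>UNIV. f i (y $ i)) \<partial>torus_measure) = (\<Prod>i\<in>UNIV. \<integral>\<^sup>+ t. f i t \<partial>circle_measure)"
    by (rule nn_integral_torus_prod) measurable
  also have "(\<integral>\<^sup>+ t. f j t \<partial>circle_measure) = 0"
    using emeasure_circle_countable[OF N] by (simp add: f_def)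
  then have "(\<Prod>i\<in>UNIV. \<integral>\<^sup>+ t. f i t \<partial>circle_measure) = 0"
    by (intro prod_zero) auto
  finally have "AE y in torus_measure. (\<Prod>i\<in>UNIV. f i (y $ i)) = 0"
    by (subst (asm) nn_integral_0_iff_AE) auto
  then show "AE y in torus_measure. cis (x $ j - y $ j) \<noteq> 1"
  proof eventually_elim
    case (elim y)
    show ?case
    proof
      assume "cis (x $ j - y $ j) = 1"
      then have "f i (y $ i) = 1" for i by (simp add: f_def N_def)
      then show False using elim by simp
    qed
  qed
qed simp

definition Lp_ball :: "real \<Rightarrow> (real ^ 'd::finite \<Rightarrow> complex) set" where
  "Lp_ball p = {\<phi> \<in> borel_measurable borel. (\<integral>\<^sup>+ y. ennreal (norm (\<phi> y) powr p) \<partial>torus_measure)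
      \<le> 1}"

lemma Lp_ball_measurable: "\<phi> \<in> Lp_ball p \<Longrightarrow> \<phi> \<in> borel_measurable borel"
  by (simp add: Lp_ball_def)

lemma Lp_ball_integrable_powr:
  assumes "\<phi> \<in> Lp_ball p"
  shows "integrable torus_measure (\<lambda>y. norm (\<phi> y) powr p)" "(LINT y|torus_measure. norm (\<phi> y) powr
      p) \<le> 1"
proof -
  have [measurable]: "\<phi> \<in> borel_measurable borel" using assms by (rule Lp_ball_measurable)
  have le: "(\<integral>\<^sup>+ y. ennreal (norm (\<phi> y) powr p) \<partial>torus_measure) \<le> 1" using assms
      by (simp add: Lp_ball_def)
  then show int: "integrable torus_measure (\<lambda>y. norm (\<phi> y) powr p)"
    by (intro integrableI_bounded) (auto simp: order.strict_trans1)
  have "ennreal (LINT y|torus_measure. norm (\<phi> y) powr p) \<le> 1"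
    using le by (subst nn_integral_eq_integral[OF int, symmetric]) auto
  then show "(LINT y|torus_measure. norm (\<phi> y) powr p) \<le> 1" by simp
qed

lemma powr_bound_one: "0 \<le> u \<Longrightarrow> 0 \<le> c \<Longrightarrow> c \<le> p \<Longrightarrow> u powr c \<le> 1 + u powr p" for u :: real
proof (cases "u \<le> 1")
  case True
  assume "0 \<le> u" "0 \<le> c"
  then have "u powr c \<le> 1" using True powr_mono2[of c u 1] by simp
  then show ?thesis using powr_ge_zero[of u p] by linarith
next
  case False
  assume "c \<le> p"
  then have "u powr c \<le> u powr p" using False by (intro powr_mono) auto
  then show ?thesis by simp
qed

lemma Lp_ball_integrable:
  assumes "\<phi> \<in> Lp_ball p" "1 \<le> p"
  shows "integrable torus_measure \<phi>"
proof (rule Bochner_Integration.integrable_bound)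
  show "integrable torus_measure (\<lambda>y. 1 + norm (\<phi> y) powr p)"
    using Lp_ball_integrable_powr[OF assms(1)] by simp
  have "norm (\<phi> y) \<le> 1 + norm (\<phi> y) powr p" for y
    using powr_bound_one[of "norm (\<phi> y)" 1 p] assms by simp
  then show "AE y in torus_measure. norm (\<phi> y) \<le> norm (1 + norm (\<phi> y) powr p)"
    by (simp add: abs_of_nonneg add_nonneg_nonneg)
qed (use Lp_ball_measurable[OF assms(1)] in simp)

lemma truncation_bound:
  fixes t p u :: real
  assumes "0 < t" "1 \<le> p" "0 \<le> u" shows "u \<le> t + t powr (1 - p) * u powr p"
proof (cases "u \<le> t")
  case False
  then have "u = u powr (1 - p) * u powr p" using assms powr_add[of u "1 - p" p] by simp
  also have "\<dots> \<le> t powr (1 - p) * u powr p"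
    using False assms by (intro mult_right_mono powr_mono2') auto
  finally show ?thesis using assms by simp
qed (use assms in \<open>simp add: add_increasing2\<close>)

text \<open>Interpolation by truncation: below the height \<open>t\<close> the L_1 norm of the
  kernel is used, above it the uniform norm together with
  \<open>t powr (1 - p) * norm (\<phi> y) powr p\<close>. The choice
  \<open>t = 2 powr (l / p)\<close> makes both contributions of order
  \<open>2 powr (- (r - 1 / p) * l)\<close>.\<close>

lemma nn_integral_block_le:
  fixes s :: "'d::finite \<Rightarrow> nat"
  assumes \<phi>: "\<phi> \<in> Lp_ball p" and p: "1 \<le> p" and r: "0 < r" "r < 1"
  shows "(\<integral>\<^sup>+ y. ennreal (norm (\<phi> y) * \<bar>mkap r s (x - y)\<bar>) \<partial>torus_measure)
    \<le> ennreal ((1200 ^ CARD('d) + 9 ^ CARD('d)) * 2 powr (- (r - 1 / p) * real (level s)))"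
proof -
  have [measurable]: "\<phi> \<in> borel_measurable borel" using \<phi> by (rule Lp_ball_measurable)
  define l where "l = real (level s)"
  define t where "t = 2 powr (l / p)"
  define M where "M = 9 ^ CARD('d) * 2 powr ((1 - r) * l)"
  have t: "0 < t" by (simp add: t_def)
  have "norm (\<phi> y) * \<bar>mkap r s (x - y)\<bar> \<le> t * \<bar>mkap r s (x - y)\<bar> + t powr (1 - p) * M * norm (\<phi> y)
      powr p" for y
  proof -
    have "norm (\<phi> y) * \<bar>mkap r s (x - y)\<bar> \<le> (t + t powr (1 - p) * norm (\<phi> y) powr p) * \<bar>mkap r s (x
        - y)\<bar>"
      using t p by (intro mult_right_mono truncation_bound) auto
    also have "\<dots> = t * \<bar>mkap r s (x - y)\<bar> + (t powr (1 - p) * norm (\<phi> y) powr p) * \<bar>mkap r s (x -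
        y)\<bar>"
      by (simp add: distrib_right)
    also have "\<dots> \<le> t * \<bar>mkap r s (x - y)\<bar> + (t powr (1 - p) * norm (\<phi> y) powr p) * M"
      unfolding M_def l_def by (intro add_left_mono mult_left_mono abs_mkap_le r) auto
    finally show ?thesis by (simp add: mult_ac)
  qed
  then have "(\<integral>\<^sup>+ y. ennreal (norm (\<phi> y) * \<bar>mkap r s (x - y)\<bar>) \<partial>torus_measure)
    \<le> (\<integral>\<^sup>+ y. ennreal t * ennreal \<bar>mkap r s (x - y)\<bar> + ennreal (t powr (1 - p) * M) * ennreal (norm
        (\<phi> y) powr p) \<partial>torus_measure)"
    using t by (intro nn_integral_mono) (auto simp: ennreal_mult[symmetric] ennreal_plus[symmetric]
        M_def simp del: ennreal_plus intro!: ennreal_leI)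
  also have "\<dots> = ennreal t * (\<integral>\<^sup>+ y. ennreal \<bar>mkap r s (x - y)\<bar> \<partial>torus_measure)
      + ennreal (t powr (1 - p) * M) * (\<integral>\<^sup>+ y. ennreal (norm (\<phi> y) powr p) \<partial>torus_measure)"
    by (simp add: nn_integral_add nn_integral_cmult)
  also have "\<dots> \<le> ennreal t * ennreal (1200 ^ CARD('d) * 2 powr (- r * l)) + ennreal (t powr (1 - p)
      * M) * 1"
    unfolding l_def using \<phi> by (intro add_mono mult_left_mono nn_integral_mkap_le r) (auto simp:
        Lp_ball_def)
  also have "\<dots> = ennreal (t * (1200 ^ CARD('d) * 2 powr (- r * l)) + t powr (1 - p) * M)"
    using t by (simp add: ennreal_mult M_def)
  also have "t * (1200 ^ CARD('d) * 2 powr (- r * l))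
      = 1200 ^ CARD('d) * 2 powr (- (r - 1 / p) * l)"
    by (simp add: t_def powr_add[symmetric] left_diff_distrib algebra_simps)
  also have "t powr (1 - p) * M = 9 ^ CARD('d) * 2 powr (- (r - 1 / p) * l)"
  proof -
    have "l / p * (1 - p) + (1 - r) * l = - (r - 1 / p) * l"
      using p by (simp add: field_simps)
    then have "2 powr (l / p * (1 - p)) * 2 powr ((1 - r) * l) = 2 powr (- (r - 1 / p) * l)"
      by (simp only: powr_add[symmetric])
    then show ?thesis unfolding t_def M_def powr_powr by (simp only: mult.left_commute mult.assoc)
  qed
  finally show ?thesis by (simp add: l_def algebra_simps)
qed

lemma integrable_mult_mkap:
  fixes s :: "'d::finite \<Rightarrow> nat"
  assumes \<phi>: "\<phi> \<in> Lp_ball p" and p: "1 \<le> p" and r: "0 < r" "r < 1"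
  shows "integrable torus_measure (\<lambda>y. \<phi> y * complex_of_real (mkap r s (x - y)))"
proof (rule Bochner_Integration.integrable_bound)
  have [measurable]: "\<phi> \<in> borel_measurable borel" using \<phi> by (rule Lp_ball_measurable)
  show "integrable torus_measure (\<lambda>y. (9 ^ CARD('d) * 2 powr ((1 - r) * real (level s))) *\<^sub>R \<phi> y)"
    using Lp_ball_integrable[OF \<phi> p] by simp
  show "AE y in torus_measure. norm (\<phi> y * complex_of_real (mkap r s (x - y)))
    \<le> norm ((9 ^ CARD('d) * 2 powr ((1 - r) * real (level s))) *\<^sub>R \<phi> y)"
    using abs_mkap_le[OF r, of s] by (intro AE_I2) (auto simp: norm_mult mult.commute intro!:
        mult_left_mono)
  show "(\<lambda>y. \<phi> y * complex_of_real (mkap r s (x - y))) \<in> borel_measurable torus_measure"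
    by measurable
qed

lemma sum_box_level:
  fixes q :: real
  assumes q: "0 \<le> q" "q < 1"
  shows "(\<Sum>s\<in>(\<Pi>\<^sub>E j\<in>(UNIV :: 'd::finite set). {..S}). q ^ level s) \<le> (1 / (1 - q)) ^ CARD('d)"
proof -
  have "(\<Sum>s\<in>(\<Pi>\<^sub>E j\<in>(UNIV :: 'd set). {..S}). q ^ level s)
      = (\<Sum>s\<in>(\<Pi>\<^sub>E j\<in>(UNIV :: 'd set). {..S}). \<Prod>j\<in>UNIV. q ^ s j)"
    by (simp add: level_def power_sum)
  also have "\<dots> = (\<Prod>j\<in>(UNIV :: 'd set). \<Sum>t\<le>S. q ^ t)"
    by (rule prod_sum_PiE[symmetric]) auto
  also have "\<dots> = (\<Sum>t<Suc S. q ^ t) ^ CARD('d)"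
    by (simp add: lessThan_Suc_atMost)
  also have "\<dots> \<le> (1 / (1 - q)) ^ CARD('d)"
  proof (intro power_mono)
    have "(\<Sum>t<Suc S. q ^ t) = (1 - q ^ Suc S) / (1 - q)" using q
        by (simp add: sum_gp_strict del: sum.lessThan_Suc)
    also have "\<dots> \<le> 1 / (1 - q)" using q by (intro divide_right_mono) auto
    finally show "(\<Sum>t<Suc S. q ^ t) \<le> 1 / (1 - q)" .
  qed (use q in \<open>simp add: sum_nonneg\<close>)
  finally show ?thesis .
qed

lemma measurable_bernoulli_kernel [measurable]: "bernoulli_kernel r \<in> borel_measurable borel"
  unfolding bernoulli_kernel_def by measurable

text \<open>A sum over a box factors into univariate partial sums, so the integrands converge almost
  everywhere by \<open>kap_sums\<close>. The dominating function exists because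
  \<open>r > 1 / p\<close> makes the block integrals summable.\<close>

lemma convolution_bernoulli_LIMSEQ:
  fixes \<phi> :: "real ^ 'd::finite \<Rightarrow> complex"
  assumes \<phi>: "\<phi> \<in> Lp_ball p" and p: "1 \<le> p" and r: "1 / p < r" "r < 1"
  shows "(\<lambda>S. \<Sum>s\<in>(\<Pi>\<^sub>E j\<in>UNIV. {..S}). torus_convolution \<phi> (mkap r s) x)
    \<longlonglongrightarrow> torus_convolution \<phi> (bernoulli_kernel_multi r) x"
proof -
  have [measurable]: "\<phi> \<in> borel_measurable borel" using \<phi> by (rule Lp_ball_measurable)
  have r0: "0 < r" using r p by (intro less_trans[OF _ r(1)]) auto
  define Box where "Box S = (\<Pi>\<^sub>E j\<in>(UNIV :: 'd set). {..S :: nat})" for S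
  have finBox: "finite (Box S)" for S by (simp add: Box_def finite_PiE)
  define F where "F S y = \<phi> y * complex_of_real (\<Prod>j\<in>UNIV. \<Sum>t\<le>S. kap r t (x $ j - y $ j))" for S y
  define G where "G S y = norm (\<phi> y) * (\<Prod>j\<in>UNIV. \<Sum>t\<le>S. \<bar>kap r t (x $ j - y $ j)\<bar>)" for S y
  have [measurable]: "F S \<in> borel_measurable borel" "G S \<in> borel_measurable borel" for S
    unfolding F_def G_def by measurable
  have G0: "0 \<le> G S y" for S y unfolding G_def
      by (intro mult_nonneg_nonneg prod_nonneg sum_nonneg) auto
  have G_sum: "G S y = (\<Sum>s\<in>Box S. norm (\<phi> y) * \<bar>mkap r s (x - y)\<bar>)" for S y
    unfolding G_def Box_def by (subst prod_sum_PiE) (auto simp: mkap_def abs_prod sum_distrib_left)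
  have F_sum: "F S y = (\<Sum>s\<in>Box S. \<phi> y * complex_of_real (mkap r s (x - y)))" for S y
    unfolding F_def Box_def by (subst prod_sum_PiE) (auto simp: mkap_def sum_distrib_left)
  define q where "q = 2 powr (- (r - 1 / p))"
  have q: "0 \<le> q" "q < 1" using r powr_less_mono[of "- (r - 1 / p)" 0 2] by (auto simp: q_def)
  have ql: "2 powr (- (r - 1 / p) * real n) = q ^ n" for n
    using powr_realpow[of q n] by (simp add: q_def powr_powr)
  define C where "C = (1200 ^ CARD('d) + 9 ^ CARD('d)) * (1 / (1 - q)) ^ CARD('d)"
  have intG: "(\<integral>\<^sup>+ y. ennreal (G S y) \<partial>torus_measure) \<le> ennreal C" for S
  proof -
    have "(\<integral>\<^sup>+ y. ennreal (G S y) \<partial>torus_measure)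
        = (\<Sum>s\<in>Box S. \<integral>\<^sup>+ y. ennreal (norm (\<phi> y) * \<bar>mkap r s (x - y)\<bar>) \<partial>torus_measure)"
      unfolding G_sum by (subst nn_integral_sum[symmetric]) (auto intro!: nn_integral_cong simp:
          sum_ennreal)
    also have "\<dots> \<le> (\<Sum>s\<in>Box S. ennreal ((1200 ^ CARD('d) + 9 ^ CARD('d)) * q ^ level s))"
      using nn_integral_block_le[OF \<phi> p r0 r(2)] unfolding ql by (intro sum_mono)
    also have "\<dots> = ennreal ((1200 ^ CARD('d) + 9 ^ CARD('d)) * (\<Sum>s\<in>Box S. q ^ level s))"
      using q by (simp add: sum_ennreal sum_distrib_left)
    also have "\<dots> \<le> ennreal C"
      unfolding C_def Box_def by (intro ennreal_leI mult_left_mono sum_box_level q) auto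
    finally show ?thesis .
  qed
  \<comment> \<open>The sums \<open>G S\<close> of absolute values increase with \<open>S\<close>
    and have integrals below \<open>C\<close>; by monotone convergence their supremum is an
    integrable majorant.\<close>
  define W where "W y = (SUP S. ennreal (G S y))" for y
  have [measurable]: "W \<in> borel_measurable borel" unfolding W_def by measurable
  have "(\<integral>\<^sup>+ y. W y \<partial>torus_measure) = (SUP S. \<integral>\<^sup>+ y. ennreal (G S y) \<partial>torus_measure)"
    unfolding W_def
  proof (rule nn_integral_monotone_convergence_SUP)
    show "incseq (\<lambda>S y. ennreal (G S y))"
    proof (intro incseq_SucI le_funI ennreal_leI)
      fix S y show "G S y \<le> G (Suc S) y"
        unfolding G_def by (intro mult_left_mono prod_mono) (auto intro!: sum_nonneg)
    qed
  qed measurable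
  also have "\<dots> \<le> ennreal C" by (intro SUP_least intG)
  finally have WC: "(\<integral>\<^sup>+ y. W y \<partial>torus_measure) \<le> ennreal C" .
  then have "(\<integral>\<^sup>+ y. W y \<partial>torus_measure) \<noteq> \<infinity>" by (auto simp: top_unique)
  then have Wfin: "AE y in torus_measure. W y \<noteq> \<infinity>"
    by (intro nn_integral_PInf_AE) auto
  have GW: "G S y \<le> enn2real (W y)" if "W y \<noteq> \<infinity>" for S y
  proof -
    have "ennreal (G S y) \<le> W y" unfolding W_def by (intro SUP_upper) auto
    then have "enn2real (ennreal (G S y)) \<le> enn2real (W y)"
      using that by (intro enn2real_mono) (auto simp: less_top)
    then show ?thesis using G0 by simp
  qed
  have "(\<lambda>S. LINT y|torus_measure. F S y) \<longlonglongrightarrow> (LINT y|torus_measure. \<phi> y * complex_of_real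
      (bernoulli_kernel_multi r (x - y)))"
  proof (rule integral_dominated_convergence)
    show "integrable torus_measure (\<lambda>y. enn2real (W y))"
    proof (rule integrableI_bounded)
      have "(\<integral>\<^sup>+ y. ennreal (norm (enn2real (W y))) \<partial>torus_measure) \<le> (\<integral>\<^sup>+ y. W y \<partial>torus_measure)"
        by (intro nn_integral_mono) (simp add: ennreal_enn2real_if)
      also have "\<dots> < \<infinity>" using WC by (simp add: order.strict_trans1)
      finally show "(\<integral>\<^sup>+ y. ennreal (norm (enn2real (W y))) \<partial>torus_measure) < \<infinity>" .
    qed measurable
    show "AE y in torus_measure. norm (F S y) \<le> enn2real (W y)" for S
      using Wfin
    proof eventually_elim
      case (elim y)
      have "norm (F S y) \<le> G S y"
        unfolding F_def G_def norm_mult norm_of_real abs_prod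
        by (intro mult_left_mono prod_mono) auto
      also have "\<dots> \<le> enn2real (W y)" using GW elim by blast
      finally show ?case .
    qed
    show "AE y in torus_measure. (\<lambda>S. F S y) \<longlonglongrightarrow> \<phi> y * complex_of_real (bernoulli_kernel_multi r (x -
        y))"
      using AE_torus_off_singularities[of x]
    proof eventually_elim
      case (elim y)
      then show ?case
        unfolding F_def bernoulli_kernel_multi_def
        by (intro tendsto_intros) (auto intro!: kap_sums r0)
    qed
    show "F S \<in> borel_measurable torus_measure" for S by measurable
    show "(\<lambda>y. \<phi> y * complex_of_real (bernoulli_kernel_multi r (x - y))) \<in> borel_measurable
        torus_measure"
      unfolding bernoulli_kernel_multi_def vector_minus_component by measurable
  qed
  moreover have "(LINT y|torus_measure. F S y) = (\<Sum>s\<in>Box S. torus_convolution \<phi> (mkap r s) x)" for S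
  proof -
    have "integrable torus_measure (\<lambda>y. \<phi> y * complex_of_real (mkap r s (x - y)))" for s
      by (rule integrable_mult_mkap[OF \<phi> p r0 r(2)])
    then show ?thesis unfolding F_sum torus_convolution_def
        by (intro Bochner_Integration.integral_sum)
  qed
  ultimately show ?thesis unfolding Box_def torus_convolution_def by simp
qed

lemma norm_convolution_mkap_le:
  fixes s :: "'d::finite \<Rightarrow> nat"
  assumes \<phi>: "\<phi> \<in> Lp_ball p" and p: "1 \<le> p" and r: "0 < r" "r < 1"
  shows "norm (torus_convolution \<phi> (mkap r s) x)
    \<le> (1200 ^ CARD('d) + 9 ^ CARD('d)) * 2 powr (- (r - 1 / p) * real (level s))"
proof -
  have [measurable]: "\<phi> \<in> borel_measurable borel" using \<phi> by (rule Lp_ball_measurable)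
  have "ennreal (norm (torus_convolution \<phi> (mkap r s) x))
     \<le> (\<integral>\<^sup>+ y. ennreal (norm (\<phi> y * complex_of_real (mkap r s (x - y)))) \<partial>torus_measure)"
    unfolding torus_convolution_def by (rule integral_norm_bound_ennreal) (rule
        integrable_mult_mkap[OF \<phi> p r])
  also have "\<dots> \<le> ennreal ((1200 ^ CARD('d) + 9 ^ CARD('d)) * 2 powr (- (r - 1 / p) * real (level
      s)))"
    using nn_integral_block_le[OF \<phi> p r, of s x] by (simp add: norm_mult)
  finally show ?thesis by (subst (asm) ennreal_le_iff) auto
qed

lemma measurable_convolution_bernoulli:
  assumes \<phi>: "\<phi> \<in> Lp_ball p" and p: "1 \<le> p" and r: "1 / p < r" "r < 1"
  shows "torus_convolution \<phi> (bernoulli_kernel_multi r) \<in> borel_measurable borel"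
proof (rule borel_measurable_LIMSEQ_metric)
  show "(\<lambda>x. \<Sum>s\<in>(\<Pi>\<^sub>E j\<in>UNIV. {..S}). torus_convolution \<phi> (mkap r s) x) \<in> borel_measurable borel"
      for S
    unfolding convolution_mkap[OF Lp_ball_integrable[OF \<phi> p]] by measurable
qed (rule convolution_bernoulli_LIMSEQ[OF assms])

section \<open>Approximation of one layer\<close>

text \<open>Each block is estimated by the L_1 norm of its kernel; adding the blocks of the layer
  costs their number, the loss that later determines the critical layer.\<close>

lemma norm_layer_conv_bounded_le:
  fixes \<psi> :: "real ^ 'd::finite \<Rightarrow> complex"
  assumes [measurable]: "\<psi> \<in> borel_measurable borel" and b: "\<And>y. norm (\<psi> y) \<le> t" and r: "0 < r" "r
      < 1"
  shows "norm (layer_conv r l \<psi> x) \<le> real (l + 1) ^ (CARD('d) - 1) * (1200 ^ CARD('d) * 2 powr (- r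
      * real l) * t)"
proof -
  have t: "0 \<le> t" using b[of 0] norm_ge_zero order_trans by blast
  have "norm (torus_convolution \<psi> (mkap r s) x) \<le> 1200 ^ CARD('d) * 2 powr (- r * real l) * t"
      if s: "s \<in> layer l" for s
  proof -
    have "integrable torus_measure (\<lambda>y. \<psi> y * complex_of_real (mkap r s (x - y)))"
    proof (rule integrable_torus_bounded[of _ "t * (9 ^ CARD('d) * 2 powr ((1 - r) * real (level
        s)))"])
      fix y show "norm (\<psi> y * complex_of_real (mkap r s (x - y)))
          \<le> t * (9 ^ CARD('d) * 2 powr ((1 - r) * real (level s)))"
        using abs_mkap_le[OF r, of s "x - y"] b[of y] t by (simp add: norm_mult mult_mono)
    qed measurable
    then have "ennreal (norm (torus_convolution \<psi> (mkap r s) x))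
      \<le> (\<integral>\<^sup>+ y. ennreal (norm (\<psi> y * complex_of_real (mkap r s (x - y)))) \<partial>torus_measure)"
      unfolding torus_convolution_def by (rule integral_norm_bound_ennreal)
    also have "\<dots> \<le> (\<integral>\<^sup>+ y. ennreal t * ennreal \<bar>mkap r s (x - y)\<bar> \<partial>torus_measure)"
      using b t by (intro nn_integral_mono) (auto simp: norm_mult ennreal_mult[symmetric] intro!:
          ennreal_leI mult_right_mono)
    also have "\<dots> = ennreal t * (\<integral>\<^sup>+ y. ennreal \<bar>mkap r s (x - y)\<bar> \<partial>torus_measure)"
      by (rule nn_integral_cmult) measurable
    also have "\<dots> \<le> ennreal t * ennreal (1200 ^ CARD('d) * 2 powr (- r * real (level s)))"
      by (intro mult_left_mono nn_integral_mkap_le r) auto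
    also have "\<dots> = ennreal (1200 ^ CARD('d) * 2 powr (- r * real l) * t)"
      using s t by (simp add: ennreal_mult[symmetric] layer_def mult_ac)
    finally show ?thesis using t by (subst (asm) ennreal_le_iff) auto
  qed
  then have "norm (layer_conv r l \<psi> x) \<le> (\<Sum>s\<in>(layer l :: ('d \<Rightarrow> nat) set). 1200 ^ CARD('d) * 2 powr
      (- r * real l) * t)"
    unfolding layer_conv_def by (rule sum_norm_le)
  also have "\<dots> = real (card (layer l :: ('d \<Rightarrow> nat) set)) * (1200 ^ CARD('d) * 2 powr (- r * real l)
      * t)"
    by simp
  also have "\<dots> \<le> real ((l + 1) ^ (CARD('d) - 1)) * (1200 ^ CARD('d) * 2 powr (- r * real l) * t)"
    using card_layer[where 'd = 'd, of l] t by (intro mult_right_mono) (auto simp del: of_nat_power)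
  finally show ?thesis by simp
qed

text \<open>800 and the root stem from \<open>tpoly_L2_ball_sup_width\<close>, the last factor from
  \<open>norm_lcoef_le\<close>; 320 is 5 times the 64 in the number of grid points used
  below.\<close>

definition layer_const :: "'d::finite itself \<Rightarrow> real" where
  "layer_const _ = 800 * sqrt (5 ^ CARD('d) * (real CARD('d) * (ln (320 * real CARD('d) * 5 ^
      CARD('d)) + real CARD('d) + 2))) * 2 ^ CARD('d)"

lemma layer_const_nonneg: "0 \<le> layer_const TYPE('d::finite)"
proof -
  have "1 * 1 \<le> real CARD('d) * 5 ^ CARD('d)"
    by (intro mult_mono) (auto simp: Suc_le_eq)
  then have "0 \<le> ln (320 * real CARD('d) * 5 ^ CARD('d))"
    by (intro ln_ge_zero) auto
  then show ?thesis unfolding layer_const_def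
    by (intro mult_nonneg_nonneg real_sqrt_ge_zero add_nonneg_nonneg) auto
qed

text \<open>Bessel's inequality and the multiplier bound put the coefficients into a Euclidean ball
  of radius \<open>2 ^ d * 2 powr (- r * l) * \<tau>\<close>. Under the root, the number of
  frequencies gives \<open>2 ^ l * (l + 1) ^ (d - 1)\<close> and the logarithm of the grid size the
  last factor \<open>l + 1\<close>.\<close>

lemma layer_L2_width:
  assumes m: "0 < m" and r: "0 < r" "r < 1"
  obtains g :: "nat \<Rightarrow> ('d::finite \<Rightarrow> int) \<Rightarrow> complex" where
    "\<And>\<psi> \<tau>. \<psi> \<in> borel_measurable borel \<Longrightarrow> integrable torus_measure \<psi> \<Longrightarrow> 0 < \<tau> \<Longrightarrow>
      integrable torus_measure (\<lambda>y. (norm (\<psi> y))\<^sup>2) \<Longrightarrow> (LINT y|torus_measure. (norm (\<psi> y))\<^sup>2) \<le> \<tau>\<^sup>2 \<Longrightarrow>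
      \<exists>z. \<forall>x. norm (layer_conv r l \<psi> x - (\<Sum>j<m. z j * tpoly (lfreq l) (g j) x))
        \<le> layer_const TYPE('d) * (2 powr (- r * real l) * \<tau>) * sqrt (2 ^ l * real (l + 1) ^ CARD('d)
            / real m)"
proof -
  define d where "d = CARD('d)"
  have d: "0 < d" by (simp add: d_def)
  define Q where "Q = (lfreq l :: ('d \<Rightarrow> int) set)"
  \<comment> \<open>Polynomial in \<open>2 ^ l\<close>, so that \<open>ln N\<close> is linear in
    \<open>l\<close>, yet fine enough: degrees are at most \<open>2 ^ Suc l\<close> and there are at
    most \<open>5 ^ d * 2 ^ (l * d)\<close> frequencies.\<close>
  define N where "N = 64 * d * 5 ^ d * 2 ^ ((d + 2) * (l + 1))"
  have N: "0 < N" using d by (simp add: N_def)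
  have cQ: "real (card Q) \<le> 5 ^ d * 2 ^ l * real (l + 1) ^ (d - 1)"
    unfolding Q_def d_def by (rule card_lfreq)
  have l2: "real (l + 1) \<le> 2 ^ l"
    using Bernoulli_inequality[of 1 l] by simp
  have grid: "4 * pi * real CARD('d) * of_int (2 ^ Suc l) * real (card Q) \<le> real N"
  proof -
    have "real (card Q) \<le> 5 ^ d * 2 ^ l * (2 ^ l) ^ (d - 1)"
      using cQ l2 by (rule_tac order_trans[OF cQ]) (intro mult_left_mono power_mono, auto)
    also have "\<dots> = 5 ^ d * 2 ^ (l * d)"
      using d by (cases d) (simp_all add: power_mult[symmetric] power_add[symmetric])
    finally have cQ': "real (card Q) \<le> 5 ^ d * 2 ^ (l * d)" .
    have "4 * pi * real d * 2 ^ Suc l * real (card Q)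
        \<le> 16 * real d * 2 ^ Suc l * (5 ^ d * 2 ^ (l * d))"
      using pi_less_4 cQ' by (intro mult_mono) auto
    also have "\<dots> \<le> 64 * real d * 2 ^ Suc l * (5 ^ d * 2 ^ (l * d))"
      by (intro mult_right_mono) auto
    also have "\<dots> = 64 * real d * 5 ^ d * 2 ^ (Suc l + l * d)"
      by (simp add: power_add)
    also have "\<dots> \<le> 64 * real d * 5 ^ d * 2 ^ ((d + 2) * (l + 1))"
      by (intro mult_left_mono power_increasing) (auto simp: algebra_simps)
    finally show ?thesis by (simp add: N_def d_def)
  qed
  define A where "A = ln (320 * real d * 5 ^ d) + real d + 2"
  have lnN: "ln (5 * real N) \<le> A * real (l + 1)"
  proof -
    have "1 * 1 \<le> real d * 5 ^ d" using d by (intro mult_mono) auto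
    then have ln0: "0 \<le> ln (320 * real d * 5 ^ d)" by (intro ln_ge_zero) auto
    have "ln (5 * real N) = ln ((320 * real d * 5 ^ d) * 2 ^ ((d + 2) * (l + 1)))"
      by (simp add: N_def)
    also have "\<dots> = ln (320 * real d * 5 ^ d) + ln (2 ^ ((d + 2) * (l + 1)))"
      using d by (intro ln_mult_pos) auto
    also have "ln (2 ^ ((d + 2) * (l + 1)) :: real) = real ((d + 2) * (l + 1)) * ln 2"
      by (rule ln_realpow)
    also have "\<dots> \<le> real ((d + 2) * (l + 1)) * 1"
      using ln_le_minus_one[of 2] by (intro mult_left_mono) auto
    also have "ln (320 * real d * 5 ^ d) + real ((d + 2) * (l + 1)) * 1
        \<le> ln (320 * real d * 5 ^ d) * real (l + 1) + (real d + 2) * real (l + 1)"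
      using ln0 by (intro add_mono) (auto simp: algebra_simps)
    finally show ?thesis by (simp add: A_def algebra_simps)
  qed
  obtain g :: "nat \<Rightarrow> ('d \<Rightarrow> int) \<Rightarrow> complex" where
    g: "\<And>c. (\<Sum>k\<in>Q. (norm (c k))\<^sup>2) \<le> 1 \<Longrightarrow> \<exists>z. \<forall>x.
      norm (tpoly Q c x - (\<Sum>j<m. of_real (z j) * tpoly Q (g j) x))
      \<le> 800 * sqrt (real (card Q) * (real CARD('d) * ln (5 * real N)) / real m)"
    by (rule tpoly_L2_ball_sup_width[of Q "2 ^ Suc l" m N])
       (use lfreq_nonempty lfreq_bound m N grid in \<open>auto simp: Q_def\<close>)
  define \<epsilon> where "\<epsilon> = 800 * sqrt (real (card Q) * (real CARD('d) * ln (5 * real N)) / real m)"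
  have eps: "\<epsilon> * 2 ^ d \<le> layer_const TYPE('d) * sqrt (2 ^ l * real (l + 1) ^ d / real m)"
  proof -
    have "real (card Q) * (real d * ln (5 * real N))
        \<le> (5 ^ d * 2 ^ l * real (l + 1) ^ (d - 1)) * (real d * (A * real (l + 1)))"
      using cQ lnN N by (intro mult_mono mult_left_mono) auto
    also have "\<dots> = (5 ^ d * (real d * A)) * (2 ^ l * (real (l + 1) ^ (d - 1) * real (l + 1)))"
      by (simp only: mult_ac)
    also have "real (l + 1) ^ (d - 1) * real (l + 1) = real (l + 1) ^ d"
      using d by (rule power_minus_mult)
    finally have "real (card Q) * (real d * ln (5 * real N)) / real m
        \<le> (5 ^ d * (real d * A)) * (2 ^ l * real (l + 1) ^ d) / real m"
      by (intro divide_right_mono) auto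
    then have "sqrt (real (card Q) * (real d * ln (5 * real N)) / real m)
        \<le> sqrt ((5 ^ d * (real d * A)) * (2 ^ l * real (l + 1) ^ d) / real m)"
      by (rule real_sqrt_le_mono)
    also have "\<dots> = sqrt (5 ^ d * (real d * A)) * sqrt (2 ^ l * real (l + 1) ^ d / real m)"
      by (simp only: real_sqrt_mult real_sqrt_divide mult.assoc times_divide_eq_right)
    finally have "\<epsilon> * 2 ^ d \<le> 800 * (sqrt (5 ^ d * (real d * A)) * sqrt (2 ^ l * real (l + 1) ^ d /
        real m)) * 2 ^ d"
      unfolding \<epsilon>_def d_def[symmetric] by (intro mult_right_mono mult_left_mono) auto
    also have "\<dots> = layer_const TYPE('d) * sqrt (2 ^ l * real (l + 1) ^ d / real m)"
    proof -
      have "layer_const TYPE('d) = 800 * sqrt (5 ^ d * (real d * A)) * 2 ^ d"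
        by (simp only: layer_const_def d_def A_def)
      then show ?thesis by (simp only: mult_ac)
    qed
    finally show ?thesis .
  qed
  show ?thesis
  proof (rule that[of g])
    fix \<psi> :: "real ^ 'd \<Rightarrow> complex" and \<tau> :: real
    assume \<psi>: "\<psi> \<in> borel_measurable borel" "integrable torus_measure \<psi>" and \<tau>: "0 < \<tau>"
      and int2: "integrable torus_measure (\<lambda>y. (norm (\<psi> y))\<^sup>2)" "(LINT y|torus_measure. (norm (\<psi>
          y))\<^sup>2) \<le> \<tau>\<^sup>2"
    define R where "R = 2 ^ d * 2 powr (- r * real l) * \<tau>"
    have R: "0 < R" using \<tau> by (simp add: R_def)
    define c where "c k = lcoef r l k * fcoeff \<psi> k / of_real R" for k
    have bes: "(\<Sum>k\<in>Q. (norm (fcoeff \<psi> k))\<^sup>2) \<le> \<tau>\<^sup>2"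
      using bessel[of Q \<psi>] \<psi>(1) int2 by (simp add: fcoeff_def Q_def)
    have "(\<Sum>k\<in>Q. (norm (c k))\<^sup>2) \<le> (\<Sum>k\<in>Q. (norm (fcoeff \<psi> k))\<^sup>2 / \<tau>\<^sup>2)"
    proof (intro sum_mono)
      fix k
      have "norm (c k) = norm (lcoef r l k) * norm (fcoeff \<psi> k) / R"
        using R by (simp add: c_def norm_mult norm_divide)
      also have "\<dots> \<le> (2 ^ d * 2 powr (- r * real l)) * norm (fcoeff \<psi> k) / R"
        unfolding d_def using R by (intro divide_right_mono mult_right_mono norm_lcoef_le r) auto
      also have "\<dots> = norm (fcoeff \<psi> k) / \<tau>" using \<tau> by (simp add: R_def)
      finally have "(norm (c k))\<^sup>2 \<le> (norm (fcoeff \<psi> k) / \<tau>)\<^sup>2" by (intro power_mono) auto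
      then show "(norm (c k))\<^sup>2 \<le> (norm (fcoeff \<psi> k))\<^sup>2 / \<tau>\<^sup>2" by (simp add: power_divide)
    qed
    also have "\<dots> \<le> 1" using bes \<tau> by (simp add: sum_divide_distrib[symmetric])
    finally obtain z where z: "\<And>x. norm (tpoly Q c x - (\<Sum>j<m. of_real (z j) * tpoly Q (g j) x)) \<le> \<epsilon>"
      unfolding \<epsilon>_def using g by blast
    have conv: "layer_conv r l \<psi> x = of_real R * tpoly Q c x" for x
      using R unfolding layer_conv_eq_tpoly[OF \<psi>(2)] Q_def[symmetric]
      by (simp add: tpoly_def c_def sum_distrib_left)
    have "norm (layer_conv r l \<psi> x - (\<Sum>j<m. complex_of_real (R * z j) * tpoly (lfreq l) (g j) x))
        \<le> layer_const TYPE('d) * (2 powr (- r * real l) * \<tau>) * sqrt (2 ^ l * real (l + 1) ^ CARD('d)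
            / real m)" for x
    proof -
      have "layer_conv r l \<psi> x - (\<Sum>j<m. complex_of_real (R * z j) * tpoly (lfreq l) (g j) x)
          = of_real R * (tpoly Q c x - (\<Sum>j<m. of_real (z j) * tpoly Q (g j) x))"
        by (simp add: conv Q_def[symmetric] right_diff_distrib sum_distrib_left mult.assoc)
      then have "norm (layer_conv r l \<psi> x - (\<Sum>j<m. complex_of_real (R * z j) * tpoly (lfreq l) (g j)
          x)) \<le> R * \<epsilon>"
        using z[of x] R by (simp add: norm_mult)
      also have "\<dots> = (2 powr (- r * real l) * \<tau>) * (\<epsilon> * 2 ^ d)" by (simp add: R_def)
      also have "\<dots> \<le> (2 powr (- r * real l) * \<tau>) * (layer_const TYPE('d) * sqrt (2 ^ l * real (l +
          1) ^ d / real m))"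
        using eps \<tau> by (intro mult_left_mono) auto
      finally show ?thesis by (simp add: d_def mult_ac)
    qed
    then show "\<exists>z. \<forall>x. norm (layer_conv r l \<psi> x - (\<Sum>j<m. z j * tpoly (lfreq l) (g j) x))
        \<le> layer_const TYPE('d) * (2 powr (- r * real l) * \<tau>) * sqrt (2 ^ l * real (l + 1) ^ CARD('d)
            / real m)"
      by (intro exI[of _ "\<lambda>j. complex_of_real (R * z j)"] allI)
  qed
qed

lemma layer_conv_add:
  assumes "integrable torus_measure \<phi>" "integrable torus_measure \<psi>"
  shows "layer_conv r l (\<lambda>y. \<phi> y + \<psi> y) x = layer_conv r l \<phi> x + layer_conv r l \<psi> x"
proof -
  have "fcoeff (\<lambda>y. \<phi> y + \<psi> y) k = fcoeff \<phi> k + fcoeff \<psi> k" for k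
    unfolding fcoeff_def distrib_right using assms
    by (intro Bochner_Integration.integral_add integrable_texp_mult)
  then show ?thesis
    using assms by (simp add: layer_conv_eq_tpoly tpoly_def algebra_simps sum.distrib)
qed

text \<open>One subspace serves both estimates and every \<open>t\<close>, since \<open>g\<close> is
  chosen first. The first estimate treats all of \<open>\<phi>\<close> as an L_2 function; the
  second leaves its part below \<open>t\<close> unapproximated.\<close>

lemma layer_width:
  assumes m: "0 < m" and r: "0 < r" "r < 1" and p: "2 < p"
  obtains g :: "nat \<Rightarrow> ('d::finite \<Rightarrow> int) \<Rightarrow> complex" where
    "\<And>\<phi>. \<phi> \<in> Lp_ball p \<Longrightarrow> \<exists>z. \<forall>x. norm (layer_conv r l \<phi> x - (\<Sum>j<m. z j * tpoly (lfreq l) (g j) x))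
        \<le> 2 * layer_const TYPE('d) * 2 powr (- r * real l) * sqrt (2 ^ l * real (l + 1) ^ CARD('d) /
            real m)"
    "\<And>\<phi> t. \<phi> \<in> Lp_ball p \<Longrightarrow> 0 < t \<Longrightarrow> \<exists>z. \<forall>x. norm (layer_conv r l \<phi> x - (\<Sum>j<m. z j * tpoly (lfreq l)
        (g j) x))
        \<le> layer_const TYPE('d) * 2 powr (- r * real l) * t powr (1 - p / 2) * sqrt (2 ^ l * real (l
            + 1) ^ CARD('d) / real m)
          + 1200 ^ CARD('d) * 2 powr (- r * real l) * (real (l + 1) ^ (CARD('d) - 1) * t)"
proof -
  obtain g :: "nat \<Rightarrow> ('d \<Rightarrow> int) \<Rightarrow> complex" where
   g: "\<And>\<psi> \<tau>. \<psi> \<in> borel_measurable borel \<Longrightarrow> integrable torus_measure \<psi> \<Longrightarrow> 0 < \<tau> \<Longrightarrow>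
      integrable torus_measure (\<lambda>y. (norm (\<psi> y))\<^sup>2) \<Longrightarrow> (LINT y|torus_measure. (norm (\<psi> y))\<^sup>2) \<le> \<tau>\<^sup>2 \<Longrightarrow>
      \<exists>z. \<forall>x. norm (layer_conv r l \<psi> x - (\<Sum>j<m. z j * tpoly (lfreq l) (g j) x))
        \<le> layer_const TYPE('d) * (2 powr (- r * real l) * \<tau>) * sqrt (2 ^ l * real (l + 1) ^ CARD('d)
            / real m)"
    by (rule layer_L2_width[OF m r]) blast
  have sq: "u powr 2 = u\<^sup>2" if "0 \<le> u" for u :: real
    using that by (cases "u = 0") (simp_all add: powr_realpow[of u 2, simplified])
  show ?thesis
  proof (rule that[of g])
    fix \<phi> :: "real ^ 'd \<Rightarrow> complex" assume \<phi>: "\<phi> \<in> Lp_ball p"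
    note [measurable] = Lp_ball_measurable[OF \<phi>]
    note int = Lp_ball_integrable[OF \<phi>]
    note intp = Lp_ball_integrable_powr[OF \<phi>]
    have le: "(norm (\<phi> y))\<^sup>2 \<le> 1 + norm (\<phi> y) powr p" for y
      using powr_bound_one[of "norm (\<phi> y)" 2 p] p by (simp add: sq)
    have int2: "integrable torus_measure (\<lambda>y. (norm (\<phi> y))\<^sup>2)"
    proof (rule Bochner_Integration.integrable_bound)
      show "integrable torus_measure (\<lambda>y. 1 + norm (\<phi> y) powr p)" using intp by simp
      show "AE y in torus_measure. norm ((norm (\<phi> y))\<^sup>2) \<le> norm (1 + norm (\<phi> y) powr p)"
        using le by (auto simp: abs_of_nonneg add_nonneg_nonneg)
    qed measurable
    have "(LINT y|torus_measure. (norm (\<phi> y))\<^sup>2) \<le> (LINT y|torus_measure. 1 + norm (\<phi> y) powr p)"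
      using int2 intp le by (intro integral_mono) auto
    also have "\<dots> \<le> 2\<^sup>2" using intp torus.prob_space[where 'd = 'd] by simp
    finally have "\<exists>z. \<forall>x. norm (layer_conv r l \<phi> x - (\<Sum>j<m. z j * tpoly (lfreq l) (g j) x))
        \<le> layer_const TYPE('d) * (2 powr (- r * real l) * 2) * sqrt (2 ^ l * real (l + 1) ^ CARD('d)
            / real m)"
      using int int2 p by (intro g) auto
    then show "\<exists>z. \<forall>x. norm (layer_conv r l \<phi> x - (\<Sum>j<m. z j * tpoly (lfreq l) (g j) x))
        \<le> 2 * layer_const TYPE('d) * 2 powr (- r * real l) * sqrt (2 ^ l * real (l + 1) ^ CARD('d) /
            real m)"
      by (simp add: mult_ac)
    fix t :: real assume t: "0 < t"
    define \<phi>1 where "\<phi>1 y = (if norm (\<phi> y) \<le> t then 0 else \<phi> y)" for y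
    define \<phi>2 where "\<phi>2 y = (if norm (\<phi> y) \<le> t then \<phi> y else 0)" for y
    have [measurable]: "\<phi>1 \<in> borel_measurable borel" "\<phi>2 \<in> borel_measurable borel"
      unfolding \<phi>1_def \<phi>2_def by measurable
    have b2: "norm (\<phi>2 y) \<le> t" for y using t by (simp add: \<phi>2_def)
    have i2: "integrable torus_measure \<phi>2" by (rule integrable_torus_bounded[OF _ b2]) measurable
    have i1: "integrable torus_measure \<phi>1"
      by (rule Bochner_Integration.integrable_bound[OF int]) (use p in \<open>auto simp: \<phi>1_def\<close>)
    have i12: "integrable torus_measure (\<lambda>y. (norm (\<phi>1 y))\<^sup>2)"
      by (rule Bochner_Integration.integrable_bound[OF int2]) (auto simp: \<phi>1_def)
    \<comment> \<open>Above \<open>t\<close> the power with exponent \<open>2 - p < 0\<close> is at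
      most \<open>t powr (2 - p)\<close>; integration gives the L_2 norm
      \<open>t powr (1 - p / 2)\<close>.\<close>
    have le1: "(norm (\<phi>1 y))\<^sup>2 \<le> t powr (2 - p) * norm (\<phi> y) powr p" for y
    proof (cases "norm (\<phi> y) \<le> t")
      case False
      then have n0: "0 < norm (\<phi> y)" using t by linarith
      then have "(norm (\<phi> y))\<^sup>2 = norm (\<phi> y) powr (2 - p) * norm (\<phi> y) powr p"
        using sq[of "norm (\<phi> y)"] by (simp add: powr_add[symmetric])
      also have "\<dots> \<le> t powr (2 - p) * norm (\<phi> y) powr p"
        using False p t by (intro mult_right_mono powr_mono2') auto
      finally show ?thesis using False by (simp add: \<phi>1_def)
    qed (simp add: \<phi>1_def)
    have "(LINT y|torus_measure. (norm (\<phi>1 y))\<^sup>2)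
        \<le> (LINT y|torus_measure. t powr (2 - p) * norm (\<phi> y) powr p)"
      using i12 intp le1 by (intro integral_mono) auto
    also have "\<dots> \<le> t powr (2 - p) * 1"
      using intp by (simp add: mult_left_le)
    also have "\<dots> = (t powr (1 - p / 2))\<^sup>2"
      using t by (simp add: power2_eq_square powr_add[symmetric])
    finally obtain z where z: "\<And>x. norm (layer_conv r l \<phi>1 x - (\<Sum>j<m. z j * tpoly (lfreq l) (g j)
        x))
        \<le> layer_const TYPE('d) * (2 powr (- r * real l) * t powr (1 - p / 2)) * sqrt (2 ^ l * real
            (l + 1) ^ CARD('d) / real m)"
      using g[of \<phi>1 "t powr (1 - p / 2)"] i1 i12 t by auto
    have split: "layer_conv r l \<phi> x = layer_conv r l \<phi>1 x + layer_conv r l \<phi>2 x" for x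
    proof -
      have "\<phi> = (\<lambda>y. \<phi>1 y + \<phi>2 y)" by (auto simp: \<phi>1_def \<phi>2_def)
      then show ?thesis using layer_conv_add[OF i1 i2] by metis
    qed
    have "norm (layer_conv r l \<phi> x - (\<Sum>j<m. z j * tpoly (lfreq l) (g j) x))
        \<le> layer_const TYPE('d) * 2 powr (- r * real l) * t powr (1 - p / 2) * sqrt (2 ^ l * real (l
            + 1) ^ CARD('d) / real m)
          + 1200 ^ CARD('d) * 2 powr (- r * real l) * (real (l + 1) ^ (CARD('d) - 1) * t)" for x
    proof -
      have "norm (layer_conv r l \<phi> x - (\<Sum>j<m. z j * tpoly (lfreq l) (g j) x))
         = norm ((layer_conv r l \<phi>1 x - (\<Sum>j<m. z j * tpoly (lfreq l) (g j) x)) + layer_conv r l \<phi>2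
             x)"
        by (simp add: split algebra_simps)
      also have "\<dots> \<le> layer_const TYPE('d) * (2 powr (- r * real l) * t powr (1 - p / 2)) * sqrt (2 ^
          l * real (l + 1) ^ CARD('d) / real m)
          + real (l + 1) ^ (CARD('d) - 1) * (1200 ^ CARD('d) * 2 powr (- r * real l) * t)"
        by (rule norm_triangle_mono[OF z norm_layer_conv_bounded_le[OF _ b2 r]]) measurable
      finally show ?thesis by (simp add: mult_ac)
    qed
    then show "\<exists>z. \<forall>x. norm (layer_conv r l \<phi> x - (\<Sum>j<m. z j * tpoly (lfreq l) (g j) x))
        \<le> layer_const TYPE('d) * 2 powr (- r * real l) * t powr (1 - p / 2) * sqrt (2 ^ l * real (l
            + 1) ^ CARD('d) / real m)
          + 1200 ^ CARD('d) * 2 powr (- r * real l) * (real (l + 1) ^ (CARD('d) - 1) * t)"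
      by blast
  qed
qed

section \<open>Assembling the layers\<close>

text \<open>Allows any index type and at most \<open>m\<close> functions: the free places are filled
  with 0.\<close>

lemma kolmogorov_width_le:
  assumes I: "finite I" "card I \<le> m" and u: "\<And>i. i \<in> I \<Longrightarrow> u i \<in> X" and X0: "(\<lambda>_. 0) \<in> X"
    and app: "\<And>f. f \<in> F \<Longrightarrow> \<exists>c. N (\<lambda>x. f x - (\<Sum>i\<in>I. c i * u i x)) \<le> E"
  shows "kolmogorov_width m F X N \<le> E"
proof -
  obtain h where h: "bij_betw h {0..<card I} I"
    using ex_bij_betw_nat_finite[OF I(1)] by blast
  define v where "v i = (if i < card I then u (h i) else (\<lambda>_. 0))" for i
  have hI: "h i \<in> I" if "i < card I" for i
    using bij_betwE[OF h] that by simp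
  have v: "v i \<in> X" for i using hI u X0 by (simp add: v_def)
  have "(SUP f\<in>F. INF c. N (\<lambda>x. f x - (\<Sum>i<m. c i * v i x))) \<le> E"
  proof (rule SUP_least)
    fix f assume "f \<in> F"
    then obtain c where c: "N (\<lambda>x. f x - (\<Sum>i\<in>I. c i * u i x)) \<le> E" using app by blast
    have "(\<Sum>i<m. c (h i) * v i x) = (\<Sum>i\<in>I. c i * u i x)" for x
    proof -
      have "(\<Sum>i<m. c (h i) * v i x) = (\<Sum>i\<in>{0..<card I}. c (h i) * v i x)"
        using I by (intro sum.mono_neutral_right) (auto simp: v_def)
      also have "\<dots> = (\<Sum>i\<in>{0..<card I}. c (h i) * u (h i) x)"
        by (intro sum.cong) (auto simp: v_def)
      also have "\<dots> = (\<Sum>i\<in>I. c i * u i x)"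
        by (rule sum.reindex_bij_betw[OF h])
      finally show ?thesis .
    qed
    then have "N (\<lambda>x. f x - (\<Sum>i<m. (c \<circ> h) i * v i x)) \<le> E" using c by simp
    then show "(INF c. N (\<lambda>x. f x - (\<Sum>i<m. c i * v i x))) \<le> E"
      by (rule INF_lower2[where i = "c \<circ> h", OF UNIV_I])
  qed
  then show ?thesis
    unfolding kolmogorov_width_def by (rule INF_lower2[where i = v, rotated]) (simp add: v)
qed

lemma lcoef_outside: "k \<notin> lfreq l \<Longrightarrow> lcoef r l k = 0"
  unfolding lcoef_def by (intro sum.neutral) (auto simp: lfreq_def mcoef_outside)

definition low_freq :: "nat \<Rightarrow> ('d::finite \<Rightarrow> int) set" where
  "low_freq n = (\<Union>l\<le>n. lfreq l)"

lemma finite_low_freq [simp]: "finite (low_freq n)"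
  by (simp add: low_freq_def)

lemma card_low_freq:
  "real (card (low_freq n :: ('d::finite \<Rightarrow> int) set))
      \<le> 2 * 5 ^ CARD('d) * (2 ^ n * real (n + 1) ^ (CARD('d) - 1))"
proof -
  have "real (card (low_freq n :: ('d \<Rightarrow> int) set)) \<le> real (\<Sum>l\<le>n. card (lfreq l :: ('d \<Rightarrow> int) set))"
    unfolding low_freq_def of_nat_le_iff by (rule card_UN_le) simp
  also have "\<dots> \<le> (\<Sum>l\<le>n. 5 ^ CARD('d) * 2 ^ l * real (n + 1) ^ (CARD('d) - 1))"
    unfolding of_nat_sum
    by (intro sum_mono order_trans[OF card_lfreq] mult_left_mono power_mono) auto
  also have "\<dots> = 5 ^ CARD('d) * real (n + 1) ^ (CARD('d) - 1) * (\<Sum>l<Suc n. 2 ^ l)"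
    unfolding lessThan_Suc_atMost sum_distrib_left by (intro sum.cong) auto
  also have "(\<Sum>l<Suc n. 2 ^ l) = 2 ^ Suc n - (1 :: real)"
    by (subst sum_gp_strict) simp
  also have "5 ^ CARD('d) * real (n + 1) ^ (CARD('d) - 1) * (2 ^ Suc n - 1)
      \<le> 5 ^ CARD('d) * real (n + 1) ^ (CARD('d) - 1) * 2 ^ Suc n"
    by (intro mult_left_mono) auto
  finally show ?thesis by (simp add: mult_ac)
qed

lemma sum_layer_conv_low:
  assumes "integrable torus_measure \<phi>"
  shows "(\<Sum>l\<le>n. layer_conv r l \<phi> x) = tpoly (low_freq n) (\<lambda>k. \<Sum>l\<le>n. lcoef r l k * fcoeff \<phi> k) x"
proof -
  have "(\<Sum>l\<le>n. layer_conv r l \<phi> x) = (\<Sum>l\<le>n. \<Sum>k\<in>low_freq n. lcoef r l k * fcoeff \<phi> k * texp k x)"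
    unfolding layer_conv_eq_tpoly[OF assms] tpoly_def
    by (intro sum.cong refl sum.mono_neutral_left) (auto simp: low_freq_def lcoef_outside)
  also have "\<dots> = (\<Sum>k\<in>low_freq n. \<Sum>l\<le>n. lcoef r l k * fcoeff \<phi> k * texp k x)"
    by (rule sum.swap)
  finally show ?thesis by (simp add: tpoly_def sum_distrib_right)
qed

text \<open>Half of the exponential decay of the blocks yields the factor in \<open>L\<close>, the
  other half makes the sum converge uniformly in \<open>S\<close>. With \<open>L = 0\<close> the
  same bound covers the whole convolution.\<close>

lemma norm_high_blocks_le:
  fixes \<phi> :: "real ^ 'd::finite \<Rightarrow> complex"
  assumes \<phi>: "\<phi> \<in> Lp_ball p" and p: "1 \<le> p" and r: "1 / p < r" "r < 1"
  shows "norm (\<Sum>s\<in>{s \<in> (\<Pi>\<^sub>E j\<in>UNIV. {..S}). L \<le> level s}. torus_convolution \<phi> (mkap r s) x)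
    \<le> (1200 ^ CARD('d) + 9 ^ CARD('d)) * (1 / (1 - 2 powr (- (r - 1 / p) / 2))) ^ CARD('d)
        * 2 powr (- (r - 1 / p) / 2 * real L)"
proof -
  define q where "q = 2 powr (- (r - 1 / p) / 2)"
  define C :: real where "C = 1200 ^ CARD('d) + 9 ^ CARD('d)"
  have C: "0 \<le> C" by (simp add: C_def)
  have q: "0 < q" "q < 1" using r powr_less_mono[of "- (r - 1 / p) / 2" 0 2] by (auto simp: q_def)
  have r0: "0 < r" using r p by (intro less_trans[OF _ r(1)]) auto
  have qn: "q ^ n = 2 powr (- (r - 1 / p) / 2 * real n)" for n
    using powr_realpow[of q n] by (simp add: q_def powr_powr)
  have "norm (torus_convolution \<phi> (mkap r s) x) \<le> C * q ^ L * q ^ level s" if "L \<le> level s" for s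
  proof -
    have "norm (torus_convolution \<phi> (mkap r s) x) \<le> C * 2 powr (- (r - 1 / p) * real (level s))"
      unfolding C_def by (rule norm_convolution_mkap_le[OF \<phi> p r0 r(2)])
    also have "2 powr (- (r - 1 / p) * real (level s)) = q ^ level s * q ^ level s"
      unfolding qn powr_add[symmetric] by (simp add: algebra_simps)
    also have "C * (q ^ level s * q ^ level s) \<le> C * (q ^ L * q ^ level s)"
      using that q C by (intro mult_left_mono mult_right_mono power_decreasing) auto
    finally show ?thesis by (simp add: mult.assoc)
  qed
  then have "norm (\<Sum>s\<in>{s \<in> (\<Pi>\<^sub>E j\<in>UNIV. {..S}). L \<le> level s}. torus_convolution \<phi> (mkap r s) x)
     \<le> (\<Sum>s\<in>{s \<in> (\<Pi>\<^sub>E j\<in>(UNIV :: 'd set). {..S}). L \<le> level s}. C * q ^ L * q ^ level s)"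
    by (intro sum_norm_le) auto
  also have "\<dots> \<le> (\<Sum>s\<in>(\<Pi>\<^sub>E j\<in>(UNIV :: 'd set). {..S}). C * q ^ L * q ^ level s)"
    using C q by (intro sum_mono2) (auto simp: finite_PiE)
  also have "\<dots> = C * q ^ L * (\<Sum>s\<in>(\<Pi>\<^sub>E j\<in>(UNIV :: 'd set). {..S}). q ^ level s)"
    by (simp add: sum_distrib_left)
  also have "\<dots> \<le> C * q ^ L * (1 / (1 - q)) ^ CARD('d)"
    using C q by (intro mult_left_mono sum_box_level) auto
  finally show ?thesis unfolding qn[symmetric] C_def q_def[symmetric] by (simp add: mult_ac)
qed

lemma sum_box_split:
  fixes h :: "('d::finite \<Rightarrow> nat) \<Rightarrow> complex"
  assumes "L \<le> S"
  shows "(\<Sum>s\<in>(\<Pi>\<^sub>E j\<in>UNIV. {..S}). h s) = (\<Sum>l\<le>L. \<Sum>s\<in>layer l. h s)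
    + (\<Sum>s\<in>{s \<in> (\<Pi>\<^sub>E j\<in>UNIV. {..S}). Suc L \<le> level s}. h s)"
proof -
  define Box where "Box = (\<Pi>\<^sub>E j\<in>(UNIV :: 'd set). {..S})"
  have fin: "finite Box" by (simp add: Box_def finite_PiE)
  have lay: "layer l = {s \<in> {s \<in> Box. level s \<le> L}. level s = l}" if "l \<le> L" for l
  proof -
    have "s j \<le> S" if "level s = l" for s and j :: 'd
      using le_level[of s j] that \<open>l \<le> L\<close> assms by linarith
    then show ?thesis using that by (auto simp: layer_def Box_def PiE_iff)
  qed
  have "(\<Sum>s\<in>Box. h s) = (\<Sum>s\<in>{s \<in> Box. level s \<le> L}. h s) + (\<Sum>s\<in>{s \<in> Box. Suc L \<le> level s}. h s)"
    using fin by (subst sum.union_disjoint[symmetric]) (auto intro!: sum.cong)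
  also have "(\<Sum>s\<in>{s \<in> Box. level s \<le> L}. h s) = (\<Sum>l\<in>{..L}. \<Sum>s\<in>{s \<in> {s \<in> Box. level s \<le> L}. level s
      = l}. h s)"
    using fin by (intro sum.group[symmetric]) auto
  also have "\<dots> = (\<Sum>l\<le>L. \<Sum>s\<in>layer l. h s)"
    using lay by (intro sum.cong) auto
  finally show ?thesis by (simp add: Box_def)
qed

text \<open>For \<open>S \<ge> L\<close> the box contains all layers up to \<open>L\<close>, so the
  error bound holds for every large box and passes to the limit. In the index set,
  \<open>Inl\<close> carries the characters of the exactly reproduced layers and \<open>Inr\<close>
  the pairs of a layer and one of its basis functions.\<close>

lemma hyperbolic_approximation:
  fixes \<phi> :: "real ^ 'd::finite \<Rightarrow> complex" and g :: "nat \<Rightarrow> nat \<Rightarrow> ('d \<Rightarrow> int) \<Rightarrow> complex"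
  assumes \<phi>: "\<phi> \<in> Lp_ball p" and p: "1 \<le> p" and r: "1 / p < r" "r < 1" and "n \<le> L"
    and app: "\<And>l. l \<in> {n<..L} \<Longrightarrow>
      \<exists>z. \<forall>x. norm (layer_conv r l \<phi> x - (\<Sum>j<M l. z j * tpoly (lfreq l) (g l j) x)) \<le> e l"
  shows "\<exists>c. \<forall>x. norm (torus_convolution \<phi> (bernoulli_kernel_multi r) x
       - (\<Sum>i\<in>low_freq n <+> Sigma {n<..L} (\<lambda>l. {..<M l}).
            c i * (case i of Inl k \<Rightarrow> texp k x | Inr (l, j) \<Rightarrow> tpoly (lfreq l) (g l j) x)))
     \<le> (\<Sum>l\<in>{n<..L}. e l) + (1200 ^ CARD('d) + 9 ^ CARD('d)) * (1 / (1 - 2 powr (- (r - 1 / p) / 2)))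
         ^ CARD('d)
        * 2 powr (- (r - 1 / p) / 2 * real (Suc L))"
proof -
  have "\<exists>z. \<forall>l\<in>{n<..L}. \<forall>x. norm (layer_conv r l \<phi> x - (\<Sum>j<M l. z l j * tpoly (lfreq l) (g l j) x))
      \<le> e l"
    using app by (intro bchoice) auto
  then obtain z where z: "\<And>l x. l \<in> {n<..L} \<Longrightarrow> norm (layer_conv r l \<phi> x - (\<Sum>j<M l. z l j * tpoly
      (lfreq l) (g l j) x)) \<le> e l"
    by blast
  define c where "c i = (case i of Inl k \<Rightarrow> \<Sum>l\<le>n. lcoef r l k * fcoeff \<phi> k | Inr (l, j) \<Rightarrow> z l j)"
      for i
  note int = Lp_ball_integrable[OF \<phi> p]
  define T where "T = (1200 ^ CARD('d) + 9 ^ CARD('d)) * (1 / (1 - 2 powr (- (r - 1 / p) / 2))) ^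
      CARD('d)
        * 2 powr (- (r - 1 / p) / 2 * real (Suc L))"
  define a where "a x = (\<Sum>i\<in>low_freq n <+> Sigma {n<..L} (\<lambda>l. {..<M l}).
            c i * (case i of Inl k \<Rightarrow> texp k x | Inr (l, j) \<Rightarrow> tpoly (lfreq l) (g l j) x))" for x
  have a: "a x = (\<Sum>l\<le>n. layer_conv r l \<phi> x) + (\<Sum>l\<in>{n<..L}. \<Sum>j<M l. z l j * tpoly (lfreq l) (g l j)
      x)" for x
    unfolding a_def sum_layer_conv_low[OF int]
    by (subst sum.Plus) (auto simp: c_def tpoly_def sum.Sigma split_def)
  have bound: "norm ((\<Sum>s\<in>(\<Pi>\<^sub>E j\<in>UNIV. {..S}). torus_convolution \<phi> (mkap r s) x) - a x)
      \<le> (\<Sum>l\<in>{n<..L}. e l) + T"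
    if "L \<le> S" for S x
  proof -
    define H where "H = (\<Sum>s\<in>{s \<in> (\<Pi>\<^sub>E j\<in>UNIV. {..S}). Suc L
        \<le> level s}. torus_convolution \<phi> (mkap r s) x)"
    have "{..L} = {..n} \<union> {n<..L}" "{..n} \<inter> {n<..L} = {}" using \<open>n \<le> L\<close> by auto
    then have "(\<Sum>l\<le>L. layer_conv r l \<phi> x) = (\<Sum>l\<le>n. layer_conv r l \<phi> x) + (\<Sum>l\<in>{n<..L}. layer_conv r l
        \<phi> x)"
      by (simp add: sum.union_disjoint)
    then have "(\<Sum>s\<in>(\<Pi>\<^sub>E j\<in>UNIV. {..S}). torus_convolution \<phi> (mkap r s) x) - a x
       = (\<Sum>l\<in>{n<..L}. layer_conv r l \<phi> x - (\<Sum>j<M l. z l j * tpoly (lfreq l) (g l j) x)) + H"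
      unfolding sum_box_split[OF that] a H_def layer_conv_def[symmetric]
          by (simp add: sum_subtractf)
    also have "norm \<dots> \<le> (\<Sum>l\<in>{n<..L}. e l) + T"
      unfolding H_def T_def
      by (intro norm_triangle_mono sum_norm_le z norm_high_blocks_le[OF \<phi> p r]) auto
    finally show ?thesis .
  qed
  have "norm (torus_convolution \<phi> (bernoulli_kernel_multi r) x - a x) \<le> (\<Sum>l\<in>{n<..L}. e l) + T" for x
  proof (rule LIMSEQ_le_const2)
    show "(\<lambda>S. norm ((\<Sum>s\<in>(\<Pi>\<^sub>E j\<in>UNIV. {..S}). torus_convolution \<phi> (mkap r s) x) - a x))
      \<longlonglongrightarrow> norm (torus_convolution \<phi> (bernoulli_kernel_multi r) x - a x)"
      by (intro tendsto_intros convolution_bernoulli_LIMSEQ[OF \<phi> p r])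
  qed (use bound in blast)
  then show ?thesis unfolding a_def T_def by blast
qed

section \<open>Distribution of the dimensions over the layers\<close>

lemma sum_power_finite_le:
  fixes q :: real
  assumes "0 \<le> q" "q < 1" "finite A"
  shows "(\<Sum>j\<in>A. q ^ j) \<le> 1 / (1 - q)"
  using sum_le_suminf[OF summable_geometric assms(3), of q] suminf_geometric[of q] assms by simp

lemma sum_powr_abs_le:
  fixes \<eta> :: real
  assumes \<eta>: "0 < \<eta>" and A: "finite A"
  shows "(\<Sum>l\<in>A. 2 powr (- \<eta> * \<bar>real l - real c\<bar>)) \<le> 2 / (1 - 2 powr (- \<eta>))"
proof -
  define q where "q = 2 powr (- \<eta>)"
  have q: "0 < q" "q < 1" using \<eta> powr_less_mono[of "- \<eta>" 0 2] by (auto simp: q_def)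
  have qn: "2 powr (- \<eta> * real j) = q ^ j" for j
    using powr_realpow[of q j] by (simp add: q_def powr_powr)
  define A1 where "A1 = {l \<in> A. l \<le> c}"
  define A2 where "A2 = {l \<in> A. \<not> l \<le> c}"
  have "(\<Sum>l\<in>A. 2 powr (- \<eta> * \<bar>real l - real c\<bar>))
      = (\<Sum>l\<in>A1. 2 powr (- \<eta> * \<bar>real l - real c\<bar>)) + (\<Sum>l\<in>A2. 2 powr (- \<eta> * \<bar>real l - real c\<bar>))"
    using A unfolding A1_def A2_def by (subst sum.union_disjoint[symmetric]) (auto intro!: sum.cong)
  also have "(\<Sum>l\<in>A1. 2 powr (- \<eta> * \<bar>real l - real c\<bar>)) = (\<Sum>l\<in>A1. q ^ (c - l))"
    unfolding qn[symmetric] by (intro sum.cong refl) (simp add: A1_def of_nat_diff)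
  also have "\<dots> = (\<Sum>j\<in>(\<lambda>l. c - l) ` A1. q ^ j)"
    by (subst sum.reindex) (auto simp: inj_on_def A1_def)
  also have "\<dots> \<le> 1 / (1 - q)"
    using q A by (intro sum_power_finite_le) (auto simp: A1_def)
  also have "(\<Sum>l\<in>A2. 2 powr (- \<eta> * \<bar>real l - real c\<bar>)) = (\<Sum>l\<in>A2. q ^ (l - c))"
    unfolding qn[symmetric] by (intro sum.cong refl) (simp add: A2_def of_nat_diff)
  also have "\<dots> = (\<Sum>j\<in>(\<lambda>l. l - c) ` A2. q ^ j)"
    by (subst sum.reindex) (auto simp: inj_on_def A2_def)
  also have "\<dots> \<le> 1 / (1 - q)"
    using q A by (intro sum_power_finite_le) (auto simp: A2_def)
  finally show ?thesis by (simp add: q_def)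
qed

lemma exists_dyadic_between:
  fixes y :: real
  assumes "1 \<le> y"
  obtains a :: nat where "y \<le> 2 ^ a" "2 ^ a \<le> 2 * y"
proof -
  define a where "a = (LEAST a. y \<le> 2 ^ a)"
  have ex: "\<exists>a. y \<le> 2 ^ a"
    using real_arch_pow[of 2 y] by (auto intro: less_imp_le)
  have 1: "y \<le> 2 ^ a" unfolding a_def by (rule LeastI_ex[OF ex])
  have 2: "2 ^ a \<le> 2 * y"
  proof (cases a)
    case (Suc b)
    then have "\<not> y \<le> 2 ^ b" unfolding a_def using not_less_Least[of b "\<lambda>a. y \<le> 2 ^ a"] by simp
    then show ?thesis by (simp add: Suc)
  qed (use assms in simp)
  show ?thesis using that 1 2 .
qed

text \<open>Here \<open>n\<close> is the only parameter and \<open>\<omega>\<close> the exponent of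
  \<open>n\<close> in the error at the critical layer \<open>n + a\<close>. Both the dimensions and
  the errors decay geometrically with the distance \<open>\<delta>\<close> from it, so neither sum
  over the layers adds a power of \<open>n\<close>.\<close>

lemma level_width:
  fixes p r :: real
  assumes d: "2 \<le> CARD('d::finite)" and p: "2 < p" and r: "1 / p < r" "r < 1 / 2"
  defines "\<omega> \<equiv> (real CARD('d) - 1) - r * (2 * real CARD('d) - 3)"
  shows "\<exists>A C. 1 \<le> A \<and> 0 < C \<and> (\<forall>n\<ge>1. \<exists>(I :: (('d \<Rightarrow> int) + nat \<times> nat) set) Q b. finite I \<and>
    real (card I) \<le> A * (2 ^ n * real n ^ (CARD('d) - 1)) \<and> (\<forall>i. finite (Q i)) \<and>
    (\<forall>\<phi>\<in>(Lp_ball p :: (real ^ 'd \<Rightarrow> complex) set). \<exists>c. \<forall>x. norm (torus_convolution \<phi>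
        (bernoulli_kernel_multi r) x
       - (\<Sum>i\<in>I. c i * tpoly (Q i) (b i) x)) \<le> C * (2 powr (- r * real n) * real n powr \<omega>)))"
proof -
  define D where "D = real CARD('d)"
  have D: "2 \<le> D" using d by (simp add: D_def)
  have r0: "0 < r" using r p by (intro less_trans[OF _ r(1)]) auto
  have rp: "1 < r * p" using r p by (simp add: field_simps)
  \<comment> \<open>Rate at which the dimensions decrease. It is small enough that
    \<open>\<theta>\<close> stays below \<open>r\<close> and that
    \<open>1 / 2 - r - \<kappa> / 2\<close> stays positive.\<close>
  define \<kappa> where "\<kappa> = min (r * p - 1) (1 - 2 * r) / 2"
  have \<kappa>: "0 < \<kappa>" "\<kappa> \<le> (r * p - 1) / 2" "\<kappa> \<le> (1 - 2 * r) / 2"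
    using rp r by (auto simp: \<kappa>_def)
  \<comment> \<open>Growth rate of the truncation height. Slightly above \<open>1 / p\<close>, it
    makes up exactly for the smaller dimensions: in \<open>exps\<close> the terms with
    \<open>\<kappa>\<close> cancel.\<close>
  define \<theta> where "\<theta> = (1 + \<kappa>) / p"
  have \<theta>p: "\<theta> * p = 1 + \<kappa>" using p by (simp add: \<theta>_def)
  have \<theta>: "\<theta> < r" using \<kappa> rp p by (simp add: \<theta>_def field_simps)
  \<comment> \<open>Decay rate of the errors: the first argument is the rate before the critical
    layer, the second the rate after it.\<close>
  define \<eta> where "\<eta> = min (1 / 2 - r - \<kappa> / 2) (r - \<theta>)"
  have \<eta>: "0 < \<eta>" "\<eta> \<le> 1 / 2 - r - \<kappa> / 2" "\<eta> \<le> r - \<theta>"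
    using \<kappa> r \<theta> by (auto simp: \<eta>_def)
  have \<omega>0: "0 \<le> \<omega>"
  proof -
    have "r * (2 * D - 3) \<le> 1 / 2 * (2 * D - 3)" using r D by (intro mult_right_mono) auto
    then show ?thesis by (simp add: \<omega>_def D_def)
  qed
  define \<gamma> where "\<gamma> = (r - 1 / p) / 2"
  have \<gamma>: "0 < \<gamma>" using r by (simp add: \<gamma>_def)
  \<comment> \<open>The last treated layer is \<open>B * n\<close>; with
    \<open>r / \<gamma> \<le> B\<close> the far blocks contribute at most a multiple of
    \<open>2 powr (- r * n)\<close>. Adding 1 ensures \<open>n \<le> B * n\<close>.\<close>
  obtain B0 :: nat where B0: "r / \<gamma> \<le> real B0" using real_arch_simple by blast
  define B where "B = B0 + 1"
  \<comment> \<open>On all treated layers \<open>l + 1 \<le> b * n\<close>, so powers of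
    \<open>l\<close> become powers of \<open>n\<close>.\<close>
  define b where "b = real (B + 1)"
  have b1: "1 \<le> b" by (simp add: b_def)
  define K where "K = layer_const TYPE('d)"
  have K: "0 \<le> K" unfolding K_def by (rule layer_const_nonneg)
  define C1 :: real where "C1 = 1200 ^ CARD('d)"
  have C1: "0 < C1" by (simp add: C1_def)
  define C2 where "C2 = 4 * K * sqrt (b ^ CARD('d)) + C1 * b ^ (CARD('d) - 1)"
  have C2: "0 < C2" using K C1 b1 unfolding C2_def by (intro add_nonneg_pos mult_pos_pos) auto
  define CT :: real where "CT = (1200 ^ CARD('d) + 9 ^ CARD('d)) * (1 / (1 - 2 powr (- (r - 1 / p) /
      2))) ^ CARD('d)"
  have CT: "0 \<le> CT"
    using r powr_less_mono[of "- (r - 1 / p) / 2" 0 2]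
        by (auto simp: CT_def intro!: mult_nonneg_nonneg)
  define C where "C = C2 * (2 / (1 - 2 powr (- \<eta>))) + CT"
  have "0 < 2 / (1 - 2 powr (- \<eta>))" using \<eta> powr_less_mono[of "- \<eta>" 0 2] by auto
  then have C: "0 < C" unfolding C_def using C2 CT by (intro add_pos_nonneg mult_pos_pos) auto
  \<comment> \<open>The three summands count the low frequencies, the geometric sum of the
    dimensions, and the rounding up in each layer.\<close>
  define A where "A = 2 * 5 ^ CARD('d) * 2 ^ (CARD('d) - 1) + 2 / (1 - 2 powr (- \<kappa>)) + real B"
  have A1: "1 \<le> A"
  proof -
    have "0 \<le> 2 / (1 - 2 powr (- \<kappa>))" using \<kappa> powr_less_mono[of "- \<kappa>" 0 2] by auto
    moreover have "0 \<le> 2 * 5 ^ CARD('d) * (2 :: real) ^ (CARD('d) - 1)" by simp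
    ultimately show ?thesis by (simp add: A_def B_def)
  qed
  have main: "\<exists>(I :: (('d \<Rightarrow> int) + nat \<times> nat) set) Q b. finite I \<and>
    real (card I) \<le> A * (2 ^ n * real n ^ (CARD('d) - 1)) \<and> (\<forall>i. finite (Q i)) \<and>
    (\<forall>\<phi>\<in>(Lp_ball p :: (real ^ 'd \<Rightarrow> complex) set). \<exists>c. \<forall>x. norm (torus_convolution \<phi>
        (bernoulli_kernel_multi r) x
       - (\<Sum>i\<in>I. c i * tpoly (Q i) (b i) x)) \<le> C * (2 powr (- r * real n) * real n powr \<omega>))"
    if n: "1 \<le> n" for n
  proof -
    have n1: "1 \<le> real n" using n by simp
    \<comment> \<open>Balancing \<open>2 powr (a / 2) * sqrt n\<close> with
      \<open>n powr (D - 1)\<close> gives \<open>2 powr a = n powr (2 * D - 3)\<close>, up to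
      rounding \<open>a\<close> to an integer.\<close>
    obtain a :: nat where a: "real n powr (2 * D - 3) \<le> 2 ^ a" "2 ^ a \<le> 2 * real n powr (2 * D - 3)"
      by (rule exists_dyadic_between[of "real n powr (2 * D - 3)"]) (use n1 D in \<open>auto intro!:
          ge_one_powr_ge_zero\<close>)
    define E where "E = 2 powr (- r * real n) * real n powr \<omega>"
    have E: "0 < E" using n1 by (simp add: E_def)
    define L where "L = B * n"
    have nL: "n \<le> L" by (simp add: L_def B_def)
    define \<delta> where "\<delta> l = real l - real (n + a)" for l
    define V where "V = 2 ^ n * real n ^ (CARD('d) - 1)"
    have V: "0 < V" using n1 by (simp add: V_def)
    define M where "M l = nat \<lceil>V * 2 powr (- \<kappa> * \<bar>\<delta> l\<bar>)\<rceil>" for l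
    have M: "V * 2 powr (- \<kappa> * \<bar>\<delta> l\<bar>) \<le> real (M l)" "real (M l) \<le> V * 2 powr (- \<kappa> * \<bar>\<delta> l\<bar>) + 1"
        for l
    proof -
      have pos: "0 < V * 2 powr (- \<kappa> * \<bar>\<delta> l\<bar>)" using V by simp
      show "V * 2 powr (- \<kappa> * \<bar>\<delta> l\<bar>) \<le> real (M l)" unfolding M_def by (rule real_nat_ceiling_ge)
      show "real (M l) \<le> V * 2 powr (- \<kappa> * \<bar>\<delta> l\<bar>) + 1" unfolding M_def using pos by linarith
    qed
    have M0: "0 < M l" for l
    proof -
      have "0 < V * 2 powr (- \<kappa> * \<bar>\<delta> l\<bar>)" using V by simp
      then have "0 < real (M l)" using M(1)[of l] by linarith
      then show ?thesis by simp
    qed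
    \<comment> \<open>The random part at the critical layer; the factor 2 is due to the rounding of
      \<open>a\<close>. \<open>P2\<close> is its counterpart for the bounded part, with the same
      exponent \<open>\<omega>\<close>.\<close>
    have P1: "sqrt (real n) * 2 powr ((1 / 2 - r) * real a) \<le> 2 * real n powr \<omega>"
    proof -
      have "2 powr ((1 / 2 - r) * real a) = (2 ^ a) powr (1 / 2 - r)"
        by (simp add: powr_realpow[symmetric] powr_powr mult.commute)
      also have "\<dots> \<le> (2 * real n powr (2 * D - 3)) powr (1 / 2 - r)"
        using a r by (intro powr_mono2) auto
      also have "\<dots> = 2 powr (1 / 2 - r) * real n powr ((2 * D - 3) * (1 / 2 - r))"
        by (simp add: powr_mult powr_powr)
      also have "\<dots> \<le> 2 powr 1 * real n powr ((2 * D - 3) * (1 / 2 - r))"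
        using r0 r by (intro mult_right_mono powr_mono) auto
      finally have "sqrt (real n) * 2 powr ((1 / 2 - r) * real a)
         \<le> real n powr (1 / 2) * (2 * real n powr ((2 * D - 3) * (1 / 2 - r)))"
        unfolding powr_half_sqrt[OF order_trans[OF zero_le_one n1], symmetric]
            by (intro mult_left_mono) auto
      also have "\<dots> = 2 * real n powr (1 / 2 + (2 * D - 3) * (1 / 2 - r))"
        by (simp add: powr_add)
      also have "1 / 2 + (2 * D - 3) * (1 / 2 - r) = \<omega>"
        by (simp add: \<omega>_def D_def algebra_simps)
      finally show ?thesis .
    qed
    have P2: "real n ^ (CARD('d) - 1) * 2 powr (- r * real a) \<le> real n powr \<omega>"
    proof -
      have "2 powr (- r * real a) = (2 ^ a) powr (- r)"
        by (simp add: powr_realpow[symmetric] powr_powr mult.commute)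
      also have "\<dots> \<le> (real n powr (2 * D - 3)) powr (- r)"
        using a r0 n1 by (intro powr_mono2') auto
      finally have "real n ^ (CARD('d) - 1) * 2 powr (- r * real a)
          \<le> real n powr (D - 1) * real n powr ((2 * D - 3) * (- r))"
        using n1 d by (simp add: powr_realpow[symmetric] powr_powr D_def of_nat_diff mult_left_mono)
      also have "\<dots> = real n powr \<omega>"
        by (simp add: powr_add[symmetric] \<omega>_def D_def algebra_simps)
      finally show ?thesis .
    qed
    have lb: "real (l + 1) \<le> b * real n" if "l \<in> {n<..L}" for l
    proof -
      have "real (l + 1) \<le> real (B * n) + 1" using that by (simp add: L_def del: of_nat_mult)
      also have "\<dots> \<le> b * real n" using n1 by (simp add: b_def algebra_simps)
      finally show ?thesis .
    qed
    \<comment> \<open>Of the \<open>CARD('d)\<close> powers of \<open>n\<close>, all but one cancel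
      against \<open>V\<close>, which leaves \<open>sqrt n\<close>; the reduced dimension costs
      \<open>2 powr (\<kappa> * \<bar>\<delta> l\<bar> / 2)\<close>.\<close>
    have main_sqrt: "sqrt (2 ^ l * real (l + 1) ^ CARD('d) / real (M l))
       \<le> sqrt (b ^ CARD('d)) * (sqrt (real n) * 2 powr ((real l - real n) / 2 + \<kappa> * \<bar>\<delta> l\<bar> / 2))"
      if l: "l \<in> {n<..L}" for l
    proof -
      have "2 ^ l * real (l + 1) ^ CARD('d) / real (M l)
         \<le> 2 ^ l * (b * real n) ^ CARD('d) / (V * 2 powr (- \<kappa> * \<bar>\<delta> l\<bar>))"
        using lb[OF l] M(1)[of l] V by (intro frac_le mult_left_mono power_mono) auto
      also have "\<dots> = b ^ CARD('d) * (real n * (2 powr (real l - real n) * 2 powr (\<kappa> * \<bar>\<delta> l\<bar>)))"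
      proof -
        have "real n ^ CARD('d) = real n ^ (CARD('d) - 1) * real n"
          by (rule power_minus_mult[symmetric]) simp
        then show ?thesis using n1
          by (simp add: V_def power_mult_distrib powr_diff powr_realpow powr_minus field_simps)
      qed
      finally have "sqrt (2 ^ l * real (l + 1) ^ CARD('d) / real (M l))
         \<le> sqrt (b ^ CARD('d) * (real n * (2 powr (real l - real n) * 2 powr (\<kappa> * \<bar>\<delta> l\<bar>))))"
        by (rule real_sqrt_le_mono)
      also have "\<dots> = sqrt (b ^ CARD('d)) * (sqrt (real n) * sqrt (2 powr ((real l - real n) + \<kappa> * \<bar>\<delta>
          l\<bar>)))"
        by (simp only: real_sqrt_mult powr_add)
      also have "sqrt (2 powr ((real l - real n) + \<kappa> * \<bar>\<delta> l\<bar>))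
          = 2 powr ((real l - real n) / 2 + \<kappa> * \<bar>\<delta> l\<bar> / 2)"
        by (simp add: powr_half_sqrt[symmetric] powr_powr add_divide_distrib)
      finally show ?thesis .
    qed
    have "\<exists>g. \<forall>\<phi>\<in>Lp_ball p. \<exists>z. \<forall>x. norm (layer_conv r l \<phi> x - (\<Sum>j<M l. z j * tpoly (lfreq l) (g j
        :: ('d \<Rightarrow> int) \<Rightarrow> complex) x))
        \<le> C2 * E * 2 powr (- \<eta> * \<bar>\<delta> l\<bar>)" if l: "l \<in> {n<..L}" for l
    proof -
      define X where "X = sqrt (2 ^ l * real (l + 1) ^ CARD('d) / real (M l))"
      have rl: "2 powr (- r * real l) = 2 powr (- r * real n) * 2 powr (- r * (real l - real n))"
        by (simp add: powr_add[symmetric] algebra_simps)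
      \<comment> \<open>\<open>w\<close> stands for the size in L_2 of the part given to the random
        subspace: 1 without truncation, \<open>t powr (1 - p / 2)\<close> with it. The condition on
        \<open>u\<close> says that the exponents relative to the critical layer add up to
        decay.\<close>
      have X_bound: "2 powr (- r * real l) * w * X
          \<le> 2 * sqrt (b ^ CARD('d)) * E * 2 powr (- \<eta> * \<bar>\<delta> l\<bar>)"
        if w: "w = 2 powr u" "u + (1 / 2 - r) * \<delta> l + \<kappa> * \<bar>\<delta> l\<bar> / 2 \<le> - \<eta> * \<bar>\<delta> l\<bar>" for w u
      proof -
        have "2 powr (- r * (real l - real n)) * 2 powr u * 2 powr ((real l - real n) / 2 + \<kappa> * \<bar>\<delta>
            l\<bar> / 2)
            = 2 powr ((1 / 2 - r) * real a + (u + (1 / 2 - r) * \<delta> l + \<kappa> * \<bar>\<delta> l\<bar> / 2))"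
          unfolding powr_add[symmetric] by (rule arg_cong[of _ _ "\<lambda>t. 2 powr t"]) (simp add: \<delta>_def
              field_simps)
        also have "\<dots> \<le> 2 powr ((1 / 2 - r) * real a + (- \<eta> * \<bar>\<delta> l\<bar>))"
          using w by (intro powr_mono) auto
        also have "\<dots> = 2 powr ((1 / 2 - r) * real a) * 2 powr (- \<eta> * \<bar>\<delta> l\<bar>)"
          by (rule powr_add)
        finally have step: "2 powr (- r * (real l - real n)) * 2 powr u * 2 powr ((real l - real n)
            / 2 + \<kappa> * \<bar>\<delta> l\<bar> / 2)
            \<le> 2 powr ((1 / 2 - r) * real a) * 2 powr (- \<eta> * \<bar>\<delta> l\<bar>)" .
        have "2 powr (- r * real l) * w * X
          \<le> 2 powr (- r * real l) * w * (sqrt (b ^ CARD('d)) * (sqrt (real n) * 2 powr ((real l -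
              real n) / 2 + \<kappa> * \<bar>\<delta> l\<bar> / 2)))"
          unfolding X_def using w by (intro mult_left_mono main_sqrt[OF l]) auto
        also have "\<dots> = sqrt (b ^ CARD('d)) * (2 powr (- r * real n) * (sqrt (real n) *
            (2 powr (- r * (real l - real n)) * 2 powr u * 2 powr ((real l - real n) / 2 + \<kappa> * \<bar>\<delta> l\<bar>
                / 2))))"
          by (simp only: rl w mult_ac)
        also have "\<dots> \<le> sqrt (b ^ CARD('d)) * (2 powr (- r * real n) * (sqrt (real n) *
            (2 powr ((1 / 2 - r) * real a) * 2 powr (- \<eta> * \<bar>\<delta> l\<bar>))))"
          using b1 by (intro mult_left_mono step) auto
        also have "\<dots> = sqrt (b ^ CARD('d)) * (2 powr (- r * real n) *
            ((sqrt (real n) * 2 powr ((1 / 2 - r) * real a)) * 2 powr (- \<eta> * \<bar>\<delta> l\<bar>)))"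
          by (simp only: mult.assoc)
        also have "\<dots> \<le> sqrt (b ^ CARD('d)) * (2 powr (- r * real n) * ((2 * real n powr \<omega>) * 2 powr
            (- \<eta> * \<bar>\<delta> l\<bar>)))"
          using b1 by (intro mult_left_mono mult_right_mono P1) auto
        finally show ?thesis by (simp add: E_def mult_ac)
      qed
      obtain g :: "nat \<Rightarrow> ('d \<Rightarrow> int) \<Rightarrow> complex" where
        g1: "\<And>\<phi>. \<phi> \<in> Lp_ball p \<Longrightarrow> \<exists>z. \<forall>x. norm (layer_conv r l \<phi> x - (\<Sum>j<M l. z j * tpoly (lfreq l)
            (g j) x))
          \<le> 2 * K * 2 powr (- r * real l) * X" and
        g2: "\<And>\<phi> t. \<phi> \<in> Lp_ball p \<Longrightarrow> 0 < t \<Longrightarrow> \<exists>z. \<forall>x. norm (layer_conv r l \<phi> x - (\<Sum>j<M l. z j * tpoly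
            (lfreq l) (g j) x))
          \<le> K * 2 powr (- r * real l) * t powr (1 - p / 2) * X
            + C1 * 2 powr (- r * real l) * (real (l + 1) ^ (CARD('d) - 1) * t)"
        unfolding K_def C1_def X_def using r by (rule_tac layer_width[OF M0[of l] r0 _ p, of l])
            auto
      have "\<exists>z. \<forall>x. norm (layer_conv r l \<phi> x - (\<Sum>j<M l. z j * tpoly (lfreq l) (g j) x))
        \<le> C2 * E * 2 powr (- \<eta> * \<bar>\<delta> l\<bar>)" if \<phi>: "\<phi> \<in> Lp_ball p" for \<phi>
      proof (cases "\<delta> l \<le> 0")
        \<comment> \<open>Up to the critical layer the whole of \<open>\<phi>\<close> goes to the
          random subspace; the growth rate \<open>1 / 2 - r\<close> acts as decay towards smaller
          \<open>l\<close>.\<close>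
        case True
        have "0 + (1 / 2 - r) * \<delta> l + \<kappa> * \<bar>\<delta> l\<bar> / 2 = (1 / 2 - r - \<kappa> / 2) * \<delta> l"
          using True by (simp add: algebra_simps)
        also have "\<dots> \<le> \<eta> * \<delta> l" using True \<eta> by (intro mult_right_mono_neg) auto
        finally have "2 powr (- r * real l) * 1 * X
            \<le> 2 * sqrt (b ^ CARD('d)) * E * 2 powr (- \<eta> * \<bar>\<delta> l\<bar>)"
          using True by (intro X_bound[of 1 0]) auto
        then have "2 * K * (2 powr (- r * real l) * 1 * X)
            \<le> 2 * K * (2 * sqrt (b ^ CARD('d)) * E * 2 powr (- \<eta> * \<bar>\<delta> l\<bar>))"
          using K by (intro mult_left_mono) auto
        also have "\<dots> = (4 * K * sqrt (b ^ CARD('d))) * E * 2 powr (- \<eta> * \<bar>\<delta> l\<bar>)" by simp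
        also have "\<dots> \<le> C2 * E * 2 powr (- \<eta> * \<bar>\<delta> l\<bar>)"
          unfolding C2_def using E C1 b1 by (intro mult_right_mono) auto
        finally have "2 * K * 2 powr (- r * real l) * X \<le> C2 * E * 2 powr (- \<eta> * \<bar>\<delta> l\<bar>)"
          by (simp only: mult.assoc mult_1_left)
        then show ?thesis using g1[OF \<phi>] by (meson order_trans)
      next
        case False
        define t where "t = 2 powr (\<theta> * \<delta> l)"
        have t: "0 < t" by (simp add: t_def)
        \<comment> \<open>By \<open>\<theta> * p = 1 + \<kappa>\<close> the random part decays
          exactly like the bounded part, at the rate \<open>r - \<theta>\<close>.\<close>
        have exps: "\<theta> * \<delta> l * (1 - p / 2) + (1 / 2 - r) * \<delta> l + \<kappa> * \<bar>\<delta> l\<bar> / 2 = - ((r - \<theta>) * \<delta> l)"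
        proof -
          have "\<theta> * \<delta> l * (1 - p / 2) = \<theta> * \<delta> l - (\<theta> * p) * \<delta> l / 2" by (simp add: algebra_simps)
          then show ?thesis using False unfolding \<theta>p by (simp add: algebra_simps)
        qed
        have \<eta>\<delta>: "\<eta> * \<delta> l \<le> (r - \<theta>) * \<delta> l" using False \<eta> by (intro mult_right_mono) auto
        have "2 powr (- r * real l) * t powr (1 - p / 2) * X
            \<le> 2 * sqrt (b ^ CARD('d)) * E * 2 powr (- \<eta> * \<bar>\<delta> l\<bar>)"
          using exps \<eta>\<delta> False by (intro X_bound[of _ "\<theta> * \<delta> l * (1 - p / 2)"]) (auto simp: t_def
              powr_powr)
        then have "K * (2 powr (- r * real l) * t powr (1 - p / 2) * X)
            \<le> K * (2 * sqrt (b ^ CARD('d)) * E * 2 powr (- \<eta> * \<bar>\<delta> l\<bar>))"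
          using K by (intro mult_left_mono) auto
        also have "\<dots> \<le> K * (4 * sqrt (b ^ CARD('d)) * E * 2 powr (- \<eta> * \<bar>\<delta> l\<bar>))"
          using K E b1 by (intro mult_left_mono mult_right_mono) auto
        finally have T1: "K * 2 powr (- r * real l) * t powr (1 - p / 2) * X
            \<le> 4 * K * sqrt (b ^ CARD('d)) * E * 2 powr (- \<eta> * \<bar>\<delta> l\<bar>)"
          by (simp only: mult_ac)
        have "2 powr (- r * (real l - real n)) * t
            = 2 powr (- r * real a) * 2 powr (- ((r - \<theta>) * \<delta> l))"
          unfolding t_def powr_add[symmetric] by (rule arg_cong[of _ _ "\<lambda>t. 2 powr t"]) (simp add:
              \<delta>_def algebra_simps)
        also have "\<dots> \<le> 2 powr (- r * real a) * 2 powr (- \<eta> * \<bar>\<delta> l\<bar>)"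
          using \<eta>\<delta> False by (intro mult_left_mono powr_mono) auto
        finally have t_le: "2 powr (- r * (real l - real n)) * t
            \<le> 2 powr (- r * real a) * 2 powr (- \<eta> * \<bar>\<delta> l\<bar>)" .
        have "C1 * 2 powr (- r * real l) * (real (l + 1) ^ (CARD('d) - 1) * t)
           = C1 * 2 powr (- r * real n) * (real (l + 1) ^ (CARD('d) - 1) * (2 powr (- r * (real l -
               real n)) * t))"
          by (simp only: rl mult_ac)
        also have "\<dots> \<le> C1 * 2 powr (- r * real n) * ((b * real n) ^ (CARD('d) - 1) * (2 powr (- r *
            real a) * 2 powr (- \<eta> * \<bar>\<delta> l\<bar>)))"
          using C1 t b1 by (intro mult_left_mono mult_mono power_mono lb[OF l] t_le) auto
        also have "\<dots> = C1 * b ^ (CARD('d) - 1) * 2 powr (- r * real n) * ((real n ^ (CARD('d) - 1) *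
            2 powr (- r * real a)) * 2 powr (- \<eta> * \<bar>\<delta> l\<bar>))"
          by (simp only: power_mult_distrib mult_ac)
        also have "\<dots> \<le> C1 * b ^ (CARD('d) - 1) * 2 powr (- r * real n) * (real n powr \<omega> * 2 powr (-
            \<eta> * \<bar>\<delta> l\<bar>))"
          using C1 b1 by (intro mult_left_mono mult_right_mono P2) auto
        finally have "C1 * 2 powr (- r * real l) * (real (l + 1) ^ (CARD('d) - 1) * t)
            \<le> C1 * b ^ (CARD('d) - 1) * E * 2 powr (- \<eta> * \<bar>\<delta> l\<bar>)"
          by (simp only: E_def mult_ac)
        with T1 have "K * 2 powr (- r * real l) * t powr (1 - p / 2) * X + C1 * 2 powr (- r * real
            l) * (real (l + 1) ^ (CARD('d) - 1) * t)
           \<le> C2 * E * 2 powr (- \<eta> * \<bar>\<delta> l\<bar>)"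
          unfolding C2_def distrib_right by (rule add_mono)
        then show ?thesis using g2[OF \<phi> t] by (meson order_trans)
      qed
      then show ?thesis by blast
    qed
    then have "\<exists>g. \<forall>l\<in>{n<..L}. \<forall>\<phi>\<in>Lp_ball p. \<exists>z. \<forall>x. norm (layer_conv r l \<phi> x - (\<Sum>j<M l. z j * tpoly
        (lfreq l) (g l j :: ('d \<Rightarrow> int) \<Rightarrow> complex) x))
        \<le> C2 * E * 2 powr (- \<eta> * \<bar>\<delta> l\<bar>)"
      by (intro bchoice) auto
    then obtain g :: "nat \<Rightarrow> nat \<Rightarrow> ('d \<Rightarrow> int) \<Rightarrow> complex" where
      g: "\<And>l \<phi>. l \<in> {n<..L} \<Longrightarrow> \<phi> \<in> Lp_ball p \<Longrightarrow> \<exists>z. \<forall>x. norm (layer_conv r l \<phi> x - (\<Sum>j<M l. z j *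
          tpoly (lfreq l) (g l j) x))
        \<le> C2 * E * 2 powr (- \<eta> * \<bar>\<delta> l\<bar>)"
      by blast
    define I where "I = (low_freq n :: ('d \<Rightarrow> int) set) <+> Sigma {n<..L} (\<lambda>l. {..<M l})"
    define Q where "Q i = (case i of Inl k \<Rightarrow> {k} | Inr (l, j) \<Rightarrow> lfreq l)"
        for i :: "('d \<Rightarrow> int) + nat \<times> nat"
    define bb where "bb i = (case i of Inl k \<Rightarrow> (\<lambda>_. 1) | Inr (l, j) \<Rightarrow> g l j)"
        for i :: "('d \<Rightarrow> int) + nat \<times> nat"
    have Qb: "tpoly (Q i) (bb i) x = (case i of Inl k \<Rightarrow> texp k x | Inr (l, j) \<Rightarrow> tpoly (lfreq l) (g l
        j) x)" for i x
      by (auto simp: Q_def bb_def tpoly_def split: sum.splits prod.splits)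
    have card_I: "real (card I) \<le> A * V"
    proof -
      have sumM: "(\<Sum>l\<in>{n<..L}. 2 powr (- \<kappa> * \<bar>\<delta> l\<bar>)) \<le> 2 / (1 - 2 powr (- \<kappa>))"
        unfolding \<delta>_def using \<kappa> by (intro sum_powr_abs_le) auto
      have "real (card I) = real (card (low_freq n :: ('d \<Rightarrow> int) set)) + (\<Sum>l\<in>{n<..L}. real (M l))"
        by (simp add: I_def card_Plus card_SigmaI)
      also have "\<dots> \<le> 2 * 5 ^ CARD('d) * (2 ^ n * real (n + 1) ^ (CARD('d) - 1)) + (\<Sum>l\<in>{n<..L}. V * 2
          powr (- \<kappa> * \<bar>\<delta> l\<bar>) + 1)"
        by (intro add_mono card_low_freq sum_mono M)
      also have "(\<Sum>l\<in>{n<..L}. V * 2 powr (- \<kappa> * \<bar>\<delta> l\<bar>) + 1)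
          = V * (\<Sum>l\<in>{n<..L}. 2 powr (- \<kappa> * \<bar>\<delta> l\<bar>)) + real (L - n)"
        by (simp add: sum.distrib sum_distrib_left)
      \<comment> \<open>Rounding up costs at most one dimension per layer, in total at most
        \<open>B * n\<close>, and \<open>n \<le> V\<close> since there are at least two
        variables.\<close>
      also have "\<dots> \<le> V * (2 / (1 - 2 powr (- \<kappa>))) + real B * V"
      proof (intro add_mono mult_left_mono sumM)
        have "real (L - n) \<le> real B * real n" by (simp add: L_def flip: of_nat_mult)
        also have "real n \<le> V"
        proof -
          have "1 * real n ^ 1 \<le> 2 ^ n * real n ^ (CARD('d) - 1)"
            using n1 d by (intro mult_mono power_increasing) auto
          then show ?thesis by (simp add: V_def)
        qed
        finally show "real (L - n) \<le> real B * V" by (simp add: mult_left_mono)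
      qed (use V in auto)
      also have "2 * 5 ^ CARD('d) * (2 ^ n * real (n + 1) ^ (CARD('d) - 1))
          \<le> 2 * 5 ^ CARD('d) * (2 ^ n * (2 * real n) ^ (CARD('d) - 1))"
        using n1 by (intro mult_left_mono power_mono) auto
      also have "\<dots> = 2 * 5 ^ CARD('d) * 2 ^ (CARD('d) - 1) * V"
        by (simp only: V_def power_mult_distrib mult_ac)
      finally show ?thesis by (simp add: A_def algebra_simps)
    qed
    have approx: "\<exists>c. \<forall>x. norm (torus_convolution \<phi> (bernoulli_kernel_multi r) x - (\<Sum>i\<in>I. c i *
        tpoly (Q i) (bb i) x)) \<le> C * E"
      if \<phi>: "\<phi> \<in> Lp_ball p" for \<phi>
    proof -
      have "\<exists>c. \<forall>x. norm (torus_convolution \<phi> (bernoulli_kernel_multi r) x - (\<Sum>i\<in>I. c i * tpoly (Q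
          i) (bb i) x))
         \<le> (\<Sum>l\<in>{n<..L}. C2 * E * 2 powr (- \<eta> * \<bar>\<delta> l\<bar>)) + CT * 2 powr (- (r - 1 / p) / 2 * real (Suc
             L))"
        unfolding Qb I_def CT_def using p r r0 nL
        by (intro hyperbolic_approximation[OF \<phi>] g \<phi>) auto
      moreover have "(\<Sum>l\<in>{n<..L}. C2 * E * 2 powr (- \<eta> * \<bar>\<delta> l\<bar>)) + CT * 2 powr (- (r - 1 / p) / 2 *
          real (Suc L)) \<le> C * E"
      proof -
        have "(\<Sum>l\<in>{n<..L}. C2 * E * 2 powr (- \<eta> * \<bar>\<delta> l\<bar>))
            = C2 * E * (\<Sum>l\<in>{n<..L}. 2 powr (- \<eta> * \<bar>\<delta> l\<bar>))"
          by (simp add: sum_distrib_left)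
        also have "\<dots> \<le> C2 * E * (2 / (1 - 2 powr (- \<eta>)))"
          unfolding \<delta>_def using \<eta> C2 E by (intro mult_left_mono sum_powr_abs_le) auto
        finally have 1: "(\<Sum>l\<in>{n<..L}. C2 * E * 2 powr (- \<eta> * \<bar>\<delta> l\<bar>))
            \<le> C2 * (2 / (1 - 2 powr (- \<eta>))) * E"
          by (simp only: mult_ac)
        have "r * real n \<le> \<gamma> * real (Suc L)"
        proof -
          have "r \<le> \<gamma> * real B" using B0 \<gamma> by (simp add: B_def field_simps)
          then have "r * real n \<le> \<gamma> * real B * real n" using n1 by (intro mult_right_mono) auto
          also have "\<dots> = \<gamma> * real L" by (simp add: L_def)
          also have "\<dots> \<le> \<gamma> * real (Suc L)" using \<gamma> by (intro mult_left_mono) auto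
          finally show ?thesis .
        qed
        moreover have "- (r - 1 / p) / 2 * real (Suc L) = - (\<gamma> * real (Suc L))"
          unfolding \<gamma>_def by (simp only: minus_divide_left[symmetric] mult_minus_left)
        ultimately have "- (r - 1 / p) / 2 * real (Suc L) \<le> - r * real n"
          by (simp only: mult_minus_left neg_le_iff_le)
        then have "2 powr (- (r - 1 / p) / 2 * real (Suc L)) \<le> 2 powr (- r * real n)"
          by (intro powr_mono) auto
        also have "\<dots> \<le> E"
          unfolding E_def using n1 \<omega>0 ge_one_powr_ge_zero[of "real n" \<omega>]
              by (simp add: mult_le_cancel_left1)
        finally have "CT * 2 powr (- (r - 1 / p) / 2 * real (Suc L)) \<le> CT * E"
          using CT by (intro mult_left_mono) auto
        with 1 show ?thesis unfolding C_def distrib_right by (rule add_mono)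
      qed
      ultimately show ?thesis by (meson order_trans)
    qed
    have fin: "finite I" "\<forall>i. finite (Q i)"
      by (auto simp: I_def Q_def split: sum.splits prod.splits)
    show ?thesis
      by (intro exI[of _ I] exI[of _ Q] exI[of _ bb] conjI ballI fin
        card_I[unfolded V_def] approx[unfolded E_def])
  qed
  show ?thesis
    by (intro exI[of _ A] exI[of _ C] conjI allI impI A1 C main)
qed

section \<open>Transfer to the class and choice of the level\<close>

lemma Lp_norm_infinity_le:
  assumes "f \<in> borel_measurable borel" "\<And>x. norm (f x) \<le> E"
  shows "Lp_norm \<infinity> f \<le> ennreal E"
  unfolding Lp_norm_def using assms by (auto intro!: esssup_I ennreal_leI)

lemma torus_periodic_tpoly: "torus_periodic (tpoly Q b)"
proof -
  have "texp k (x + axis i (2 * pi)) = texp k x" for k x and i :: 'a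
    using torus_periodic_texp[of k] unfolding torus_periodic_def by blast
  then show ?thesis by (simp add: torus_periodic_def tpoly_def)
qed

lemma tpoly_mem_Lp_space: "tpoly Q b \<in> Lp_space \<infinity>"
  using order.strict_trans1[OF Lp_norm_infinity_le[OF measurable_tpoly norm_tpoly_le]
      ennreal_less_top]
  by (simp add: Lp_space_def torus_periodic_tpoly)

text \<open>On a probability space the unit ball of \<open>L_\<infinity>\<close> lies in that of
  every finite exponent, so the infinite case reduces to some finite \<open>p'\<close>; as
  \<open>1 / p' < r\<close> is strict, such a \<open>p' > 2\<close> exists. The choice
  \<open>max 3 (2 / r)\<close> gives \<open>1 / p' \<le> r / 2\<close>.\<close>

lemma W_class_representation:
  fixes p :: ennreal
  assumes p: "2 < p" and r: "1 / p < ennreal r"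
  obtains p' :: real where "2 < p'" "1 / p' < r"
    "\<And>f. f \<in> (W_class r p :: (real ^ 'd::finite \<Rightarrow> complex) set) \<Longrightarrow>
      \<exists>\<phi>\<in>Lp_ball p'. f = torus_convolution \<phi> (bernoulli_kernel_multi r)"
proof (cases "p = \<infinity>")
  case True
  have r0: "0 < r" using r by (simp add: True)
  define p' where "p' = max 3 (2 / r)"
  show ?thesis
  proof (rule that[of p'])
    show "2 < p'" by (simp add: p'_def)
    have "2 / r \<le> p'" by (simp add: p'_def)
    then have "2 \<le> p' * r" using r0 by (simp add: field_simps)
    then show "1 / p' < r" using \<open>2 < p'\<close> by (simp add: field_simps)
    fix f :: "real ^ 'd \<Rightarrow> complex" assume "f \<in> W_class r p"
    then obtain \<phi> where \<phi>: "f = torus_convolution \<phi> (bernoulli_kernel_multi r)"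
      "\<phi> \<in> borel_measurable borel" "Lp_norm p \<phi> \<le> 1"
      by (auto simp: W_class_def Lp_space_def)
    have le1: "esssup torus_measure (\<lambda>y. ennreal (norm (\<phi> y))) \<le> 1"
      using \<phi>(3) by (simp add: Lp_norm_def True)
    have "AE y in torus_measure. ennreal (norm (\<phi> y)) \<le> 1"
      using esssup_AE[of "\<lambda>y. ennreal (norm (\<phi> y))" torus_measure]
    proof eventually_elim
      case (elim y)
      then show ?case using le1 by (rule order_trans)
    qed
    then have "AE y in torus_measure. ennreal (norm (\<phi> y) powr p') \<le> 1"
    proof eventually_elim
      case (elim y)
      then have "norm (\<phi> y) powr p' \<le> 1 powr p'"
        using \<open>2 < p'\<close> by (intro powr_mono2) auto
      then show ?case by simp
    qed
    then have "(\<integral>\<^sup>+ y. ennreal (norm (\<phi> y) powr p') \<partial>torus_measure)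
        \<le> (\<integral>\<^sup>+ y. 1 \<partial>(torus_measure :: (real ^ 'd) measure))"
      by (rule nn_integral_mono_AE)
    also have "\<dots> = 1" using torus.emeasure_space_1[where 'd = 'd] by simp
    finally show "\<exists>\<phi>\<in>Lp_ball p'. f = torus_convolution \<phi> (bernoulli_kernel_multi r)"
      using \<phi> by (auto simp: Lp_ball_def)
  qed
next
  case False
  define p' where "p' = enn2real p"
  have pp: "p = ennreal p'" using False by (simp add: p'_def less_top)
  have p'0: "0 \<le> p'" by (simp add: p'_def)
  have p'2: "2 < p'"
  proof -
    have "ennreal 2 < ennreal p'" using p pp by simp
    then show ?thesis by (subst (asm) ennreal_less_iff) auto
  qed
  show ?thesis
  proof (rule that[OF p'2])
    have "ennreal (1 / p') < ennreal r"
      using r p'2 unfolding pp by (subst (asm) divide_ennreal[of 1, simplified]) auto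
    then show "1 / p' < r" using p'2 by (subst (asm) ennreal_less_iff) auto
    fix f :: "real ^ 'd \<Rightarrow> complex" assume "f \<in> W_class r p"
    then obtain \<phi> where \<phi>: "f = torus_convolution \<phi> (bernoulli_kernel_multi r)"
      "\<phi> \<in> borel_measurable borel" "Lp_norm p \<phi> \<le> 1"
      by (auto simp: W_class_def Lp_space_def)
    define J where "J = (\<integral>\<^sup>+ y. ennreal (norm (\<phi> y) powr p') \<partial>torus_measure)"
    have "(if J = \<infinity> then \<infinity> else ennreal (enn2real J powr (1 / p'))) \<le> 1"
      using \<phi>(3) unfolding Lp_norm_def Let_def J_def p'_def if_not_P[OF False] .
    then have J: "J \<noteq> \<infinity>" "enn2real J powr (1 / p') \<le> 1"
      by (auto split: if_splits simp: top_unique)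
    have "enn2real J \<le> 1"
    proof (rule ccontr)
      assume "\<not> ?thesis"
      then have "1 powr (1 / p') < enn2real J powr (1 / p')" using p'2
          by (intro powr_less_mono2) auto
      then show False using J by simp
    qed
    then have "ennreal (enn2real J) \<le> ennreal 1" by (rule ennreal_leI)
    then have "J \<le> 1" using J by (simp add: less_top)
    then show "\<exists>\<phi>\<in>Lp_ball p'. f = torus_convolution \<phi> (bernoulli_kernel_multi r)"
      using \<phi> by (auto simp: Lp_ball_def J_def)
  qed
qed

text \<open>Bounds the error of the zero subspace, which settles the finitely many small
  \<open>m\<close>.\<close>

lemma norm_convolution_bernoulli_le:
  fixes \<phi> :: "real ^ 'd::finite \<Rightarrow> complex"
  assumes \<phi>: "\<phi> \<in> Lp_ball p" and p: "1 \<le> p" and r: "1 / p < r" "r < 1"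
  shows "norm (torus_convolution \<phi> (bernoulli_kernel_multi r) x)
    \<le> (1200 ^ CARD('d) + 9 ^ CARD('d)) * (1 / (1 - 2 powr (- (r - 1 / p) / 2))) ^ CARD('d)"
proof (rule LIMSEQ_le_const2)
  show "(\<lambda>S. norm (\<Sum>s\<in>(\<Pi>\<^sub>E j\<in>UNIV. {..S}). torus_convolution \<phi> (mkap r s) x))
      \<longlonglongrightarrow> norm (torus_convolution \<phi> (bernoulli_kernel_multi r) x)"
    by (intro tendsto_norm convolution_bernoulli_LIMSEQ[OF \<phi> p r])
  show "\<exists>N. \<forall>S\<ge>N. norm (\<Sum>s\<in>(\<Pi>\<^sub>E j\<in>UNIV. {..S}). torus_convolution \<phi> (mkap r s) x)
     \<le> (1200 ^ CARD('d) + 9 ^ CARD('d)) * (1 / (1 - 2 powr (- (r - 1 / p) / 2))) ^ CARD('d)"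
    using norm_high_blocks_le[OF \<phi> p r, where L = 0 and x = x] by simp
qed

theorem theorem3p2:
  fixes p :: ennreal and r :: real
  assumes "CARD('d::finite) \<ge> 2"
    and "2 < p"
    and "1 / p < ennreal r" and "r < 1 / 2"
  shows "\<exists>C::real. C > 0 \<and> (\<forall>m::nat. m \<ge> 2 \<longrightarrow>
           kolmogorov_width m (W_class r p :: (real ^ 'd \<Rightarrow> complex) set) (Lp_space \<infinity>) (Lp_norm \<infinity>)
             \<le> ennreal (C * real m powr (- r)
                  * ln (real m) powr ((real CARD('d) - 2) * (1 - r) + 1)))"
proof -
  obtain p' :: real where p': "2 < p'" "1 / p' < r"
    and rep: "\<And>f. f \<in> (W_class r p :: (real ^ 'd \<Rightarrow> complex) set) \<Longrightarrow>
      \<exists>\<phi>\<in>Lp_ball p'. f = torus_convolution \<phi> (bernoulli_kernel_multi r)"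
    by (rule W_class_representation[OF assms(2,3), where 'd = 'd]) blast
  have r0: "0 < r" using p' by (intro less_trans[OF _ p'(2)]) auto
  have r1: "r < 1" using assms(4) by simp
  have p'1: "1 \<le> p'" using p' by simp
  define D where "D = real CARD('d)"
  have D: "2 \<le> D" using assms(1) by (simp add: D_def)
  define \<omega> where "\<omega> = (D - 1) - r * (2 * D - 3)"
  define e where "e = (D - 2) * (1 - r) + 1"
  have e: "0 < e" using D r1 by (simp add: e_def add_nonneg_pos)
  \<comment> \<open>Expressing \<open>2 powr (- r * n)\<close> by \<open>m powr (- r)\<close> costs
    \<open>n powr (r * (D - 1))\<close>; this is the resulting exponent of the logarithm.\<close>
  have \<omega>e: "\<omega> + r * (D - 1) = e" by (simp add: \<omega>_def e_def algebra_simps)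
  obtain A C where AC: "1 \<le> A" "0 < C" and lev: "\<And>n. 1 \<le> n \<Longrightarrow>
      \<exists>(I :: (('d \<Rightarrow> int) + nat \<times> nat) set) Q b. finite I \<and>
      real (card I) \<le> A * (2 ^ n * real n ^ (CARD('d) - 1)) \<and> (\<forall>i. finite (Q i)) \<and>
      (\<forall>\<phi>\<in>(Lp_ball p' :: (real ^ 'd \<Rightarrow> complex) set). \<exists>c. \<forall>x. norm (torus_convolution \<phi>
          (bernoulli_kernel_multi r) x
       - (\<Sum>i\<in>I. c i * tpoly (Q i) (b i) x)) \<le> C * (2 powr (- r * real n) * real n powr \<omega>))"
    using level_width[OF assms(1) p' assms(4)] unfolding \<omega>_def D_def by blast
  have width: "kolmogorov_width m (W_class r p :: (real ^ 'd \<Rightarrow> complex) set) (Lp_space \<infinity>) (Lp_norm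
      \<infinity>) \<le> ennreal E"
    if I: "finite I" "card I \<le> m"
      and app: "\<And>\<phi> :: real ^ 'd \<Rightarrow> complex. \<phi> \<in> Lp_ball p' \<Longrightarrow>
       \<exists>c. \<forall>x. norm (torus_convolution \<phi> (bernoulli_kernel_multi r) x
       - (\<Sum>i\<in>I. c i * tpoly (Q i) (b i) x)) \<le> E"
    for I :: "(('d \<Rightarrow> int) + nat \<times> nat) set" and m Q b E
  proof (rule kolmogorov_width_le[OF I, where u = "\<lambda>i. tpoly (Q i) (b i)"])
    show "(\<lambda>_. 0) \<in> (Lp_space \<infinity> :: (real ^ 'd \<Rightarrow> complex) set)"
      using tpoly_mem_Lp_space[of "{}"] by (simp add: tpoly_def[abs_def])
    fix f :: "real ^ 'd \<Rightarrow> complex" assume "f \<in> W_class r p"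
    then obtain \<phi> where \<phi>: "\<phi> \<in> Lp_ball p'" "f = torus_convolution \<phi> (bernoulli_kernel_multi r)"
      using rep by blast
    obtain c where c: "\<And>x. norm (f x - (\<Sum>i\<in>I. c i * tpoly (Q i) (b i) x)) \<le> E"
      using app[OF \<phi>(1)] \<phi>(2) by blast
    have [measurable]: "f \<in> borel_measurable borel"
      unfolding \<phi>(2) by (rule measurable_convolution_bernoulli[OF \<phi>(1) p'1 p'(2) r1])
    show "\<exists>c. Lp_norm \<infinity> (\<lambda>x. f x - (\<Sum>i\<in>I. c i * tpoly (Q i) (b i) x)) \<le> ennreal E"
      by (intro exI[of _ c] Lp_norm_infinity_le c) measurable
  qed (rule tpoly_mem_Lp_space)
  define C0 where "C0 = (1200 ^ CARD('d) + 9 ^ CARD('d)) * (1 / (1 - 2 powr (- (r - 1 / p') / 2))) ^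
      CARD('d)"
  have C0: "0 \<le> C0"
    using p' powr_less_mono[of "- (r - 1 / p') / 2" 0 2]
        by (auto simp: C0_def intro!: mult_nonneg_nonneg)
  \<comment> \<open>Normalized so that the claimed bound is at least \<open>C0\<close> for every
    \<open>m\<close> between 2 and \<open>2 * A\<close>.\<close>
  define G where "G = C0 * ((2 * A) powr r * (1 / ln 2 powr e))"
  define F where "F = C * (A * 2 ^ CARD('d)) * 2 powr e"
  have G: "0 \<le> G" using C0 by (simp add: G_def)
  have F: "0 < F" using AC by (simp add: F_def)
  have "kolmogorov_width m (W_class r p :: (real ^ 'd \<Rightarrow> complex) set) (Lp_space \<infinity>) (Lp_norm \<infinity>)
      \<le> ennreal ((F + G) * real m powr (- r) * ln (real m) powr e)" if m: "2 \<le> m" for m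
  proof -
    have lnm: "ln 2 \<le> ln (real m)" using m by (intro ln_mono) auto
    have ln2: "(0 :: real) < ln 2" by simp
    have W: "0 \<le> real m powr (- r) * ln (real m) powr e" by simp
    show ?thesis
    proof (cases "real m < 2 * A")
      case True
      have "(2 * A) powr (- r) \<le> real m powr (- r)"
        using True m r0 by (intro powr_mono2') auto
      moreover have "ln 2 powr e \<le> ln (real m) powr e"
        using lnm e by (intro powr_mono2) auto
      ultimately have "(2 * A) powr (- r) * ln 2 powr e \<le> real m powr (- r) * ln (real m) powr e"
        by (intro mult_mono) auto
      then have "G * ((2 * A) powr (- r) * ln 2 powr e)
          \<le> G * (real m powr (- r) * ln (real m) powr e)"
        using G by (rule mult_left_mono)
      moreover have "G * ((2 * A) powr (- r) * ln 2 powr e) = C0"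
        using AC by (simp add: G_def powr_minus)
      ultimately have C0le: "C0 \<le> (F + G) * real m powr (- r) * ln (real m) powr e"
        using F W by (simp add: distrib_right mult.assoc add_increasing)
      have "kolmogorov_width m (W_class r p :: (real ^ 'd \<Rightarrow> complex) set) (Lp_space \<infinity>) (Lp_norm \<infinity>)
          \<le> ennreal C0"
      proof (rule width[of "{}"])
        fix \<phi> :: "real ^ 'd \<Rightarrow> complex" assume "\<phi> \<in> Lp_ball p'"
        then show "\<exists>c. \<forall>x. norm (torus_convolution \<phi> (bernoulli_kernel_multi r) x
          - (\<Sum>i\<in>{}. c i * tpoly {} (\<lambda>_. 0) x)) \<le> C0"
          unfolding C0_def by (simp only: sum.empty diff_zero norm_convolution_bernoulli_le[OF _ p'1
              p'(2) r1] simp_thms)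
      qed auto
      also have "\<dots> \<le> ennreal ((F + G) * real m powr (- r) * ln (real m) powr e)"
        by (rule ennreal_leI[OF C0le])
      finally show ?thesis .
    next
      case False
      \<comment> \<open>The largest admissible level is used: \<open>m < 2 * A\<close> is excluded
        here, so level 1 is admissible, and failure at \<open>Suc n\<close> bounds \<open>m\<close>
        by a multiple of \<open>2 ^ n * n ^ (CARD('d) - 1)\<close>.\<close>
      define P where "P n \<longleftrightarrow> 1 \<le> n \<and> A * (2 ^ n * real n ^ (CARD('d) - 1)) \<le> real m" for n :: nat
      have P1: "P 1" using False by (simp add: P_def mult.commute)
      have pow_le: "2 ^ n \<le> real m" if "P n" for n
      proof -
        have "1 * (2 ^ n * 1) \<le> A * (2 ^ n * real n ^ (CARD('d) - 1))"
          using AC that by (intro mult_mono one_le_power) (auto simp: P_def)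
        moreover have "A * (2 ^ n * real n ^ (CARD('d) - 1)) \<le> real m"
          using that by (simp only: P_def)
        ultimately show ?thesis by linarith
      qed
      have bdd: "n \<le> m" if "P n" for n
      proof -
        have "n < 2 ^ n" by (rule less_exp)
        moreover have "2 ^ n \<le> m" using pow_le[OF that] by (simp flip: of_nat_le_iff)
        ultimately show ?thesis by linarith
      qed
      define n where "n = (GREATEST n. P n)"
      have Pn: "P n" unfolding n_def by (rule GreatestI_nat[of P 1 m]) (use P1 bdd in auto)
      have not_Suc: "\<not> P (Suc n)"
      proof
        assume "P (Suc n)"
        from Greatest_le_nat[of P "Suc n" m, OF this bdd]
        have "Suc n \<le> n" unfolding n_def .
        then show False by simp
      qed
      have n: "1 \<le> n" using Pn by (simp add: P_def)
      have n1: "1 \<le> real n" using n by simp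
      define R where "R = A * 2 ^ CARD('d)"
      have R: "1 \<le> R" unfolding R_def using AC mult_mono[of 1 A 1 "2 ^ CARD('d)"] by simp
      have "real m < A * (2 ^ Suc n * real (Suc n) ^ (CARD('d) - 1))"
        using not_Suc by (auto simp: P_def)
      also have "\<dots> \<le> A * (2 ^ Suc n * (2 * real n) ^ (CARD('d) - 1))"
        using AC n1 by (intro mult_left_mono power_mono) auto
      also have "\<dots> = A * (2 ^ (CARD('d) - 1) * 2) * (2 ^ n * real n ^ (CARD('d) - 1))"
        by (simp add: power_mult_distrib)
      also have "(2 :: real) ^ (CARD('d) - 1) * 2 = 2 ^ CARD('d)"
        by (rule power_minus_mult) simp
      finally have "real m < R * (2 ^ n * real n ^ (CARD('d) - 1))" by (simp only: R_def)
      then have "(R * (2 ^ n * real n ^ (CARD('d) - 1))) powr (- r) \<le> real m powr (- r)"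
        using m r0 by (intro powr_mono2') auto
      also have "(R * (2 ^ n * real n ^ (CARD('d) - 1))) powr (- r)
          = R powr (- r) * (2 powr (- r * real n) * real n powr (- r * (D - 1)))"
        using R n1 assms(1)
        by (simp add: powr_mult powr_powr D_def of_nat_diff mult.commute flip: powr_realpow)
      finally have mr: "R powr (- r) * (2 powr (- r * real n) * real n powr (- r * (D - 1)))
          \<le> real m powr (- r)" .
      have "2 powr (- r * real n) = R powr r * real n powr (r * (D - 1)) * (R powr (- r) * (2 powr
          (- r * real n) * real n powr (- r * (D - 1))))"
      proof -
        have cancel: "z = x * y * (inverse x * (z * inverse y))" if "x \<noteq> 0" "y \<noteq> 0"
            for x y z :: real
          using that by (simp add: field_simps)
        show ?thesis
          unfolding mult_minus_left powr_minus by (rule cancel) (use R n in auto)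
      qed
      also have "\<dots> \<le> R powr r * real n powr (r * (D - 1)) * real m powr (- r)"
        by (intro mult_left_mono mr) auto
      also have "\<dots> \<le> R * real n powr (r * (D - 1)) * real m powr (- r)"
        using R r1 powr_mono[of r 1 R] by (intro mult_right_mono) auto
      finally have 2: "2 powr (- r * real n) \<le> R * real n powr (r * (D - 1)) * real m powr (- r)" .
      \<comment> \<open>From \<open>2 ^ n \<le> m\<close>; the factor 2 exceeds
        \<open>1 / ln 2\<close> and reappears as \<open>2 powr e\<close> in
        \<open>F\<close>.\<close>
      have n_ln: "real n \<le> 2 * ln (real m)"
      proof -
        have "real n * ln 2 = ln (2 ^ n)" by (rule ln_realpow[symmetric])
        also have "\<dots> \<le> ln (real m)" using pow_le[OF Pn] by (intro ln_mono) auto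
        finally have "real n * ln 2 \<le> ln (real m)" .
        moreover have "real n * (1 / 2) \<le> real n * ln 2"
          using ln2_ge_two_thirds by (intro mult_left_mono) auto
        ultimately show ?thesis by linarith
      qed
      have "2 powr (- r * real n) * real n powr \<omega>
          \<le> (R * real n powr (r * (D - 1)) * real m powr (- r)) * real n powr \<omega>"
        by (intro mult_right_mono 2) auto
      also have "\<dots> = R * real m powr (- r) * real n powr e"
        unfolding \<omega>e[symmetric] powr_add by (simp only: mult_ac)
      also have "\<dots> \<le> R * real m powr (- r) * (2 * ln (real m)) powr e"
        using n_ln e R by (intro mult_left_mono powr_mono2) auto
      also have "(2 * ln (real m)) powr e = 2 powr e * ln (real m) powr e"
        using lnm ln2 by (intro powr_mult)
      finally have "C * (2 powr (- r * real n) * real n powr \<omega>)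
          \<le> C * (R * real m powr (- r) * (2 powr e * ln (real m) powr e))"
        using AC by (intro mult_left_mono) auto
      also have "\<dots> = F * (real m powr (- r) * ln (real m) powr e)"
        by (simp only: F_def R_def mult_ac)
      also have "\<dots> \<le> (F + G) * (real m powr (- r) * ln (real m) powr e)"
        using G W by (intro mult_right_mono) auto
      finally have err: "C * (2 powr (- r * real n) * real n powr \<omega>)
          \<le> (F + G) * real m powr (- r) * ln (real m) powr e"
        by (simp only: mult.assoc)
      obtain I :: "(('d \<Rightarrow> int) + nat \<times> nat) set" and Q b where I: "finite I"
        "real (card I) \<le> A * (2 ^ n * real n ^ (CARD('d) - 1))"
        and app: "\<forall>\<phi>\<in>(Lp_ball p' :: (real ^ 'd \<Rightarrow> complex) set). \<exists>c. \<forall>x. norm (torus_convolution \<phi>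
            (bernoulli_kernel_multi r) x
         - (\<Sum>i\<in>I. c i * tpoly (Q i) (b i) x)) \<le> C * (2 powr (- r * real n) * real n powr \<omega>)"
        using lev[OF n] by (elim exE conjE)
      have "real (card I) \<le> real m" using I(2) Pn by (simp add: P_def)
      then have "card I \<le> m" by simp
      from width[OF I(1) this bspec[OF app]]
      have "kolmogorov_width m (W_class r p :: (real ^ 'd \<Rightarrow> complex) set) (Lp_space \<infinity>) (Lp_norm \<infinity>)
         \<le> ennreal (C * (2 powr (- r * real n) * real n powr \<omega>))" .
      also have "\<dots> \<le> ennreal ((F + G) * real m powr (- r) * ln (real m) powr e)"
        by (rule ennreal_leI[OF err])
      finally show ?thesis .
    qed
  qed
  then show ?thesis
    using F G by (intro exI[of _ "F + G"]) (auto simp: e_def D_def)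
qed

end
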